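(* For any integer $n\ge 1$, there is an object $X_n$ in $\mathsf{D}(\Lambda)$ such that the $n$-fold derived tensor product $X_n\otimes^L_\Lambda\cdots\otimes^L_\Lambda X_n$ ($n$ factors) is nonzero, while the $(n+1)$-fold derived tensor product of $X_n$ with itself is zero.
   Context: Fix a countable field $k$ and integers $n_i\ge 2$ for all $i\ge 1$. Let $\Lambda = k[x_1,x_2,x_3,\dots]/(x_i^{n_i}\ \text{for all } i)$, graded by $\deg x_i = 2^i$. All modules are graded; $\mathsf{D}(\Lambda)$ is the unbounded derived category of (cochain complexes of) graded $\Lambda$-modules with degree-preserving maps, and $\otimes^L_\Lambda$ is the derived tensor product. *)

theory Defs
  imports "HOL-Algebra.Algebra" "HOL-Algebra.Algebraic_Closure_Type" "HOL-Library.Poly_Mapping"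
begin

section \<open>The graded ring\<close>

record 'l graded_ring = "'l ring" +
  homog :: "int \<Rightarrow> 'l set"

text \<open>
  The indeterminates \<open>x\<^sub>1, x\<^sub>2, \<dots>\<close> are numbered from 0 in \<open>nat \<Rightarrow>\<^sub>0 nat\<close>: index \<open>j\<close>
  stands for \<open>x\<^bsub>j+1\<^esub>\<close>, of degree \<open>2\<^bsup>j+1\<^esup>\<close>.
\<close>

type_synonym 'k mpoly = "(nat \<Rightarrow>\<^sub>0 nat) \<Rightarrow>\<^sub>0 'k"

definition indet :: "nat \<Rightarrow> 'k::field mpoly" where
  "indet i = Poly_Mapping.single (Poly_Mapping.single (i - 1) 1) 1"

definition monom_deg :: "(nat \<Rightarrow>\<^sub>0 nat) \<Rightarrow> nat" where
  "monom_deg m = (\<Sum>j\<in>Poly_Mapping.keys m. Poly_Mapping.lookup m j * 2 ^ (j + 1))"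

definition homog_poly :: "int \<Rightarrow> 'k::field mpoly set" where
  "homog_poly d = {p. \<forall>m\<in>Poly_Mapping.keys p. int (monom_deg m) = d}"

definition trunc_ideal :: "(nat \<Rightarrow> nat) \<Rightarrow> 'k::field mpoly set" where
  "trunc_ideal e = Idl\<^bsub>ring_of_type_algebra\<^esub> {indet i ^ e i |i. i \<ge> 1}"

definition trunc_poly :: "(nat \<Rightarrow> nat) \<Rightarrow> 'k::field mpoly set graded_ring" where
  "trunc_poly e =
     ring.extend (ring_of_type_algebra Quot trunc_ideal e)
       (graded_ring.fields
         (\<lambda>d. (\<lambda>p. trunc_ideal e +>\<^bsub>ring_of_type_algebra\<^esub> p) ` homog_poly d))"


section \<open>Graded modules and cochain complexes\<close>

text \<open>
  A graded module is a family of abelian groups \<open>part M d\<close>, \<open>d \<in> \<int>\<close> (written multiplicatively, to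
  use the library's groups), with scalar multiplications
  \<open>act M a d : homog R a \<times> part M d \<rightarrow> part M (a + d)\<close>.
\<close>

record ('l, 'u) graded_module =
  part :: "int \<Rightarrow> 'u monoid"
  act :: "int \<Rightarrow> int \<Rightarrow> 'l \<Rightarrow> 'u \<Rightarrow> 'u"

definition is_graded_module :: "'l graded_ring \<Rightarrow> ('l, 'u) graded_module \<Rightarrow> bool" where
  "is_graded_module R M \<longleftrightarrow>
     (\<forall>d. comm_group (part M d)) \<and>
     (\<forall>a d. \<forall>r\<in>homog R a. act M a d r \<in> hom (part M d) (part M (a + d))) \<and>
     (\<forall>a d. \<forall>r\<in>homog R a. \<forall>s\<in>homog R a. \<forall>m\<in>carrier (part M d).
        act M a d (r \<oplus>\<^bsub>R\<^esub> s) m = act M a d r m \<otimes>\<^bsub>part M (a + d)\<^esub> act M a d s m) \<and>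
     (\<forall>a b d. \<forall>r\<in>homog R a. \<forall>s\<in>homog R b. \<forall>m\<in>carrier (part M d).
        act M (a + b) d (r \<otimes>\<^bsub>R\<^esub> s) m = act M a (b + d) r (act M b d s m)) \<and>
     (\<forall>d. \<forall>m\<in>carrier (part M d). act M 0 d \<one>\<^bsub>R\<^esub> m = m)"

definition is_graded_hom ::
    "'l graded_ring \<Rightarrow> ('l, 'u) graded_module \<Rightarrow> ('l, 'v) graded_module \<Rightarrow> (int \<Rightarrow> 'u \<Rightarrow> 'v) \<Rightarrow> bool" where
  "is_graded_hom R M N f \<longleftrightarrow>
     (\<forall>d. f d \<in> hom (part M d) (part N d)) \<and>
     (\<forall>a d. \<forall>r\<in>homog R a. \<forall>m\<in>carrier (part M d). f (a + d) (act M a d r m) = act N a d r (f d m))"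

text \<open>In \<open>diff C p d\<close>, \<open>p\<close> is the cohomological degree and \<open>d\<close> the internal one.\<close>

record ('l, 'u) cochain_complex =
  term_at :: "int \<Rightarrow> ('l, 'u) graded_module"
  diff :: "int \<Rightarrow> int \<Rightarrow> 'u \<Rightarrow> 'u"

abbreviation cpart :: "('l, 'u) cochain_complex \<Rightarrow> int \<Rightarrow> int \<Rightarrow> 'u monoid" where
  "cpart C p d \<equiv> part (term_at C p) d"

abbreviation cact ::
    "('l, 'u) cochain_complex \<Rightarrow> int \<Rightarrow> int \<Rightarrow> int \<Rightarrow> 'l \<Rightarrow> 'u \<Rightarrow> 'u" where
  "cact C p \<equiv> act (term_at C p)"

definition is_complex :: "'l graded_ring \<Rightarrow> ('l, 'u) cochain_complex \<Rightarrow> bool" where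
  "is_complex R C \<longleftrightarrow>
     (\<forall>p. is_graded_module R (term_at C p)) \<and>
     (\<forall>p. is_graded_hom R (term_at C p) (term_at C (p + 1)) (diff C p)) \<and>
     (\<forall>p d. \<forall>x\<in>carrier (cpart C p d). diff C (p + 1) d (diff C p d x) = \<one>\<^bsub>cpart C (p + 2) d\<^esub>)"

definition is_chain_map ::
    "'l graded_ring \<Rightarrow> ('l, 'u) cochain_complex \<Rightarrow> ('l, 'v) cochain_complex \<Rightarrow>
      (int \<Rightarrow> int \<Rightarrow> 'u \<Rightarrow> 'v) \<Rightarrow> bool" where
  "is_chain_map R C D f \<longleftrightarrow>
     (\<forall>p. is_graded_hom R (term_at C p) (term_at D p) (f p)) \<and>
     (\<forall>p d. \<forall>x\<in>carrier (cpart C p d). f (p + 1) d (diff C p d x) = diff D p d (f p d x))"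

definition complexes_isomorphic ::
    "'l graded_ring \<Rightarrow> ('l, 'u) cochain_complex \<Rightarrow> ('l, 'v) cochain_complex \<Rightarrow> bool" where
  "complexes_isomorphic R C D \<longleftrightarrow>
     (\<exists>f. is_chain_map R C D f \<and> (\<forall>p d. f p d \<in> iso (cpart C p d) (cpart D p d)))"

definition zero_complex :: "('l, 'u) cochain_complex" where
  "zero_complex =
     \<lparr>term_at = (\<lambda>p. \<lparr>part = (\<lambda>d. singleton_group undefined), act = (\<lambda>a d r m. undefined)\<rparr>),
      diff = (\<lambda>p d x. undefined)\<rparr>"


section \<open>Cohomology\<close>

text \<open>
  The map induced on cosets by \<open>f\<close>, with values in cosets of \<open>H\<close>; the union is that of a single
  coset when \<open>f\<close> respects the subgroups.
\<close>

definition coset_map :: "('b, 'm) monoid_scheme \<Rightarrow> 'b set \<Rightarrow> ('a \<Rightarrow> 'b) \<Rightarrow> 'a set \<Rightarrow> 'b set" where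
  "coset_map G H f K = (\<Union>c\<in>K. H #>\<^bsub>G\<^esub> f c)"

definition cocycles :: "('l, 'u) cochain_complex \<Rightarrow> int \<Rightarrow> int \<Rightarrow> 'u set" where
  "cocycles C p d = kernel (cpart C p d) (cpart C (p + 1) d) (diff C p d)"

definition coboundaries :: "('l, 'u) cochain_complex \<Rightarrow> int \<Rightarrow> int \<Rightarrow> 'u set" where
  "coboundaries C p d = diff C (p - 1) d ` carrier (cpart C (p - 1) d)"

definition cohomology :: "('l, 'u) cochain_complex \<Rightarrow> int \<Rightarrow> int \<Rightarrow> 'u set monoid" where
  "cohomology C p d = (cpart C p d)\<lparr>carrier := cocycles C p d\<rparr> Mod coboundaries C p d"

definition acyclic_complex :: "('l, 'u) cochain_complex \<Rightarrow> bool" where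
  "acyclic_complex C \<longleftrightarrow> (\<forall>p d. trivial_group (cohomology C p d))"

definition is_quasi_iso ::
    "'l graded_ring \<Rightarrow> ('l, 'u) cochain_complex \<Rightarrow> ('l, 'v) cochain_complex \<Rightarrow>
      (int \<Rightarrow> int \<Rightarrow> 'u \<Rightarrow> 'v) \<Rightarrow> bool" where
  "is_quasi_iso R C D f \<longleftrightarrow> is_chain_map R C D f \<and>
     (\<forall>p d. coset_map (cpart D p d) (coboundaries D p d) (f p d)
              \<in> iso (cohomology C p d) (cohomology D p d))"


section \<open>Tensor product of complexes\<close>

text \<open>
  The part of \<open>C \<otimes> D\<close> of cohomological degree \<open>n\<close> and internal degree \<open>d\<close> is
  \<open>\<Oplus>\<^bsub>p+q=n\<^esub> (C\<^sup>p \<otimes>\<^sub>R D\<^sup>q)\<^sub>d\<close>, obtained in one step as the quotient of the free abelian group on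
  the symbols \<open>(p, a, x, y)\<close>, which stand for \<open>x \<otimes> y\<close> with \<open>x\<close> in degrees \<open>(p, a)\<close> and \<open>y\<close> in degrees
  \<open>(n - p, d - a)\<close>. No relation mixes different \<open>p\<close>, whence the direct sum.
\<close>

type_synonym ('u, 'v) tensor_frag = "(int \<times> int \<times> 'u \<times> 'v) \<Rightarrow>\<^sub>0 int"

definition tensor_gens ::
    "('l, 'u) cochain_complex \<Rightarrow> ('l, 'v) cochain_complex \<Rightarrow> int \<Rightarrow> int \<Rightarrow> (int \<times> int \<times> 'u \<times> 'v) set" where
  "tensor_gens C D n d =
     {(p, a, x, y). x \<in> carrier (cpart C p a) \<and> y \<in> carrier (cpart D (n - p) (d - a))}"

definition tensor_relators ::
    "'l graded_ring \<Rightarrow> ('l, 'u) cochain_complex \<Rightarrow> ('l, 'v) cochain_complex \<Rightarrow> int \<Rightarrow> int \<Rightarrow>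
      ('u, 'v) tensor_frag set" where
  "tensor_relators R C D n d =
     {frag_of (p, a, x \<otimes>\<^bsub>cpart C p a\<^esub> x', y) - frag_of (p, a, x, y) - frag_of (p, a, x', y) | p a x x' y.
        x \<in> carrier (cpart C p a) \<and> x' \<in> carrier (cpart C p a) \<and>
        y \<in> carrier (cpart D (n - p) (d - a))} \<union>
     {frag_of (p, a, x, y \<otimes>\<^bsub>cpart D (n - p) (d - a)\<^esub> y') - frag_of (p, a, x, y) - frag_of (p, a, x, y') | p a x y y'.
        x \<in> carrier (cpart C p a) \<and>
        y \<in> carrier (cpart D (n - p) (d - a)) \<and> y' \<in> carrier (cpart D (n - p) (d - a))} \<union>
     {frag_of (p, b + a, cact C p b a r x, y) - frag_of (p, a, x, cact D (n - p) b (d - a - b) r y) | p a b r x y.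
        r \<in> homog R b \<and> x \<in> carrier (cpart C p a) \<and>
        y \<in> carrier (cpart D (n - p) (d - a - b))}"

definition tensor_rels ::
    "'l graded_ring \<Rightarrow> ('l, 'u) cochain_complex \<Rightarrow> ('l, 'v) cochain_complex \<Rightarrow> int \<Rightarrow> int \<Rightarrow>
      ('u, 'v) tensor_frag set" where
  "tensor_rels R C D n d =
     generate (free_Abelian_group (tensor_gens C D n d)) (tensor_relators R C D n d)"

definition tensor_act ::
    "('l, 'u) cochain_complex \<Rightarrow> int \<Rightarrow> 'l \<Rightarrow> ('u, 'v) tensor_frag \<Rightarrow> ('u, 'v) tensor_frag" where
  "tensor_act C b r = frag_extend (\<lambda>(p, a, x, y). frag_of (p, b + a, cact C p b a r x, y))"

definition tensor_diff ::
    "('l, 'u) cochain_complex \<Rightarrow> ('l, 'v) cochain_complex \<Rightarrow> int \<Rightarrow> int \<Rightarrow>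
      ('u, 'v) tensor_frag \<Rightarrow> ('u, 'v) tensor_frag" where
  "tensor_diff C D n d = frag_extend (\<lambda>(p, a, x, y).
     frag_of (p + 1, a, diff C p a x, y) +
     frag_cmul (if even p then 1 else - 1) (frag_of (p, a, x, diff D (n - p) (d - a) y)))"

definition tensor_complex ::
    "'l graded_ring \<Rightarrow> ('l, 'u) cochain_complex \<Rightarrow> ('l, 'v) cochain_complex \<Rightarrow>
      ('l, ('u, 'v) tensor_frag set) cochain_complex" where
  "tensor_complex R C D =
     \<lparr>term_at = (\<lambda>n.
        \<lparr>part = (\<lambda>d. free_Abelian_group (tensor_gens C D n d) Mod tensor_rels R C D n d),
         act = (\<lambda>b d r. coset_map (free_Abelian_group (tensor_gens C D n (b + d)))
                           (tensor_rels R C D n (b + d)) (tensor_act C b r))\<rparr>),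
      diff = (\<lambda>n d. coset_map (free_Abelian_group (tensor_gens C D (n + 1) d))
                      (tensor_rels R C D (n + 1) d) (tensor_diff C D n d))\<rparr>"


section \<open>The derived category\<close>

text \<open>
  The objects of the derived category are the complexes \<open>C\<close> with \<open>is_complex R C\<close> whose underlying
  sets lie in a type \<open>'u\<close> that plays the role of a universe. For a countable ring, any
  infinite type \<open>'u\<close> will do: up to isomorphism, its complexes are closed under the
  tensor product and have K-flat resolutions among themselves.

  Isomorphisms in the derived category are represented by roofs of quasi-isomorphisms.
\<close>

definition derived_isomorphic ::
    "'l graded_ring \<Rightarrow> ('l, 'u) cochain_complex \<Rightarrow> ('l, 'u) cochain_complex \<Rightarrow> bool" where
  "derived_isomorphic R C D \<longleftrightarrow>
     (\<exists>(Z :: ('l, 'u) cochain_complex) f g.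
        is_complex R Z \<and> is_quasi_iso R Z C f \<and> is_quasi_iso R Z D g)"

definition derived_zero :: "'l graded_ring \<Rightarrow> ('l, 'u) cochain_complex \<Rightarrow> bool" where
  "derived_zero R C \<longleftrightarrow> derived_isomorphic R C zero_complex"

definition K_flat :: "'l graded_ring \<Rightarrow> ('l, 'u) cochain_complex \<Rightarrow> bool" where
  "K_flat R P \<longleftrightarrow> is_complex R P \<and>
     (\<forall>A :: ('l, 'u) cochain_complex. is_complex R A \<longrightarrow> acyclic_complex A \<longrightarrow>
        acyclic_complex (tensor_complex R P A))"

text \<open>
  The elements of \<open>tensor_complex R P D\<close> live in a new type, so the derived tensor product
  is an isomorphic copy of that complex in the universe \<open>'u\<close>. It is determined, up to isomorphism
  in the derived category, independently of the choices.
\<close>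

definition is_derived_tensor ::
    "'l graded_ring \<Rightarrow> ('l, 'u) cochain_complex \<Rightarrow> ('l, 'u) cochain_complex \<Rightarrow>
      ('l, 'u) cochain_complex \<Rightarrow> bool" where
  "is_derived_tensor R C D T \<longleftrightarrow>
     is_complex R T \<and>
     (\<exists>(P :: ('l, 'u) cochain_complex) f.
        K_flat R P \<and> is_quasi_iso R P C f \<and> complexes_isomorphic R T (tensor_complex R P D))"

definition derived_tensor ::
    "'l graded_ring \<Rightarrow> ('l, 'u) cochain_complex \<Rightarrow> ('l, 'u) cochain_complex \<Rightarrow> ('l, 'u) cochain_complex" where
  "derived_tensor R C D = (SOME T. is_derived_tensor R C D T)"

text \<open>The \<open>n\<close>-fold power, for \<open>n \<ge> 1\<close>; the factors are bracketed to the right.\<close>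

definition derived_power ::
    "'l graded_ring \<Rightarrow> ('l, 'u) cochain_complex \<Rightarrow> nat \<Rightarrow> ('l, 'u) cochain_complex" where
  "derived_power R C n = (derived_tensor R C ^^ (n - 1)) C"

end

theory Submission
  imports Defs
begin

text \<open>
  The example is a direct sum of \<open>n\<close> flat modules, each of which has vanishing tensor square, while
  the tensor product of all \<open>n\<close> of them is nonzero.

  Call \<open>\<Lambda>\<close> the ring, and let \<open>N\<close> be the integer \<open>n\<close> of the theorem. The classes of the powers
  \<open>x\<^sub>i ^ (e i - 1)\<close> are homogeneous of square zero, because \<open>e i \<ge> 2\<close>, and the product of any
  finite set of them is nonzero, because it is the class of a monomial in which every exponent is
  below the truncation bound. Distribute them over \<open>N\<close> infinite sequences:
  \<open>a j m\<close>, with \<open>j < N\<close>, is the one with index \<open>i = m * N + j + 1\<close>. Let \<open>X\<^sub>j\<close> be the telescope, that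
  is, the colimit of the chain of multiplications by \<open>a j 0, a j 1, \<dots>\<close> on \<open>\<Lambda>\<close> (with shifted
  gradings), and let \<open>X\<close> be the sum of the \<open>X\<^sub>j\<close>, regarded as a complex in degree 0. Filtered colimits
  of free modules are flat, so derived tensor powers of \<open>X\<close> are ordinary ones, and
  \<open>X \<otimes> \<cdots> \<otimes> X\<close> with \<open>r\<close> factors is the sum, over the words \<open>w\<close> of length \<open>r\<close> in the letters below
  \<open>N\<close>, of the tensor products of the \<open>X\<^sub>j\<close> along \<open>w\<close>; each of these is the colimit of \<open>\<Lambda>\<close> under
  multiplication by \<open>\<Prod>\<^bsub>j\<in>w\<^esub> a j m\<close>. If a letter is repeated, the multipliers are zero and so is the
  colimit; this happens for every word of length \<open>N + 1\<close>. For the word \<open>0, 1, \<dots>, N - 1\<close> the image of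
  \<open>1\<close> at stage \<open>m\<close> is the product of all \<open>a j t\<close> with \<open>j < N\<close> and \<open>t < m\<close>. It never vanishes, so the
  colimit is nonzero.

  The notion that carries this argument is that of a flat system (locale \<open>flat_system\<close>): a complex in
  degree 0 with coordinates, over a finite index set and for every stage \<open>m\<close>, that are additive and
  linear for large \<open>m\<close> and from which an element can be recovered for large \<open>m\<close>. Telescopes are flat
  systems (\<open>tel_flat_system\<close>), and tensor products of flat systems are flat systems
  (\<open>tensor_flat_system\<close>) whose coordinates are products of coordinates. Computing coordinatewise
  shows that a flat system preserves acyclic complexes (\<open>acyclic_tensor_flat\<close>, whence \<open>K_flat\<close>) and
  quasi-isomorphisms (\<open>tensor_flat_qiso\<close>). Lemma \<open>word_system_Suc\<close> follows the words through one more
  tensor factor, and \<open>word_system_acyclic\<close> and \<open>word_system_not_acyclic\<close> read off the two claims.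

  The derived tensor product is defined through some K-flat complex \<open>P\<close> with a quasi-isomorphism to
  \<open>X\<close>, on which nothing else is known. The comparison with the ordinary tensor product
  (\<open>derived_power_word_system\<close>) goes from \<open>P \<otimes> T\<close> to \<open>P \<otimes> Y\<close>, where \<open>T\<close> is the power formed so far and
  \<open>Y\<close> the word system that computes it, and then from \<open>P \<otimes> Y\<close> to \<open>X \<otimes> Y\<close>. The second step is flatness
  of \<open>Y\<close>; the first is the classical argument with the mapping cone of \<open>T \<rightarrow> Y\<close>
  (\<open>K_flat_tensor_qiso\<close>). All objects must live on the given infinite type, and countability of the
  field enters only to place the telescope on it.
\<close>


section \<open>Cosets and quotients of abelian groups\<close>

lemma (in comm_group) rcos_eq_iff:
  assumes "subgroup H G" "x \<in> carrier G" "y \<in> carrier G"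
  shows "H #> x = H #> y \<longleftrightarrow> x \<otimes> inv y \<in> H"
proof
  assume "H #> x = H #> y"
  then have "x \<in> H #> y" using rcos_self[OF assms(2,1)] by simp
  then show "x \<otimes> inv y \<in> H" using subgroup.rcos_module_imp[OF assms(1) is_group assms(3)] by simp
next
  assume "x \<otimes> inv y \<in> H"
  then have "x \<in> H #> y" using subgroup.rcos_module_rev[OF assms(1) is_group assms(3,2)] by simp
  then show "H #> x = H #> y" using repr_independence[OF _ assms(3,1)] by simp
qed

lemma (in comm_group) rcos_eq_self_iff:
  assumes "subgroup H G" "x \<in> carrier G"
  shows "H #> x = H \<longleftrightarrow> x \<in> H"
  using coset_join1[OF _ assms(2,1)] coset_join2[OF assms(2,1)] subgroup.subset[OF assms(1)] by blast

lemma (in comm_group) rcos_mult: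
  assumes "subgroup H G" "x \<in> carrier G" "y \<in> carrier G"
  shows "(H #> x) <#> (H #> y) = H #> (x \<otimes> y)"
  by (rule normal.rcos_sum[OF subgroup_imp_normal[OF assms(1)] assms(2,3)])

lemma (in comm_group) comm_group_Mod:
  assumes "subgroup H G" shows "comm_group (G Mod H)"
  by (rule abelian_FactGroup[OF assms])

lemma coset_map_rcos:
  assumes G: "comm_group G" "comm_group G'" and N: "subgroup N G" "subgroup N' G'"
    and F: "F \<in> hom G G'" "F ` N \<subseteq> N'" and x: "x \<in> carrier G"
  shows "coset_map G' N' F (N #>\<^bsub>G\<^esub> x) = N' #>\<^bsub>G'\<^esub> F x"
proof -
  interpret G: comm_group G by fact
  interpret G': comm_group G' by fact
  have *: "N' #>\<^bsub>G'\<^esub> F c = N' #>\<^bsub>G'\<^esub> F x" if c: "c \<in> N #>\<^bsub>G\<^esub> x" for c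
  proof -
    obtain h where h: "h \<in> N" "c = h \<otimes>\<^bsub>G\<^esub> x" using c unfolding r_coset_def by blast
    have hG: "h \<in> carrier G" using N(1) h(1) subgroup.mem_carrier by fastforce
    have Fh: "F h \<in> N'" using F(2) h(1) by blast
    have FG: "F h \<in> carrier G'" "F x \<in> carrier G'" using F(1) hG x by (auto simp: hom_def)
    have "F c = F h \<otimes>\<^bsub>G'\<^esub> F x" using h hG x F(1) by (simp add: hom_mult)
    then have "N' #>\<^bsub>G'\<^esub> F c = (N' #>\<^bsub>G'\<^esub> F h) #>\<^bsub>G'\<^esub> F x"
      using FG N(2) by (simp add: G'.coset_mult_assoc subgroup.subset)
    also have "N' #>\<^bsub>G'\<^esub> F h = N'" using G'.rcos_eq_self_iff[OF N(2) FG(1)] Fh by simp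
    finally show ?thesis .
  qed
  have "x \<in> N #>\<^bsub>G\<^esub> x" using G.rcos_self[OF x N(1)] .
  then show ?thesis unfolding coset_map_def using * by blast
qed

lemma hom_coset_map:
  assumes G: "comm_group G" "comm_group G'" and N: "subgroup N G" "subgroup N' G'"
    and F: "F \<in> hom G G'" "F ` N \<subseteq> N'"
  shows "coset_map G' N' F \<in> hom (G Mod N) (G' Mod N')"
proof (rule homI)
  interpret G: comm_group G by fact
  interpret G': comm_group G' by fact
  have Fc: "F x \<in> carrier G'" if "x \<in> carrier G" for x using F(1) that by (auto simp: hom_def)
  fix K assume "K \<in> carrier (G Mod N)"
  then obtain x where x: "x \<in> carrier G" "K = N #>\<^bsub>G\<^esub> x" by (auto simp: carrier_FactGroup)
  show "coset_map G' N' F K \<in> carrier (G' Mod N')"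
    using x coset_map_rcos[OF assms x(1)] Fc by (auto simp: carrier_FactGroup)
  fix L assume "L \<in> carrier (G Mod N)"
  then obtain y where y: "y \<in> carrier G" "L = N #>\<^bsub>G\<^esub> y" by (auto simp: carrier_FactGroup)
  show "coset_map G' N' F (K \<otimes>\<^bsub>G Mod N\<^esub> L) = coset_map G' N' F K \<otimes>\<^bsub>G' Mod N'\<^esub> coset_map G' N' F L"
    using x y Fc F(1)
    by (simp add: G.rcos_mult[OF N(1)] coset_map_rcos[OF assms] G'.rcos_mult[OF N(2)] hom_mult)
qed

lemma comm_group_imp_group: "comm_group G \<Longrightarrow> group G"
  by (rule comm_group.axioms(2))

lemma hom_imp_one:
  "comm_group G \<Longrightarrow> comm_group H \<Longrightarrow> h \<in> hom G H \<Longrightarrow> h \<one>\<^bsub>G\<^esub> = \<one>\<^bsub>H\<^esub>"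
  by (rule hom_one) (auto intro: comm_group_imp_group)

lemma hom_imp_inv:
  "comm_group G \<Longrightarrow> comm_group H \<Longrightarrow> h \<in> hom G H \<Longrightarrow> x \<in> carrier G \<Longrightarrow> h (inv\<^bsub>G\<^esub> x) = inv\<^bsub>H\<^esub> (h x)"
  by (rule group_hom.hom_inv[OF group_hom.intro])
     (auto intro: comm_group_imp_group simp: group_hom_axioms_def)

lemma hom_imp_closed: "h \<in> hom G H \<Longrightarrow> x \<in> carrier G \<Longrightarrow> h x \<in> carrier H"
  by (auto simp: hom_def)

lemma (in comm_group) mult_inv_eq_one_iff:
  assumes "x \<in> carrier G" "y \<in> carrier G"
  shows "x \<otimes> inv y = \<one> \<longleftrightarrow> x = y"
proof
  assume "x \<otimes> inv y = \<one>"
  then have "inv (inv y) = x" by (rule inv_equality) (use assms in auto)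
  then show "x = y" using assms by simp
qed (use assms in simp)


section \<open>Graded modules over a graded commutative ring\<close>

locale graded_cring = cring R for R :: "'l graded_ring" (structure) +
  assumes homog_subgroup: "subgroup (homog R d) (add_monoid R)"
    and homog_mult: "r \<in> homog R a \<Longrightarrow> s \<in> homog R b \<Longrightarrow> r \<otimes> s \<in> homog R (a + b)"
    and homog_one: "\<one> \<in> homog R 0"
begin

lemma homog_carrier: "r \<in> homog R a \<Longrightarrow> r \<in> carrier R"
  using homog_subgroup[of a] subgroup.mem_carrier by fastforce

lemma homog_zero: "\<zero> \<in> homog R a"
  using subgroup.one_closed[OF homog_subgroup[of a]] by simp

lemma homog_add: "r \<in> homog R a \<Longrightarrow> s \<in> homog R a \<Longrightarrow> r \<oplus> s \<in> homog R a"
  using subgroup.m_closed[OF homog_subgroup[of a]] by simp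

lemma homog_minus: "r \<in> homog R a \<Longrightarrow> \<ominus> r \<in> homog R a"
  using subgroup.m_inv_closed[OF homog_subgroup[of a]] by (simp add: a_inv_def)

end

context
  fixes R :: "'l graded_ring" and M :: "('l, 'u) graded_module"
  assumes M: "is_graded_module R M"
begin

lemma part_comm_group: "comm_group (part M d)"
  using M by (simp add: is_graded_module_def)

lemma act_hom: "r \<in> homog R a \<Longrightarrow> act M a d r \<in> hom (part M d) (part M (a + d))"
  using M by (simp add: is_graded_module_def)

lemma act_closed: "r \<in> homog R a \<Longrightarrow> m \<in> carrier (part M d) \<Longrightarrow> act M a d r m \<in> carrier (part M (a + d))"
  using act_hom by (auto simp: hom_def)

lemma act_mult:
  "r \<in> homog R a \<Longrightarrow> m \<in> carrier (part M d) \<Longrightarrow> m' \<in> carrier (part M d) \<Longrightarrow>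
    act M a d r (m \<otimes>\<^bsub>part M d\<^esub> m') = act M a d r m \<otimes>\<^bsub>part M (a + d)\<^esub> act M a d r m'"
  using act_hom by (auto simp: hom_def)

lemma act_unit: "r \<in> homog R a \<Longrightarrow> act M a d r \<one>\<^bsub>part M d\<^esub> = \<one>\<^bsub>part M (a + d)\<^esub>"
  by (rule hom_imp_one[OF part_comm_group part_comm_group act_hom])

lemma act_inv: "r \<in> homog R a \<Longrightarrow> m \<in> carrier (part M d) \<Longrightarrow>
    act M a d r (inv\<^bsub>part M d\<^esub> m) = inv\<^bsub>part M (a + d)\<^esub> act M a d r m"
  by (rule hom_imp_inv[OF part_comm_group part_comm_group act_hom])

lemma act_add_scalar:
  "r \<in> homog R a \<Longrightarrow> s \<in> homog R a \<Longrightarrow> m \<in> carrier (part M d) \<Longrightarrow>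
    act M a d (r \<oplus>\<^bsub>R\<^esub> s) m = act M a d r m \<otimes>\<^bsub>part M (a + d)\<^esub> act M a d s m"
  using M by (simp add: is_graded_module_def)

lemma act_act:
  "r \<in> homog R a \<Longrightarrow> s \<in> homog R b \<Longrightarrow> m \<in> carrier (part M d) \<Longrightarrow>
    act M a (b + d) r (act M b d s m) = act M (a + b) d (r \<otimes>\<^bsub>R\<^esub> s) m"
  using M by (simp add: is_graded_module_def)

lemma act_one: "m \<in> carrier (part M d) \<Longrightarrow> act M 0 d \<one>\<^bsub>R\<^esub> m = m"
  using M by (simp add: is_graded_module_def)

end

lemma (in graded_cring) act_zero_scalar:
  assumes M: "is_graded_module R M" and m: "m \<in> carrier (part M d)"
  shows "act M a d \<zero> m = \<one>\<^bsub>part M (a + d)\<^esub>"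
proof -
  interpret P: comm_group "part M (a + d)" using part_comm_group[OF M] .
  have c: "act M a d \<zero> m \<in> carrier (part M (a + d))" using act_closed[OF M homog_zero m] .
  have "act M a d \<zero> m \<otimes>\<^bsub>part M (a + d)\<^esub> act M a d \<zero> m = act M a d \<zero> m"
    using act_add_scalar[OF M homog_zero homog_zero m, of a] by simp
  then show ?thesis using P.l_cancel_one[OF c c] by simp
qed

lemma (in graded_cring) act_commute:
  assumes M: "is_graded_module R M" and m: "m \<in> carrier (part M d)"
    and r: "r \<in> homog R a" and s: "s \<in> homog R b"
  shows "act M a (b + d) r (act M b d s m) = act M b (a + d) s (act M a d r m)"
  using act_act[OF M r s m] act_act[OF M s r m] r s homog_carrier by (simp add: m_comm add.commute)

lemma is_graded_homD:
  assumes "is_graded_hom R M N f"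
  shows "f d \<in> hom (part M d) (part N d)"
    and "r \<in> homog R a \<Longrightarrow> m \<in> carrier (part M d) \<Longrightarrow> f (a + d) (act M a d r m) = act N a d r (f d m)"
  using assms by (auto simp: is_graded_hom_def)

text \<open>
  The last three module axioms are only asked for modulo \<open>N\<close>: on formal sums of tensor symbols the scalar
  action becomes additive in the scalar only after passing to the quotient.
\<close>
lemma quotient_graded_module:
  fixes R :: "'l graded_ring" and G :: "int \<Rightarrow> 'v monoid"
  assumes G: "\<And>d. comm_group (G d)" and N: "\<And>d. subgroup (N d) (G d)"
    and hom: "\<And>a d r. r \<in> homog R a \<Longrightarrow> A a d r \<in> hom (G d) (G (a + d))"
    and pres: "\<And>a d r. r \<in> homog R a \<Longrightarrow> A a d r ` N d \<subseteq> N (a + d)"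
    and add: "\<And>a d r s m. r \<in> homog R a \<Longrightarrow> s \<in> homog R a \<Longrightarrow> m \<in> carrier (G d) \<Longrightarrow>
      N (a + d) #>\<^bsub>G (a + d)\<^esub> A a d (r \<oplus>\<^bsub>R\<^esub> s) m = N (a + d) #>\<^bsub>G (a + d)\<^esub> (A a d r m \<otimes>\<^bsub>G (a + d)\<^esub> A a d s m)"
    and mult: "\<And>a b d r s m. r \<in> homog R a \<Longrightarrow> s \<in> homog R b \<Longrightarrow> m \<in> carrier (G d) \<Longrightarrow>
      N (a + b + d) #>\<^bsub>G (a + b + d)\<^esub> A (a + b) d (r \<otimes>\<^bsub>R\<^esub> s) m = N (a + b + d) #>\<^bsub>G (a + b + d)\<^esub> A a (b + d) r (A b d s m)"
    and one: "\<And>d m. m \<in> carrier (G d) \<Longrightarrow> N d #>\<^bsub>G d\<^esub> A 0 d \<one>\<^bsub>R\<^esub> m = N d #>\<^bsub>G d\<^esub> m"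
    and R: "graded_cring R"
  shows "is_graded_module R \<lparr>part = \<lambda>d. G d Mod N d, act = \<lambda>b d r. coset_map (G (b + d)) (N (b + d)) (A b d r)\<rparr>"
proof -
  interpret graded_cring R by fact
  have cl: "A a d r m \<in> carrier (G (a + d))" if "r \<in> homog R a" "m \<in> carrier (G d)" for a d r m
    using hom[OF that(1)] that(2) by (auto simp: hom_def)
  have cm: "coset_map (G (a + d)) (N (a + d)) (A a d r) (N d #>\<^bsub>G d\<^esub> m) = N (a + d) #>\<^bsub>G (a + d)\<^esub> A a d r m"
    if "r \<in> homog R a" "m \<in> carrier (G d)" for a d r m
    by (rule coset_map_rcos[OF G G N N hom[OF that(1)] pres[OF that(1)] that(2)])
  have sum: "(N d #>\<^bsub>G d\<^esub> x) <#>\<^bsub>G d\<^esub> (N d #>\<^bsub>G d\<^esub> y) = N d #>\<^bsub>G d\<^esub> (x \<otimes>\<^bsub>G d\<^esub> y)"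
    if "x \<in> carrier (G d)" "y \<in> carrier (G d)" for x y d
    using comm_group.rcos_mult[OF G N that] .
  show ?thesis
    unfolding is_graded_module_def
  proof (intro conjI allI ballI; simp)
    show "comm_group (G d Mod N d)" for d using comm_group.comm_group_Mod[OF G N] .
    show "coset_map (G (a + d)) (N (a + d)) (A a d r) \<in> Group.hom (G d Mod N d) (G (a + d) Mod N (a + d))"
      if "r \<in> homog R a" for a d r
      by (rule hom_coset_map[OF G G N N hom[OF that] pres[OF that]])
    show "coset_map (G (a + d)) (N (a + d)) (A a d (r \<oplus>\<^bsub>R\<^esub> s)) m =
        coset_map (G (a + d)) (N (a + d)) (A a d r) m <#>\<^bsub>G (a + d)\<^esub> coset_map (G (a + d)) (N (a + d)) (A a d s) m"
      if "r \<in> homog R a" "s \<in> homog R a" "m \<in> carrier (G d Mod N d)" for a d r s m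
      using that by (auto simp: carrier_FactGroup cm homog_add sum cl add)
    show "coset_map (G (a + b + d)) (N (a + b + d)) (A (a + b) d (r \<otimes>\<^bsub>R\<^esub> s)) m =
       coset_map (G (a + (b + d))) (N (a + (b + d))) (A a (b + d) r) (coset_map (G (b + d)) (N (b + d)) (A b d s) m)"
      if "r \<in> homog R a" "s \<in> homog R b" "m \<in> carrier (G d Mod N d)" for a b d r s m
    proof -
      note r = that(1) and s = that(2) and mc = that(3)
      obtain x where x: "x \<in> carrier (G d)" and m: "m = N d #>\<^bsub>G d\<^esub> x"
        using mc unfolding carrier_FactGroup by blast
      show ?thesis
        unfolding m cm[OF s x] cm[OF r cl[OF s x]] cm[OF homog_mult[OF r s] x] mult[OF r s x]
        by (simp only: add.assoc)
    qed
    show "coset_map (G d) (N d) (A 0 d \<one>\<^bsub>R\<^esub>) m = m" if "m \<in> carrier (G d Mod N d)" for d m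
      using that cm[OF homog_one, of _ d] one by (auto simp: carrier_FactGroup)
  qed
qed

lemma quotient_graded_hom:
  fixes R :: "'l graded_ring" and G :: "int \<Rightarrow> 'v monoid" and G' :: "int \<Rightarrow> 'w monoid"
  assumes G: "\<And>d. comm_group (G d)" and N: "\<And>d. subgroup (N d) (G d)"
    and hom: "\<And>a d r. r \<in> homog R a \<Longrightarrow> A a d r \<in> hom (G d) (G (a + d))"
    and pres: "\<And>a d r. r \<in> homog R a \<Longrightarrow> A a d r ` N d \<subseteq> N (a + d)"
    and G': "\<And>d. comm_group (G' d)" and N': "\<And>d. subgroup (N' d) (G' d)"
    and hom': "\<And>a d r. r \<in> homog R a \<Longrightarrow> A' a d r \<in> hom (G' d) (G' (a + d))"
    and pres': "\<And>a d r. r \<in> homog R a \<Longrightarrow> A' a d r ` N' d \<subseteq> N' (a + d)"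
    and F: "\<And>d. F d \<in> hom (G d) (G' d)" "\<And>d. F d ` N d \<subseteq> N' d"
    and eq: "\<And>a d r m. r \<in> homog R a \<Longrightarrow> m \<in> carrier (G d) \<Longrightarrow>
        N' (a + d) #>\<^bsub>G' (a + d)\<^esub> F (a + d) (A a d r m) = N' (a + d) #>\<^bsub>G' (a + d)\<^esub> A' a d r (F d m)"
  shows "is_graded_hom R \<lparr>part = \<lambda>d. G d Mod N d, act = \<lambda>b d r. coset_map (G (b + d)) (N (b + d)) (A b d r)\<rparr>
     \<lparr>part = \<lambda>d. G' d Mod N' d, act = \<lambda>b d r. coset_map (G' (b + d)) (N' (b + d)) (A' b d r)\<rparr>
     (\<lambda>d. coset_map (G' d) (N' d) (F d))"
proof -
  have cl: "A a d r m \<in> carrier (G (a + d))" if "r \<in> homog R a" "m \<in> carrier (G d)" for a d r m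
    using hom[OF that(1)] that(2) by (auto simp: hom_def)
  have clF: "F d m \<in> carrier (G' d)" if "m \<in> carrier (G d)" for d m
    using F(1) that by (auto simp: hom_def)
  have cm: "coset_map (G (a + d)) (N (a + d)) (A a d r) (N d #>\<^bsub>G d\<^esub> m) = N (a + d) #>\<^bsub>G (a + d)\<^esub> A a d r m"
    if "r \<in> homog R a" "m \<in> carrier (G d)" for a d r m
    by (rule coset_map_rcos[OF G G N N hom[OF that(1)] pres[OF that(1)] that(2)])
  have cm': "coset_map (G' (a + d)) (N' (a + d)) (A' a d r) (N' d #>\<^bsub>G' d\<^esub> m) = N' (a + d) #>\<^bsub>G' (a + d)\<^esub> A' a d r m"
    if "r \<in> homog R a" "m \<in> carrier (G' d)" for a d r m
    by (rule coset_map_rcos[OF G' G' N' N' hom'[OF that(1)] pres'[OF that(1)] that(2)])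
  have cF: "coset_map (G' d) (N' d) (F d) (N d #>\<^bsub>G d\<^esub> m) = N' d #>\<^bsub>G' d\<^esub> F d m"
    if "m \<in> carrier (G d)" for d m
    by (rule coset_map_rcos[OF G G' N N' F that])
  show ?thesis
    unfolding is_graded_hom_def
    using hom_coset_map[OF G G' N N' F]
    by (auto simp: carrier_FactGroup cm cm' cF cl clF eq)
qed


section \<open>Cohomology of complexes\<close>

lemma mem_cocycles_iff:
  "x \<in> cocycles C p d \<longleftrightarrow> x \<in> carrier (cpart C p d) \<and> diff C p d x = \<one>\<^bsub>cpart C (p + 1) d\<^esub>"
  by (simp add: cocycles_def kernel_def)

context
  fixes R :: "'l graded_ring" and C :: "('l, 'u) cochain_complex"
  assumes C: "is_complex R C"
begin

lemma complex_module: "is_graded_module R (term_at C p)"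
  using C by (simp add: is_complex_def)

lemma complex_group: "comm_group (cpart C p d)"
  by (rule part_comm_group[OF complex_module])

lemma diff_graded_hom: "is_graded_hom R (term_at C p) (term_at C (p + 1)) (diff C p)"
  using C by (simp add: is_complex_def)

lemma diff_hom: "diff C p d \<in> hom (cpart C p d) (cpart C (p + 1) d)"
  by (rule is_graded_homD(1)[OF diff_graded_hom])

lemma diff_closed: "x \<in> carrier (cpart C p d) \<Longrightarrow> diff C p d x \<in> carrier (cpart C (p + 1) d)"
  by (rule hom_imp_closed[OF diff_hom])

lemma diff_unit: "diff C p d \<one>\<^bsub>cpart C p d\<^esub> = \<one>\<^bsub>cpart C (p + 1) d\<^esub>"
  by (rule hom_imp_one[OF complex_group complex_group diff_hom])

lemma diff_inv: "x \<in> carrier (cpart C p d) \<Longrightarrow>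
    diff C p d (inv\<^bsub>cpart C p d\<^esub> x) = inv\<^bsub>cpart C (p + 1) d\<^esub> diff C p d x"
  by (rule hom_imp_inv[OF complex_group complex_group diff_hom])

lemma diff_mult: "x \<in> carrier (cpart C p d) \<Longrightarrow> y \<in> carrier (cpart C p d) \<Longrightarrow>
    diff C p d (x \<otimes>\<^bsub>cpart C p d\<^esub> y) = diff C p d x \<otimes>\<^bsub>cpart C (p + 1) d\<^esub> diff C p d y"
  using diff_hom by (simp add: hom_mult)

lemma diff_act: "r \<in> homog R a \<Longrightarrow> x \<in> carrier (cpart C p d) \<Longrightarrow>
    diff C p (a + d) (cact C p a d r x) = cact C (p + 1) a d r (diff C p d x)"
  by (rule is_graded_homD(2)[OF diff_graded_hom])

lemma diff_diff: "x \<in> carrier (cpart C p d) \<Longrightarrow> diff C (p + 1) d (diff C p d x) = \<one>\<^bsub>cpart C (p + 2) d\<^esub>"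
  using C by (simp add: is_complex_def)

lemma subgroup_cocycles: "subgroup (cocycles C p d) (cpart C p d)"
  unfolding cocycles_def
  by (rule group_hom.subgroup_kernel[OF group_hom.intro])
     (auto intro: comm_group_imp_group complex_group simp: group_hom_axioms_def diff_hom)

lemma coboundaries_diff: "x \<in> carrier (cpart C p d) \<Longrightarrow> diff C p d x \<in> coboundaries C (p + 1) d"
  by (auto simp: coboundaries_def)

lemma subgroup_coboundaries: "subgroup (coboundaries C p d) (cpart C p d)"
proof -
  have "group_hom (cpart C (p - 1) d) (cpart C p d) (diff C (p - 1) d)"
    using diff_hom[of "p - 1" d] comm_group_imp_group[OF complex_group]
    by (auto simp: group_hom_def group_hom_axioms_def)
  then show ?thesis
    unfolding coboundaries_def by (rule group_hom.img_is_subgroup)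
qed

lemma coboundaries_subset_cocycles: "coboundaries C p d \<subseteq> cocycles C p d"
proof
  fix y assume "y \<in> coboundaries C p d"
  then obtain x where x: "x \<in> carrier (cpart C (p - 1) d)" "y = diff C (p - 1) d x"
    by (auto simp: coboundaries_def)
  then show "y \<in> cocycles C p d"
    using diff_closed[of x "p - 1" d] diff_diff[of x "p - 1" d] by (simp add: mem_cocycles_iff add.commute)
qed

lemma cocycles_group: "comm_group ((cpart C p d)\<lparr>carrier := cocycles C p d\<rparr>)"
proof (rule group.group_comm_groupI)
  show "group ((cpart C p d)\<lparr>carrier := cocycles C p d\<rparr>)"
    by (rule subgroup.subgroup_is_group[OF subgroup_cocycles comm_group_imp_group[OF complex_group]])
  interpret comm_group "cpart C p d" by (rule complex_group)
  show "x \<otimes>\<^bsub>(cpart C p d)\<lparr>carrier := cocycles C p d\<rparr>\<^esub> y = y \<otimes>\<^bsub>(cpart C p d)\<lparr>carrier := cocycles C p d\<rparr>\<^esub> x"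
    if "x \<in> carrier ((cpart C p d)\<lparr>carrier := cocycles C p d\<rparr>)"
       "y \<in> carrier ((cpart C p d)\<lparr>carrier := cocycles C p d\<rparr>)" for x y
    using that by (simp add: mem_cocycles_iff m_comm)
qed

lemma subgroup_coboundaries_cocycles:
  "subgroup (coboundaries C p d) ((cpart C p d)\<lparr>carrier := cocycles C p d\<rparr>)"
  by (rule group.subgroup_incl[OF comm_group_imp_group[OF complex_group]
        subgroup_coboundaries subgroup_cocycles coboundaries_subset_cocycles])

lemma carrier_cohomology: "carrier (cohomology C p d) = (\<lambda>z. coboundaries C p d #>\<^bsub>cpart C p d\<^esub> z) ` cocycles C p d"
  by (simp add: cohomology_def carrier_FactGroup)

lemma acyclic_complex_iff: "acyclic_complex C \<longleftrightarrow> (\<forall>p d. cocycles C p d \<subseteq> coboundaries C p d)"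
proof -
  have "trivial_group (cohomology C p d) \<longleftrightarrow> cocycles C p d \<subseteq> coboundaries C p d" for p d
  proof -
    interpret H: comm_group "cohomology C p d"
      unfolding cohomology_def
      by (rule comm_group.comm_group_Mod[OF cocycles_group subgroup_coboundaries_cocycles])
    have one: "\<one>\<^bsub>cohomology C p d\<^esub> = coboundaries C p d" by (simp add: cohomology_def)
    have *: "coboundaries C p d #>\<^bsub>cpart C p d\<^esub> z = coboundaries C p d \<longleftrightarrow> z \<in> coboundaries C p d"
      if "z \<in> cocycles C p d" for z
      using that comm_group.rcos_eq_self_iff[OF complex_group subgroup_coboundaries] by (simp add: mem_cocycles_iff)
    show ?thesis
      unfolding H.trivial_group_subset one carrier_cohomology using * by auto
  qed
  then show ?thesis by (simp add: acyclic_complex_def)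
qed

end


section \<open>Quasi-isomorphisms\<close>

lemma is_chain_mapD:
  assumes "is_chain_map R C D f"
  shows "is_graded_hom R (term_at C p) (term_at D p) (f p)"
    and "x \<in> carrier (cpart C p d) \<Longrightarrow> f (p + 1) d (diff C p d x) = diff D p d (f p d x)"
  using assms by (auto simp: is_chain_map_def)

lemma chain_map_hom: "is_chain_map R C D f \<Longrightarrow> f p d \<in> hom (cpart C p d) (cpart D p d)"
  by (rule is_graded_homD(1)[OF is_chain_mapD(1)])

lemma chain_map_closed:
  "is_chain_map R C D f \<Longrightarrow> x \<in> carrier (cpart C p d) \<Longrightarrow> f p d x \<in> carrier (cpart D p d)"
  by (rule hom_imp_closed[OF chain_map_hom])

lemma chain_map_act:
  "is_chain_map R C D f \<Longrightarrow> r \<in> homog R a \<Longrightarrow> x \<in> carrier (cpart C p d) \<Longrightarrow>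
    f p (a + d) (cact C p a d r x) = cact D p a d r (f p d x)"
  by (rule is_graded_homD(2)[OF is_chain_mapD(1)])

lemma chain_map_cocycles:
  assumes "is_complex R C" "is_complex R D" "is_chain_map R C D f" "x \<in> cocycles C p d"
  shows "f p d x \<in> cocycles D p d"
proof -
  have "f (p + 1) d \<one>\<^bsub>cpart C (p + 1) d\<^esub> = \<one>\<^bsub>cpart D (p + 1) d\<^esub>"
    by (rule hom_imp_one[OF complex_group[OF assms(1)] complex_group[OF assms(2)] chain_map_hom[OF assms(3)]])
  then show ?thesis
    using assms(4) chain_map_closed[OF assms(3)] is_chain_mapD(2)[OF assms(3), of x p d]
    by (auto simp: mem_cocycles_iff)
qed

lemma chain_map_coboundaries:
  assumes "is_chain_map R C D f" "x \<in> coboundaries C p d"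
  shows "f p d x \<in> coboundaries D p d"
proof -
  obtain y where y: "y \<in> carrier (cpart C (p - 1) d)" "x = diff C (p - 1) d y"
    using assms(2) by (auto simp: coboundaries_def)
  then have "f p d x = diff D (p - 1) d (f (p - 1) d y)"
    using is_chain_mapD(2)[OF assms(1) y(1)] by simp
  then show ?thesis using chain_map_closed[OF assms(1) y(1)] by (auto simp: coboundaries_def)
qed

text \<open>
  Injectivity and surjectivity on cohomology, spelled out on representatives. In this form it can be
  verified and used without mentioning cosets.
\<close>
definition qiso ::
    "'l graded_ring \<Rightarrow> ('l, 'u) cochain_complex \<Rightarrow> ('l, 'v) cochain_complex \<Rightarrow>
      (int \<Rightarrow> int \<Rightarrow> 'u \<Rightarrow> 'v) \<Rightarrow> bool" where
  "qiso R C D f \<longleftrightarrow> is_chain_map R C D f \<and>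
     (\<forall>p d. \<forall>x\<in>cocycles C p d. f p d x \<in> coboundaries D p d \<longrightarrow> x \<in> coboundaries C p d) \<and>
     (\<forall>p d. \<forall>y\<in>cocycles D p d. \<exists>x\<in>cocycles C p d. y \<otimes>\<^bsub>cpart D p d\<^esub> inv\<^bsub>cpart D p d\<^esub> f p d x \<in> coboundaries D p d)"

lemma quasi_iso_iff:
  assumes C: "is_complex R C" and D: "is_complex R D"
  shows "is_quasi_iso R C D f \<longleftrightarrow> qiso R C D f"
proof (cases "is_chain_map R C D f")
  case f: True
  have "coset_map (cpart D p d) (coboundaries D p d) (f p d) \<in> iso (cohomology C p d) (cohomology D p d) \<longleftrightarrow>
     (\<forall>x\<in>cocycles C p d. f p d x \<in> coboundaries D p d \<longrightarrow> x \<in> coboundaries C p d) \<and>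
     (\<forall>y\<in>cocycles D p d. \<exists>x\<in>cocycles C p d. y \<otimes>\<^bsub>cpart D p d\<^esub> inv\<^bsub>cpart D p d\<^esub> f p d x \<in> coboundaries D p d)"
    (is "?F \<in> _ \<longleftrightarrow> ?I \<and> ?S") for p d
  proof -
    let ?C = "cpart C p d" and ?D = "cpart D p d"
    let ?BC = "coboundaries C p d" and ?BD = "coboundaries D p d"
    let ?ZC = "cocycles C p d" and ?ZD = "cocycles D p d"
    interpret gC: comm_group ?C by (rule complex_group[OF C])
    interpret gD: comm_group ?D by (rule complex_group[OF D])
    note sC = subgroup_coboundaries[OF C, of p d] and sD = subgroup_coboundaries[OF D, of p d]
    have ZC: "x \<in> carrier ?C" if "x \<in> ?ZC" for x using that by (simp add: mem_cocycles_iff)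
    have ZD: "x \<in> carrier ?D" if "x \<in> ?ZD" for x using that by (simp add: mem_cocycles_iff)
    have fZ: "f p d x \<in> ?ZD" if "x \<in> ?ZC" for x using chain_map_cocycles[OF C D f that] .
    have fB: "f p d ` ?BC \<subseteq> ?BD" using chain_map_coboundaries[OF f] by blast
    have cm: "?F (?BC #>\<^bsub>?C\<^esub> x) = ?BD #>\<^bsub>?D\<^esub> f p d x" if "x \<in> ?ZC" for x
      by (rule coset_map_rcos[OF complex_group[OF C] complex_group[OF D] sC sD chain_map_hom[OF f] fB ZC[OF that]])
    have fh: "f p d \<in> hom (?C\<lparr>carrier := ?ZC\<rparr>) (?D\<lparr>carrier := ?ZD\<rparr>)"
      using fZ chain_map_hom[OF f, of p d] ZC by (auto simp: hom_def)
    have eq: "coset_map (?D\<lparr>carrier := ?ZD\<rparr>) ?BD (f p d) = ?F"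
      by (simp add: coset_map_def fun_eq_iff)
    have hom: "?F \<in> hom (cohomology C p d) (cohomology D p d)"
      using hom_coset_map[OF cocycles_group[OF C] cocycles_group[OF D]
          subgroup_coboundaries_cocycles[OF C] subgroup_coboundaries_cocycles[OF D] fh fB]
      by (simp add: eq cohomology_def)
    have inj: "inj_on ?F (carrier (cohomology C p d)) \<longleftrightarrow> ?I"
    proof
      assume inj: "inj_on ?F (carrier (cohomology C p d))"
      show ?I
      proof (intro ballI impI)
        fix x assume x: "x \<in> ?ZC" and fx: "f p d x \<in> ?BD"
        have 1: "\<one>\<^bsub>?C\<^esub> \<in> ?ZC" by (rule subgroup.one_closed[OF subgroup_cocycles[OF C]])
        have f1: "f p d \<one>\<^bsub>?C\<^esub> = \<one>\<^bsub>?D\<^esub>"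
          by (rule hom_imp_one[OF complex_group[OF C] complex_group[OF D] chain_map_hom[OF f]])
        have "?F (?BC #>\<^bsub>?C\<^esub> x) = ?F (?BC #>\<^bsub>?C\<^esub> \<one>\<^bsub>?C\<^esub>)"
          unfolding cm[OF x] cm[OF 1] f1
          using gD.rcos_eq_self_iff[OF sD ZD[OF fZ[OF x]]] fx gD.rcos_eq_self_iff[OF sD gD.one_closed]
            subgroup.one_closed[OF sD] by simp
        then have "?BC #>\<^bsub>?C\<^esub> x = ?BC #>\<^bsub>?C\<^esub> \<one>\<^bsub>?C\<^esub>"
          using inj x 1 unfolding inj_on_def carrier_cohomology[OF C] by blast
        then show "x \<in> ?BC" using gC.rcos_eq_iff[OF sC ZC[OF x] gC.one_closed] ZC[OF x] by simp
      qed
    next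
      assume I: ?I
      show "inj_on ?F (carrier (cohomology C p d))"
      proof (rule inj_onI)
        fix K L assume "K \<in> carrier (cohomology C p d)" "L \<in> carrier (cohomology C p d)" and e: "?F K = ?F L"
        then obtain x y where x: "x \<in> ?ZC" "K = ?BC #>\<^bsub>?C\<^esub> x" and y: "y \<in> ?ZC" "L = ?BC #>\<^bsub>?C\<^esub> y"
          by (auto simp: carrier_cohomology[OF C])
        have "?BD #>\<^bsub>?D\<^esub> f p d x = ?BD #>\<^bsub>?D\<^esub> f p d y" using e x y cm by simp
        then have "f p d x \<otimes>\<^bsub>?D\<^esub> inv\<^bsub>?D\<^esub> f p d y \<in> ?BD"
          using gD.rcos_eq_iff[OF sD ZD[OF fZ[OF x(1)]] ZD[OF fZ[OF y(1)]]] by simp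
        moreover have "f p d x \<otimes>\<^bsub>?D\<^esub> inv\<^bsub>?D\<^esub> f p d y = f p d (x \<otimes>\<^bsub>?C\<^esub> inv\<^bsub>?C\<^esub> y)"
          using hom_imp_inv[OF complex_group[OF C] complex_group[OF D] chain_map_hom[OF f] ZC[OF y(1)]]
            hom_mult[OF chain_map_hom[OF f] ZC[OF x(1)] gC.inv_closed[OF ZC[OF y(1)]]] by simp
        moreover have "x \<otimes>\<^bsub>?C\<^esub> inv\<^bsub>?C\<^esub> y \<in> ?ZC"
          using x y subgroup_cocycles[OF C, of p d] by (simp add: subgroup.m_closed subgroup.m_inv_closed)
        ultimately have "x \<otimes>\<^bsub>?C\<^esub> inv\<^bsub>?C\<^esub> y \<in> ?BC" using I by simp
        then show "K = L" using gC.rcos_eq_iff[OF sC ZC[OF x(1)] ZC[OF y(1)]] x y by simp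
      qed
    qed
    have surj: "?F ` carrier (cohomology C p d) = carrier (cohomology D p d) \<longleftrightarrow> ?S"
    proof -
      have im: "?F ` carrier (cohomology C p d) = (\<lambda>x. ?BD #>\<^bsub>?D\<^esub> f p d x) ` ?ZC"
        unfolding carrier_cohomology[OF C] image_image using cm by (rule image_cong[OF refl])
      have "?F ` carrier (cohomology C p d) \<subseteq> carrier (cohomology D p d)"
        unfolding im carrier_cohomology[OF D] using fZ by blast
      moreover have "carrier (cohomology D p d) \<subseteq> ?F ` carrier (cohomology C p d) \<longleftrightarrow>
         (\<forall>y\<in>?ZD. \<exists>x\<in>?ZC. ?BD #>\<^bsub>?D\<^esub> y = ?BD #>\<^bsub>?D\<^esub> f p d x)"
        unfolding im carrier_cohomology[OF D] by blast
      moreover have "\<dots> \<longleftrightarrow> ?S"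
        using gD.rcos_eq_iff[OF sD] ZD fZ by simp
      ultimately show ?thesis by blast
    qed
    show ?thesis using hom inj surj by (auto simp: iso_def bij_betw_def)
  qed
  then show ?thesis by (auto simp: is_quasi_iso_def qiso_def f)
qed (simp add: is_quasi_iso_def qiso_def)

lemma qiso_chain_map: "qiso R C D f \<Longrightarrow> is_chain_map R C D f"
  by (simp add: qiso_def)

lemma qiso_reflects_coboundaries:
  "qiso R C D f \<Longrightarrow> x \<in> cocycles C p d \<Longrightarrow> f p d x \<in> coboundaries D p d \<Longrightarrow> x \<in> coboundaries C p d"
  by (simp add: qiso_def)

lemma qiso_surj:
  assumes "qiso R C D f" "y \<in> cocycles D p d"
  obtains x where "x \<in> cocycles C p d" "y \<otimes>\<^bsub>cpart D p d\<^esub> inv\<^bsub>cpart D p d\<^esub> f p d x \<in> coboundaries D p d"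
  using assms unfolding qiso_def by blast

lemma chain_map_comp:
  assumes f: "is_chain_map R C D f" and g: "is_chain_map R D E g"
  shows "is_chain_map R C E (\<lambda>p d x. g p d (f p d x))"
  unfolding is_chain_map_def is_graded_hom_def
proof (intro conjI allI ballI)
  show "(\<lambda>x. g p d (f p d x)) \<in> hom (cpart C p d) (cpart E p d)" for p d
    using hom_compose[OF chain_map_hom[OF f, of p d] chain_map_hom[OF g, of p d]] by (simp add: comp_def)
  show "g p (a + d) (f p (a + d) (cact C p a d r m)) = cact E p a d r (g p d (f p d m))"
    if "r \<in> homog R a" "m \<in> carrier (cpart C p d)" for p a d r m
    using that by (simp add: chain_map_act[OF f] chain_map_act[OF g] chain_map_closed[OF f])
  show "g (p + 1) d (f (p + 1) d (diff C p d x)) = diff E p d (g p d (f p d x))"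
    if "x \<in> carrier (cpart C p d)" for p d x
    using that by (simp add: is_chain_mapD(2)[OF f] is_chain_mapD(2)[OF g] chain_map_closed[OF f])
qed

lemma qiso_comp:
  assumes C: "is_complex R C" and D: "is_complex R D" and E: "is_complex R E"
    and f: "qiso R C D f" and g: "qiso R D E g"
  shows "qiso R C E (\<lambda>p d x. g p d (f p d x))"
  unfolding qiso_def
proof (intro conjI allI ballI impI)
  note cf = qiso_chain_map[OF f] and cg = qiso_chain_map[OF g]
  show "is_chain_map R C E (\<lambda>p d x. g p d (f p d x))" by (rule chain_map_comp[OF cf cg])
  show "x \<in> coboundaries C p d"
    if "x \<in> cocycles C p d" "g p d (f p d x) \<in> coboundaries E p d" for p d x
    using that qiso_reflects_coboundaries[OF f] qiso_reflects_coboundaries[OF g] chain_map_cocycles[OF C D cf]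
    by blast
  show "\<exists>x\<in>cocycles C p d. y \<otimes>\<^bsub>cpart E p d\<^esub> inv\<^bsub>cpart E p d\<^esub> g p d (f p d x) \<in> coboundaries E p d"
    if y: "y \<in> cocycles E p d" for p d y
  proof -
    interpret gD: comm_group "cpart D p d" by (rule complex_group[OF D])
    interpret gE: comm_group "cpart E p d" by (rule complex_group[OF E])
    obtain z where z: "z \<in> cocycles D p d"
      and yz: "y \<otimes>\<^bsub>cpart E p d\<^esub> inv\<^bsub>cpart E p d\<^esub> g p d z \<in> coboundaries E p d"
      using qiso_surj[OF g y] .
    obtain x where x: "x \<in> cocycles C p d"
      and zx: "z \<otimes>\<^bsub>cpart D p d\<^esub> inv\<^bsub>cpart D p d\<^esub> f p d x \<in> coboundaries D p d"
      using qiso_surj[OF f z] .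
    have zc: "z \<in> carrier (cpart D p d)" using z by (simp add: mem_cocycles_iff)
    have fx: "f p d x \<in> carrier (cpart D p d)"
      using x chain_map_closed[OF cf] by (simp add: mem_cocycles_iff)
    have yc: "y \<in> carrier (cpart E p d)" using y by (simp add: mem_cocycles_iff)
    have gz: "g p d z \<in> carrier (cpart E p d)" and gfx: "g p d (f p d x) \<in> carrier (cpart E p d)"
      using chain_map_closed[OF cg] zc fx by blast+
    have "g p d (z \<otimes>\<^bsub>cpart D p d\<^esub> inv\<^bsub>cpart D p d\<^esub> f p d x) \<in> coboundaries E p d"
      by (rule chain_map_coboundaries[OF cg zx])
    also have "g p d (z \<otimes>\<^bsub>cpart D p d\<^esub> inv\<^bsub>cpart D p d\<^esub> f p d x)
        = g p d z \<otimes>\<^bsub>cpart E p d\<^esub> inv\<^bsub>cpart E p d\<^esub> g p d (f p d x)"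
      using hom_mult[OF chain_map_hom[OF cg] zc gD.inv_closed[OF fx]]
        hom_imp_inv[OF complex_group[OF D] complex_group[OF E] chain_map_hom[OF cg] fx] by simp
    finally have "(y \<otimes>\<^bsub>cpart E p d\<^esub> inv\<^bsub>cpart E p d\<^esub> g p d z) \<otimes>\<^bsub>cpart E p d\<^esub>
        (g p d z \<otimes>\<^bsub>cpart E p d\<^esub> inv\<^bsub>cpart E p d\<^esub> g p d (f p d x)) \<in> coboundaries E p d"
      using yz subgroup.m_closed[OF subgroup_coboundaries[OF E]] by blast
    also have "(y \<otimes>\<^bsub>cpart E p d\<^esub> inv\<^bsub>cpart E p d\<^esub> g p d z) \<otimes>\<^bsub>cpart E p d\<^esub>
        (g p d z \<otimes>\<^bsub>cpart E p d\<^esub> inv\<^bsub>cpart E p d\<^esub> g p d (f p d x))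
        = y \<otimes>\<^bsub>cpart E p d\<^esub> inv\<^bsub>cpart E p d\<^esub> g p d (f p d x)"
      using yc gz gfx gE.inv_solve_left' by (simp add: gE.m_assoc)
    finally show ?thesis using x by blast
  qed
qed

lemma qiso_acyclic_iff:
  assumes C: "is_complex R C" and D: "is_complex R D" and f: "qiso R C D f"
  shows "acyclic_complex C \<longleftrightarrow> acyclic_complex D"
  unfolding acyclic_complex_iff[OF C] acyclic_complex_iff[OF D]
proof (intro iffI allI subsetI)
  note cf = qiso_chain_map[OF f]
  fix p d y
  assume a: "\<forall>p d. cocycles C p d \<subseteq> coboundaries C p d" and y: "y \<in> cocycles D p d"
  interpret gD: comm_group "cpart D p d" by (rule complex_group[OF D])
  obtain x where x: "x \<in> cocycles C p d"
    and yx: "y \<otimes>\<^bsub>cpart D p d\<^esub> inv\<^bsub>cpart D p d\<^esub> f p d x \<in> coboundaries D p d"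
    using qiso_surj[OF f y] .
  have fx: "f p d x \<in> coboundaries D p d" using a x chain_map_coboundaries[OF cf] by blast
  have c: "y \<in> carrier (cpart D p d)" "f p d x \<in> carrier (cpart D p d)"
    using y fx subgroup.mem_carrier[OF subgroup_coboundaries[OF D]] by (auto simp: mem_cocycles_iff)
  have "(y \<otimes>\<^bsub>cpart D p d\<^esub> inv\<^bsub>cpart D p d\<^esub> f p d x) \<otimes>\<^bsub>cpart D p d\<^esub> f p d x \<in> coboundaries D p d"
    using yx fx subgroup.m_closed[OF subgroup_coboundaries[OF D]] by blast
  then show "y \<in> coboundaries D p d" using c by (simp add: gD.m_assoc)
next
  note cf = qiso_chain_map[OF f]
  fix p d x
  assume "\<forall>p d. cocycles D p d \<subseteq> coboundaries D p d" and "x \<in> cocycles C p d"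
  then show "x \<in> coboundaries C p d"
    using qiso_reflects_coboundaries[OF f] chain_map_cocycles[OF C D cf] by blast
qed

lemma iso_imp_qiso:
  assumes C: "is_complex R C" and D: "is_complex R D"
    and f: "is_chain_map R C D f" and iso: "\<And>p d. f p d \<in> iso (cpart C p d) (cpart D p d)"
  shows "qiso R C D f"
  unfolding qiso_def
proof (intro conjI allI ballI impI)
  have inj: "inj_on (f p d) (carrier (cpart C p d))" and im: "f p d ` carrier (cpart C p d) = carrier (cpart D p d)"
    for p d using iso[of p d] by (auto simp: iso_def bij_betw_def)
  show "is_chain_map R C D f" by fact
  show "x \<in> coboundaries C p d" if x: "x \<in> cocycles C p d" and fx: "f p d x \<in> coboundaries D p d" for p d x
  proof -
    obtain y where y: "y \<in> carrier (cpart D (p - 1) d)" "f p d x = diff D (p - 1) d y"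
      using fx by (auto simp: coboundaries_def)
    obtain w where w: "w \<in> carrier (cpart C (p - 1) d)" "y = f (p - 1) d w"
      using y(1) im[of "p - 1" d] by blast
    have "f p d x = f p d (diff C (p - 1) d w)"
      using y(2) w is_chain_mapD(2)[OF f w(1)] by simp
    then have "x = diff C (p - 1) d w"
      using inj[of p d] x diff_closed[OF C w(1)] by (auto simp: mem_cocycles_iff inj_on_def)
    then show ?thesis using w(1) by (auto simp: coboundaries_def)
  qed
  show "\<exists>x\<in>cocycles C p d. y \<otimes>\<^bsub>cpart D p d\<^esub> inv\<^bsub>cpart D p d\<^esub> f p d x \<in> coboundaries D p d"
    if y: "y \<in> cocycles D p d" for p d y
  proof -
    interpret gD: comm_group "cpart D p d" by (rule complex_group[OF D])
    have yc: "y \<in> carrier (cpart D p d)" "diff D p d y = \<one>\<^bsub>cpart D (p + 1) d\<^esub>"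
      using y by (auto simp: mem_cocycles_iff)
    then obtain x where x: "x \<in> carrier (cpart C p d)" "y = f p d x" using im[of p d] by blast
    have "f (p + 1) d (diff C p d x) = f (p + 1) d \<one>\<^bsub>cpart C (p + 1) d\<^esub>"
      using is_chain_mapD(2)[OF f x(1)] x(2) yc(2)
        hom_imp_one[OF complex_group[OF C] complex_group[OF D] chain_map_hom[OF f]] by simp
    then have "diff C p d x = \<one>\<^bsub>cpart C (p + 1) d\<^esub>"
      using inj[of "p + 1" d] diff_closed[OF C x(1)] comm_group_imp_group[OF complex_group[OF C, of "p + 1" d]]
      by (auto simp: inj_on_def group.is_monoid monoid.one_closed)
    then have "x \<in> cocycles C p d" using x(1) by (simp add: mem_cocycles_iff)
    moreover have "y \<otimes>\<^bsub>cpart D p d\<^esub> inv\<^bsub>cpart D p d\<^esub> f p d x \<in> coboundaries D p d"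
      using x yc(1) subgroup.one_closed[OF subgroup_coboundaries[OF D]] by simp
    ultimately show ?thesis by blast
  qed
qed

lemma qiso_id: "is_complex R C \<Longrightarrow> qiso R C C (\<lambda>p d x. x)"
  by (rule iso_imp_qiso)
     (auto simp: is_chain_map_def is_graded_hom_def hom_def iso_def bij_betw_def)


section \<open>Zero objects of the derived category\<close>

lemma is_complex_zero: "is_complex R zero_complex"
  unfolding is_complex_def is_graded_module_def is_graded_hom_def zero_complex_def
  by (auto simp: singleton_group_def hom_def intro!: comm_groupI)

text \<open>
  Both legs of a roof preserve and reflect acyclicity, and the zero complex is acyclic; conversely an
  acyclic complex is itself the tip of a roof, with the zero map as one of its legs.
\<close>
lemma derived_zero_iff:
  fixes C :: "('l, 'u) cochain_complex"
  assumes C: "is_complex R C"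
  shows "derived_zero R C \<longleftrightarrow> acyclic_complex C"
proof -
  let ?Z = "zero_complex :: ('l, 'u) cochain_complex"
  note Z = is_complex_zero[of R, where ?'b = 'u]
  have carr: "carrier (cpart ?Z p d) = {undefined}" "\<one>\<^bsub>cpart ?Z p d\<^esub> = undefined" for p d
    by (simp_all add: zero_complex_def singleton_group_def)
  have acZ: "acyclic_complex ?Z"
    unfolding acyclic_complex_iff[OF Z]
  proof (intro allI subsetI)
    fix p d x assume "x \<in> cocycles ?Z p d"
    then have "x = \<one>\<^bsub>cpart ?Z p d\<^esub>" by (simp add: mem_cocycles_iff carr)
    then show "x \<in> coboundaries ?Z p d" using subgroup.one_closed[OF subgroup_coboundaries[OF Z]] by simp
  qed
  show ?thesis
  proof
    assume "derived_zero R C"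
    then obtain A :: "('l, 'u) cochain_complex" and f g
      where A: "is_complex R A" "is_quasi_iso R A C f" "is_quasi_iso R A ?Z g"
      unfolding derived_zero_def derived_isomorphic_def by blast
    have "acyclic_complex A"
      using qiso_acyclic_iff[OF A(1) Z] A(3) acZ by (simp add: quasi_iso_iff[OF A(1) Z])
    then show "acyclic_complex C"
      using qiso_acyclic_iff[OF A(1) C] A(2) by (simp add: quasi_iso_iff[OF A(1) C])
  next
    assume ac: "acyclic_complex C"
    let ?g = "\<lambda>(p::int) (d::int) (x::'u). undefined :: 'u"
    have ch: "is_chain_map R C ?Z ?g"
      by (auto simp: is_chain_map_def is_graded_hom_def zero_complex_def singleton_group_def hom_def)
    have "qiso R C ?Z ?g"
      unfolding qiso_def
    proof (intro conjI allI ballI impI ch)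
      show "x \<in> coboundaries C p d" if "x \<in> cocycles C p d" for p d x
        using that ac by (auto simp: acyclic_complex_iff[OF C])
      show "\<exists>x\<in>cocycles C p d. y \<otimes>\<^bsub>cpart ?Z p d\<^esub> inv\<^bsub>cpart ?Z p d\<^esub> undefined \<in> coboundaries ?Z p d"
        if y: "y \<in> cocycles ?Z p d" for p d y
      proof
        show "\<one>\<^bsub>cpart C p d\<^esub> \<in> cocycles C p d"
          by (rule subgroup.one_closed[OF subgroup_cocycles[OF C]])
        interpret comm_group "cpart ?Z p d" by (rule complex_group[OF Z])
        have "y \<otimes>\<^bsub>cpart ?Z p d\<^esub> inv\<^bsub>cpart ?Z p d\<^esub> undefined \<in> carrier (cpart ?Z p d)"
          using y by (intro m_closed inv_closed) (auto simp: mem_cocycles_iff carr)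
        then have "y \<otimes>\<^bsub>cpart ?Z p d\<^esub> inv\<^bsub>cpart ?Z p d\<^esub> undefined = \<one>\<^bsub>cpart ?Z p d\<^esub>"
          unfolding carr by simp
        then show "y \<otimes>\<^bsub>cpart ?Z p d\<^esub> inv\<^bsub>cpart ?Z p d\<^esub> undefined \<in> coboundaries ?Z p d"
          using subgroup.one_closed[OF subgroup_coboundaries[OF Z]] by simp
      qed
    qed
    then have "is_quasi_iso R C ?Z ?g" by (simp add: quasi_iso_iff[OF C Z])
    moreover have "is_quasi_iso R C C (\<lambda>p d x. x)" using qiso_id[OF C] by (simp add: quasi_iso_iff[OF C C])
    ultimately show "derived_zero R C"
      unfolding derived_zero_def derived_isomorphic_def using C by blast
  qed
qed


section \<open>Copies of complexes on other types\<close>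

text \<open>
  Complexes built by a construction (cones, tensor products, telescopes) live on a new type. Transport
  of structure along an injection brings them back to the type over which \<open>K_flat\<close> and
  \<open>derived_isomorphic\<close> quantify.
\<close>
lemma complex_copy:
  fixes C :: "('l, 'v) cochain_complex" and h :: "'v \<Rightarrow> 'u"
  assumes C: "is_complex R C" and inj: "\<And>p d. inj_on h (carrier (cpart C p d))"
  obtains T :: "('l, 'u) cochain_complex" and f
    where "is_complex R T" "is_chain_map R T C f" "\<And>p d. f p d \<in> iso (cpart T p d) (cpart C p d)"
proof -
  define g where "g p d = inv_into (carrier (cpart C p d)) h" for p d
  define T where "T = \<lparr>term_at = (\<lambda>p. \<lparr>part = (\<lambda>d. \<lparr>carrier = h ` carrier (cpart C p d),
       monoid.mult = (\<lambda>x y. h (g p d x \<otimes>\<^bsub>cpart C p d\<^esub> g p d y)), one = h \<one>\<^bsub>cpart C p d\<^esub>\<rparr>),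
     act = (\<lambda>a d r x. h (cact C p a d r (g p d x)))\<rparr>), diff = (\<lambda>p d x. h (diff C p d (g p d x)))\<rparr>"
  have gh: "g p d (h x) = x" if "x \<in> carrier (cpart C p d)" for p d x
    unfolding g_def using inv_into_f_f[OF inj that] .
  have carr: "carrier (cpart T p d) = h ` carrier (cpart C p d)"
    and mult: "monoid.mult (cpart T p d) = (\<lambda>x y. h (g p d x \<otimes>\<^bsub>cpart C p d\<^esub> g p d y))"
    and one: "\<one>\<^bsub>cpart T p d\<^esub> = h \<one>\<^bsub>cpart C p d\<^esub>"
    and act: "cact T p = (\<lambda>a d r x. h (cact C p a d r (g p d x)))"
    and dif: "diff T p d = (\<lambda>x. h (diff C p d (g p d x)))" for p d
    by (simp_all add: T_def)
  have grp: "comm_group (cpart T p d)" for p d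
  proof -
    interpret comm_group "cpart C p d" by (rule complex_group[OF C])
    show ?thesis
    proof (rule comm_groupI; (unfold carr mult one))
      fix x assume "x \<in> h ` carrier (cpart C p d)"
      then obtain x' where "x' \<in> carrier (cpart C p d)" "x = h x'" by blast
      then show "\<exists>y\<in>h ` carrier (cpart C p d). h (g p d y \<otimes>\<^bsub>cpart C p d\<^esub> g p d x) = h \<one>\<^bsub>cpart C p d\<^esub>"
        by (intro bexI[of _ "h (inv\<^bsub>cpart C p d\<^esub> x')"]) (auto simp: gh)
    qed (auto simp: gh m_ac)
  qed
  have homh: "(\<lambda>x. h (F (g p d x))) \<in> hom (cpart T p d) (cpart T q e)"
    if "F \<in> hom (cpart C p d) (cpart C q e)" for F p d q e
  proof (rule homI)
    interpret comm_group "cpart C p d" by (rule complex_group[OF C])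
    show "h (F (g p d x)) \<in> carrier (cpart T q e)" if "x \<in> carrier (cpart T p d)" for x
      using that hom_imp_closed[OF \<open>F \<in> _\<close>] by (auto simp: carr gh)
    show "h (F (g p d (x \<otimes>\<^bsub>cpart T p d\<^esub> y))) = h (F (g p d x)) \<otimes>\<^bsub>cpart T q e\<^esub> h (F (g p d y))"
      if "x \<in> carrier (cpart T p d)" "y \<in> carrier (cpart T p d)" for x y
      using that hom_imp_closed[OF \<open>F \<in> _\<close>] hom_mult[OF \<open>F \<in> _\<close>] by (auto simp: carr gh mult)
  qed
  note Cm = complex_module[OF C]
  interpret comm_group "cpart C p d" for p d by (rule complex_group[OF C])
  have "is_graded_module R (term_at T p)" for p
    unfolding is_graded_module_def
    by (intro conjI allI ballI grp)
       (auto simp: act carr mult gh act_hom[OF Cm] act_closed[OF Cm] act_add_scalar[OF Cm] act_act[OF Cm] act_one[OF Cm] intro: homh)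
  moreover have "is_graded_hom R (term_at T p) (term_at T (p + 1)) (diff T p)" for p
    unfolding is_graded_hom_def
    by (auto simp: act carr gh dif diff_hom[OF C] diff_closed[OF C] diff_act[OF C] act_closed[OF Cm] intro: homh)
  ultimately have T: "is_complex R T"
    by (auto simp: is_complex_def dif carr gh diff_closed[OF C] diff_diff[OF C] one)
  have ch: "is_chain_map R T C g"
    by (auto simp: is_chain_map_def is_graded_hom_def hom_def carr gh mult act act_closed[OF Cm] dif diff_closed[OF C])
  have "g p d \<in> iso (cpart T p d) (cpart C p d)" for p d
    using chain_map_hom[OF ch, of p d]
    by (auto simp: iso_def bij_betw_def inj_on_def carr gh image_image)
  with T ch that show thesis by blast
qed

lemma inverse_chain_map:
  assumes T: "is_complex R T" and C: "is_complex R C" and f: "is_chain_map R T C f"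
    and iso: "\<And>p d. f p d \<in> iso (cpart T p d) (cpart C p d)"
  obtains g where "is_chain_map R C T g"
    "\<And>p d x. x \<in> carrier (cpart C p d) \<Longrightarrow> f p d (g p d x) = x"
    "\<And>p d x. x \<in> carrier (cpart T p d) \<Longrightarrow> g p d (f p d x) = x"
proof -
  define g where "g p d = inv_into (carrier (cpart T p d)) (f p d)" for p d
  have bij: "bij_betw (f p d) (carrier (cpart T p d)) (carrier (cpart C p d))" for p d
    using iso[of p d] by (simp add: iso_def)
  have fg: "f p d (g p d x) = x" if "x \<in> carrier (cpart C p d)" for p d x
    unfolding g_def using bij_betw_inv_into_right[OF bij that] .
  have gf: "g p d (f p d x) = x" if "x \<in> carrier (cpart T p d)" for p d x
    unfolding g_def using bij_betw_inv_into_left[OF bij that] .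
  have gh: "g p d \<in> hom (cpart C p d) (cpart T p d)" for p d
    using group.iso_set_sym[OF comm_group_imp_group[OF complex_group[OF T]] iso[of p d]]
    by (simp add: g_def iso_def)
  note gc = hom_imp_closed[OF gh]
  have "g p (a + d) (cact C p a d r x) = cact T p a d r (g p d x)"
    if r: "r \<in> homog R a" and x: "x \<in> carrier (cpart C p d)" for p a d r x
    using gf[OF act_closed[OF complex_module[OF T] r gc[OF x]]] chain_map_act[OF f r gc[OF x]] fg[OF x] by simp
  moreover have "g (p + 1) d (diff C p d x) = diff T p d (g p d x)"
    if x: "x \<in> carrier (cpart C p d)" for p d x
    using gf[OF diff_closed[OF T gc[OF x]]] is_chain_mapD(2)[OF f gc[OF x]] fg[OF x] by simp
  ultimately have "is_chain_map R C T g" by (auto simp: is_chain_map_def is_graded_hom_def gh)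
  then show thesis using that fg gf by blast
qed


section \<open>Tensor products at the level of formal sums\<close>

lemma frag_cmul_diff_right: "frag_cmul k (u - v) = frag_cmul k u - frag_cmul k v"
  by (rule poly_mapping_eqI) (simp add: lookup_minus right_diff_distrib)

text \<open>
  The tensor product is computed with on the level of formal sums of symbols, up to membership of
  differences in \<open>tensor_rels\<close>; cosets reappear only when a statement about complexes is needed.
\<close>
definition tchains :: "('l, 'u) cochain_complex \<Rightarrow> ('l, 'v) cochain_complex \<Rightarrow> int \<Rightarrow> int \<Rightarrow> ('u, 'v) tensor_frag set" where
  "tchains C D n d = {c. Poly_Mapping.keys c \<subseteq> tensor_gens C D n d}"

lemma carrier_free_tensor: "carrier (free_Abelian_group (tensor_gens C D n d)) = tchains C D n d"
  by (auto simp: tchains_def)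

lemma mem_tensor_gens:
  "(p, a, x, y) \<in> tensor_gens C D n d \<longleftrightarrow> x \<in> carrier (cpart C p a) \<and> y \<in> carrier (cpart D (n - p) (d - a))"
  by (simp add: tensor_gens_def)

lemma tchains_frag_of:
  "frag_of (p, a, x, y) \<in> tchains C D n d \<longleftrightarrow> x \<in> carrier (cpart C p a) \<and> y \<in> carrier (cpart D (n - p) (d - a))"
  by (simp add: tchains_def mem_tensor_gens)

lemma tchains_zero: "0 \<in> tchains C D n d"
  by (simp add: tchains_def)

lemma tchains_add: "c \<in> tchains C D n d \<Longrightarrow> c' \<in> tchains C D n d \<Longrightarrow> c + c' \<in> tchains C D n d"
  using keys_add[of c c'] by (auto simp: tchains_def)

lemma tchains_diff: "c \<in> tchains C D n d \<Longrightarrow> c' \<in> tchains C D n d \<Longrightarrow> c - c' \<in> tchains C D n d"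
  using keys_diff[of c c'] by (auto simp: tchains_def)

lemma tchains_uminus: "c \<in> tchains C D n d \<Longrightarrow> - c \<in> tchains C D n d"
  by (simp add: tchains_def)

lemma tchains_cmul: "c \<in> tchains C D n d \<Longrightarrow> frag_cmul k c \<in> tchains C D n d"
  using keys_cmul[of k c] by (auto simp: tchains_def)

lemma tchains_sum: "(\<And>i. i \<in> I \<Longrightarrow> c i \<in> tchains C D n d) \<Longrightarrow> sum c I \<in> tchains C D n d"
  by (induction I rule: infinite_finite_induct) (auto simp: tchains_zero tchains_add)

text \<open>
  Closure under differences is the only induction step, so that it suffices to know of a map on
  formal sums that it preserves differences.
\<close>
lemma tchains_induct [consumes 1, case_names zero gen diff]:
  assumes "c \<in> tchains C D n d" and "P 0"
    and "\<And>p a x y. x \<in> carrier (cpart C p a) \<Longrightarrow> y \<in> carrier (cpart D (n - p) (d - a)) \<Longrightarrow> P (frag_of (p, a, x, y))"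
    and "\<And>c c'. c \<in> tchains C D n d \<Longrightarrow> c' \<in> tchains C D n d \<Longrightarrow> P c \<Longrightarrow> P c' \<Longrightarrow> P (c - c')"
  shows "P c"
proof -
  have "Poly_Mapping.keys c \<subseteq> tensor_gens C D n d" using assms(1) by (simp add: tchains_def)
  then show ?thesis
    by (rule free_Abelian_group_induct) (use assms(2-4) in \<open>auto simp: tchains_def tensor_gens_def\<close>)
qed

lemma tensor_rels_induct [consumes 2, case_names zero relator diff]:
  assumes "c \<in> tensor_rels R C D n d" and sub: "tensor_relators R C D n d \<subseteq> tchains C D n d"
    and 0: "P 0" and rel: "\<And>c. c \<in> tensor_relators R C D n d \<Longrightarrow> P c"
    and diff: "\<And>c c'. P c \<Longrightarrow> P c' \<Longrightarrow> P (c - c')"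
  shows "P c"
  using assms(1) unfolding tensor_rels_def
proof (induction rule: generate.induct)
  case one
  show ?case using 0 by simp
next
  case (incl c)
  then show ?case by (rule rel)
next
  case (inv c)
  then have "c \<in> tchains C D n d" using sub by blast
  then have "inv\<^bsub>free_Abelian_group (tensor_gens C D n d)\<^esub> c = 0 - c" by (simp add: tchains_def)
  then show ?case using diff[OF 0 rel[OF inv]] by simp
next
  case (eng c c')
  have "c + c' = c - (0 - c')" by simp
  then show ?case using diff[OF eng.IH(1) diff[OF 0 eng.IH(2)]] by simp
qed

lemma tensor_relators_cases [consumes 1, case_names left right act]:
  assumes "c \<in> tensor_relators R C D n d"
  obtains (left) p a x x' y where
      "c = frag_of (p, a, x \<otimes>\<^bsub>cpart C p a\<^esub> x', y) - frag_of (p, a, x, y) - frag_of (p, a, x', y)"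
      "x \<in> carrier (cpart C p a)" "x' \<in> carrier (cpart C p a)" "y \<in> carrier (cpart D (n - p) (d - a))"
    | (right) p a x y y' where
      "c = frag_of (p, a, x, y \<otimes>\<^bsub>cpart D (n - p) (d - a)\<^esub> y') - frag_of (p, a, x, y) - frag_of (p, a, x, y')"
      "x \<in> carrier (cpart C p a)" "y \<in> carrier (cpart D (n - p) (d - a))" "y' \<in> carrier (cpart D (n - p) (d - a))"
    | (act) p a b r x y where
      "c = frag_of (p, b + a, cact C p b a r x, y) - frag_of (p, a, x, cact D (n - p) b (d - a - b) r y)"
      "r \<in> homog R b" "x \<in> carrier (cpart C p a)" "y \<in> carrier (cpart D (n - p) (d - a - b))"
  using assms unfolding tensor_relators_def Un_iff mem_Collect_eq
  by (elim disjE exE conjE) (rule that; assumption)+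

locale complex_pair = graded_cring R for R :: "'l graded_ring" (structure) +
  fixes C :: "('l, 'u) cochain_complex" and D :: "('l, 'v) cochain_complex"
  assumes C: "is_complex R C" and D: "is_complex R D"
begin

abbreviation "tfree n d \<equiv> free_Abelian_group (tensor_gens C D n d)"
abbreviation "rels n d \<equiv> tensor_rels R C D n d"
abbreviation "tch n d \<equiv> tchains C D n d"

lemmas C_module = complex_module[OF C]
lemmas D_module = complex_module[OF D]

lemma C_group: "comm_group (cpart C p d)" by (rule complex_group[OF C])
lemma D_group: "comm_group (cpart D p d)" by (rule complex_group[OF D])

sublocale Cg: comm_group "cpart C p d" for p d by (rule C_group)
sublocale Dg: comm_group "cpart D p d" for p d by (rule D_group)

lemma relators_subset: "tensor_relators R C D n d \<subseteq> tch n d"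
proof -
  have act: "frag_of (p, b + a, cact C p b a r x, y) - frag_of (p, a, x, cact D (n - p) b (d - a - b) r y) \<in> tch n d"
    if "r \<in> homog R b" "x \<in> carrier (cpart C p a)" "y \<in> carrier (cpart D (n - p) (d - a - b))" for p a b r x y
  proof -
    have e: "d - (b + a) = d - a - b" "b + (d - a - b) = d - a" by simp_all
    show ?thesis
      using act_closed[OF C_module that(1,2)] act_closed[OF D_module that(1,3)] that
      by (intro tchains_diff; simp only: tchains_frag_of e)
  qed
  show ?thesis
    unfolding tensor_relators_def
  proof (intro Un_least subsetI; elim CollectE exE conjE; hypsubst)
    fix p a b r x y assume "r \<in> homog R b" "x \<in> carrier (cpart C p a)" "y \<in> carrier (cpart D (n - p) (d - a - b))"
    then show "frag_of (p, b + a, cact C p b a r x, y) - frag_of (p, a, x, cact D (n - p) b (d - a - b) r y) \<in> tch n d"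
      by (rule act)
  qed (auto simp: tchains_frag_of intro!: tchains_diff)
qed

lemma rels_subgroup: "subgroup (rels n d) (tfree n d)"
  unfolding tensor_rels_def
  by (rule group.generate_is_subgroup) (simp_all only: group_free_Abelian_group carrier_free_tensor relators_subset)

lemma rels_chains: "c \<in> rels n d \<Longrightarrow> c \<in> tch n d"
  using subgroup.subset[OF rels_subgroup] by (auto simp: carrier_free_tensor)

lemma rels_zero: "0 \<in> rels n d"
  using subgroup.one_closed[OF rels_subgroup] by simp

lemma rels_uminus: "c \<in> rels n d \<Longrightarrow> - c \<in> rels n d"
  using subgroup.m_inv_closed[OF rels_subgroup, of c n d] rels_chains by (simp add: tchains_def)

lemma rels_add: "c \<in> rels n d \<Longrightarrow> c' \<in> rels n d \<Longrightarrow> c + c' \<in> rels n d"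
  using subgroup.m_closed[OF rels_subgroup] by simp

lemma rels_diff: "c \<in> rels n d \<Longrightarrow> c' \<in> rels n d \<Longrightarrow> c - c' \<in> rels n d"
  using rels_add[OF _ rels_uminus, of c n d c'] by simp

lemma rels_cmul: "c \<in> rels n d \<Longrightarrow> frag_cmul k c \<in> rels n d"
  by (rule frag_closure_minus_cmul) (auto intro: rels_zero rels_diff)

lemma rels_sum: "(\<And>i. i \<in> I \<Longrightarrow> c i \<in> rels n d) \<Longrightarrow> sum c I \<in> rels n d"
  by (induction I rule: infinite_finite_induct) (auto simp: rels_zero rels_add)

lemma rels_trans: "c - c' \<in> rels n d \<Longrightarrow> c' - c'' \<in> rels n d \<Longrightarrow> c - c'' \<in> rels n d"
  using rels_add[of "c - c'" n d "c' - c''"] by simp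

lemma rels_left:
  "x \<in> carrier (cpart C p a) \<Longrightarrow> x' \<in> carrier (cpart C p a) \<Longrightarrow> y \<in> carrier (cpart D (n - p) (d - a)) \<Longrightarrow>
    frag_of (p, a, x \<otimes>\<^bsub>cpart C p a\<^esub> x', y) - frag_of (p, a, x, y) - frag_of (p, a, x', y) \<in> rels n d"
  unfolding tensor_rels_def by (rule generate.incl) (auto simp: tensor_relators_def)

lemma rels_right:
  "x \<in> carrier (cpart C p a) \<Longrightarrow> y \<in> carrier (cpart D (n - p) (d - a)) \<Longrightarrow> y' \<in> carrier (cpart D (n - p) (d - a)) \<Longrightarrow>
    frag_of (p, a, x, y \<otimes>\<^bsub>cpart D (n - p) (d - a)\<^esub> y') - frag_of (p, a, x, y) - frag_of (p, a, x, y') \<in> rels n d"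
  unfolding tensor_rels_def by (rule generate.incl) (auto simp: tensor_relators_def)

lemma rels_act:
  assumes "r \<in> homog R b" "x \<in> carrier (cpart C p a)" "y \<in> carrier (cpart D (n - p) e)" "e = d - a - b" "a' = b + a"
  shows "frag_of (p, a', cact C p b a r x, y) - frag_of (p, a, x, cact D (n - p) b e r y) \<in> rels n d"
  unfolding tensor_rels_def using assms by (intro generate.incl) (auto simp: tensor_relators_def)

lemma rels_unit_left:
  assumes "y \<in> carrier (cpart D (n - p) (d - a))"
  shows "frag_of (p, a, \<one>\<^bsub>cpart C p a\<^esub>, y) \<in> rels n d"
  using rels_uminus[OF rels_left[OF Cg.one_closed Cg.one_closed assms]] by simp

lemma rels_unit_right:
  assumes "x \<in> carrier (cpart C p a)"
  shows "frag_of (p, a, x, \<one>\<^bsub>cpart D (n - p) (d - a)\<^esub>) \<in> rels n d"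
  using rels_uminus[OF rels_right[OF assms Dg.one_closed Dg.one_closed]] by simp

lemma rels_inv_right:
  assumes "x \<in> carrier (cpart C p a)" "y \<in> carrier (cpart D (n - p) (d - a))"
  shows "frag_of (p, a, x, inv\<^bsub>cpart D (n - p) (d - a)\<^esub> y) + frag_of (p, a, x, y) \<in> rels n d"
  using rels_diff[OF rels_unit_right[OF assms(1)] rels_right[OF assms(1) Dg.inv_closed[OF assms(2)] assms(2)]] assms(2)
  by (simp add: add.commute)

lemma rels_finprod_right:
  assumes "x \<in> carrier (cpart C p a)" "\<And>i. i \<in> I \<Longrightarrow> y i \<in> carrier (cpart D (n - p) (d - a))" "finite I"
  shows "frag_of (p, a, x, finprod (cpart D (n - p) (d - a)) y I) - (\<Sum>i\<in>I. frag_of (p, a, x, y i)) \<in> rels n d"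
  using assms(3,2)
proof (induction I)
  case empty
  then show ?case using rels_unit_right[OF assms(1)] by simp
next
  case (insert i I)
  have c: "y \<in> I \<rightarrow> carrier (cpart D (n - p) (d - a))" "y i \<in> carrier (cpart D (n - p) (d - a))"
    using insert.prems by auto
  have "frag_of (p, a, x, finprod (cpart D (n - p) (d - a)) y (insert i I)) - frag_of (p, a, x, y i)
      - frag_of (p, a, x, finprod (cpart D (n - p) (d - a)) y I) \<in> rels n d"
    using rels_right[OF assms(1) c(2) Dg.finprod_closed[OF c(1)]] insert c by simp
  from rels_add[OF this insert.IH] insert.prems show ?case
    using insert.hyps by (simp add: algebra_simps)
qed

end

text \<open>
  Two additive maps that agree modulo \<open>N\<close> on symbols agree modulo \<open>N\<close> on all formal sums. With
  \<open>N = {0}\<close> this yields equalities, with a group of relations it yields equalities of classes.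
\<close>
lemma frag_agree:
  assumes "c \<in> tchains C D n d" and "0 \<in> N" and "\<And>u v. u \<in> N \<Longrightarrow> v \<in> N \<Longrightarrow> u - v \<in> N"
    and "\<And>u v. \<Phi> (u - v) = \<Phi> u - \<Phi> v" and "\<And>u v. \<Psi> (u - v) = \<Psi> u - \<Psi> v"
    and "\<And>p a x y. x \<in> carrier (cpart C p a) \<Longrightarrow> y \<in> carrier (cpart D (n - p) (d - a)) \<Longrightarrow>
      \<Phi> (frag_of (p, a, x, y)) - \<Psi> (frag_of (p, a, x, y)) \<in> (N :: ('b \<Rightarrow>\<^sub>0 int) set)"
  shows "\<Phi> c - \<Psi> c \<in> N"
  using assms(1)
proof (induction rule: tchains_induct)
  case zero
  have "\<Phi> 0 = 0" "\<Psi> 0 = 0" using assms(4)[of 0 0] assms(5)[of 0 0] by simp_all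
  then show ?case using assms(2) by simp
next
  case (gen p a x y)
  then show ?case by (rule assms(6))
next
  case (diff c c')
  have "\<Phi> (c - c') - \<Psi> (c - c') = (\<Phi> c - \<Psi> c) - (\<Phi> c' - \<Psi> c')" by (simp add: assms(4,5))
  then show ?case using assms(3)[OF diff.IH] by simp
qed

text \<open>
  The common shape of most maps between tensor products below: \<open>x \<otimes> y\<close> goes to \<open>f x \<otimes> g y\<close> with a sign
  \<open>s\<close> that depends on the degree of \<open>x\<close>. The map \<open>f\<close> shifts the cohomological degree by \<open>k\<close> and
  the internal one by \<open>b\<close>. The differential, the scalar action, the maps induced by chain maps and
  the injections and projections of a cone are instances, so that compatibility with the relations
  is proved once (\<open>tensor_map_rels\<close>).
\<close>
definition tensor_map where
  "tensor_map s k b f g d = frag_extend (\<lambda>(p :: int, a :: int, x, y). frag_cmul (s p) (frag_of (p + k, b + a, f p a x, g p (d - a) y)))"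

lemma tensor_map_frag_of:
  "tensor_map s k b f g d (frag_of (p, a, x, y)) = frag_cmul (s p) (frag_of (p + k, b + a, f p a x, g p (d - a) y))"
  by (simp add: tensor_map_def)

lemma tensor_map_diff: "tensor_map s k b f g d (u - v) = tensor_map s k b f g d u - tensor_map s k b f g d v"
  by (simp add: tensor_map_def frag_extend_diff)

lemma tensor_map_add: "tensor_map s k b f g d (u + v) = tensor_map s k b f g d u + tensor_map s k b f g d v"
  by (simp add: tensor_map_def frag_extend_add)

lemma tensor_map_zero: "tensor_map s k b f g d 0 = 0"
  by (simp add: tensor_map_def)

lemma tensor_map_cmul: "tensor_map s k b f g d (frag_cmul m u) = frag_cmul m (tensor_map s k b f g d u)"
  by (simp add: tensor_map_def frag_extend_cmul)

definition tensor_compatible where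
  "tensor_compatible R C D C' D' n n' k b f g \<longleftrightarrow>
     (\<forall>p a. f p a \<in> hom (cpart C p a) (cpart C' (p + k) (b + a))) \<and>
     (\<forall>p a c. \<forall>r\<in>homog R c. \<forall>x\<in>carrier (cpart C p a).
        f p (c + a) (cact C p c a r x) = cact C' (p + k) c (b + a) r (f p a x)) \<and>
     (\<forall>p. is_graded_hom R (term_at D (n - p)) (term_at D' (n' - (p + k))) (g p))"

locale two_complex_pairs = complex_pair R C D + T: complex_pair R C' D'
  for R :: "'l graded_ring" (structure)
    and C :: "('l, 'u) cochain_complex" and D :: "('l, 'v) cochain_complex"
    and C' :: "('l, 'u2) cochain_complex" and D' :: "('l, 'v2) cochain_complex"
begin

lemma tensor_map_chains:
  assumes fg: "tensor_compatible R C D C' D' n n' k b f g" and c: "c \<in> tch n d" and d': "d' = b + d"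
  shows "tensor_map s k b f g d c \<in> T.tch n' d'"
  using c
proof (induction rule: tchains_induct)
  case zero
  then show ?case by (simp add: tensor_map_zero tchains_zero)
next
  case (gen p a x y)
  have "f p a x \<in> carrier (cpart C' (p + k) (b + a))"
    using hom_imp_closed[of "f p a"] fg gen(1) unfolding tensor_compatible_def by blast
  moreover have "g p (d - a) y \<in> carrier (cpart D' (n' - (p + k)) (d - a))"
    using hom_imp_closed[OF is_graded_homD(1)[of R _ _ "g p" "d - a"]] fg gen(2)
    unfolding tensor_compatible_def by blast
  ultimately show ?case
    by (auto simp: tensor_map_frag_of tchains_frag_of d' intro!: tchains_cmul)
next
  case (diff c c')
  then show ?case by (simp add: tensor_map_diff tchains_diff)
qed

lemma tensor_map_rels:
  assumes fg: "tensor_compatible R C D C' D' n n' k b f g" and c: "c \<in> rels n d" and d': "d' = b + d"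
  shows "tensor_map s k b f g d c \<in> T.rels n' d'"
  using c relators_subset
proof (induction rule: tensor_rels_induct)
  case zero
  then show ?case by (simp add: tensor_map_zero T.rels_zero)
next
  case (diff c c')
  then show ?case by (simp add: tensor_map_diff T.rels_diff)
next
  case (relator c)
  have f: "f p a \<in> hom (cpart C p a) (cpart C' (p + k) (b + a))" for p a
    using fg by (auto simp: tensor_compatible_def)
  have g: "g p e \<in> hom (cpart D (n - p) e) (cpart D' (n' - (p + k)) e)" for p e
    using fg by (auto simp: tensor_compatible_def is_graded_hom_def)
  have fact: "f p (c + a) (cact C p c a r x) = cact C' (p + k) c (b + a) r (f p a x)"
    if "r \<in> homog R c" "x \<in> carrier (cpart C p a)" for p a c r x
    using fg that by (auto simp: tensor_compatible_def)
  have gact: "g p (c + e) (cact D (n - p) c e r y) = cact D' (n' - (p + k)) c e r (g p e y)"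
    if "r \<in> homog R c" "y \<in> carrier (cpart D (n - p) e)" for p e c r y
    using fg that by (auto simp: tensor_compatible_def is_graded_hom_def)
  note fc = hom_imp_closed[OF f] and gc = hom_imp_closed[OF g]
  have deg: "d' - (b + a) = d - a" for a by (simp add: d')
  from relator show ?case
  proof (cases rule: tensor_relators_cases)
    case (left p a x x' y)
    have "frag_of (p + k, b + a, f p a x \<otimes>\<^bsub>cpart C' (p + k) (b + a)\<^esub> f p a x', g p (d - a) y)
       - frag_of (p + k, b + a, f p a x, g p (d - a) y) - frag_of (p + k, b + a, f p a x', g p (d - a) y) \<in> T.rels n' d'"
      by (rule T.rels_left) (simp_all add: left fc gc deg)
    from T.rels_cmul[OF this, of "s p"] show ?thesis
      unfolding left(1) tensor_map_diff tensor_map_frag_of hom_mult[OF f left(2,3)]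
      by (simp only: frag_cmul_diff_right)
  next
    case (right p a x y y')
    have "frag_of (p + k, b + a, f p a x, g p (d - a) y \<otimes>\<^bsub>cpart D' (n' - (p + k)) (d' - (b + a))\<^esub> g p (d - a) y')
       - frag_of (p + k, b + a, f p a x, g p (d - a) y) - frag_of (p + k, b + a, f p a x, g p (d - a) y') \<in> T.rels n' d'"
      by (rule T.rels_right) (simp_all add: right fc gc deg)
    from T.rels_cmul[OF this, of "s p"] show ?thesis
      unfolding right(1) tensor_map_diff tensor_map_frag_of hom_mult[OF g right(3,4)] deg
      by (simp only: frag_cmul_diff_right)
  next
    case (act p a c' r x y)
    define e where "e = d - a - c'"
    have e: "d - (c' + a) = e" "d - a = c' + e" "d - a - c' = e" by (simp_all add: e_def)
    have "frag_of (p + k, c' + (b + a), cact C' (p + k) c' (b + a) r (f p a x), g p e y)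
       - frag_of (p + k, b + a, f p a x, cact D' (n' - (p + k)) c' e r (g p e y)) \<in> T.rels n' d'"
      by (rule T.rels_act) (use act fc gc in \<open>auto simp: e_def d'\<close>)
    from T.rels_cmul[OF this, of "s p"] show ?thesis
      using fact[OF act(2,3)] gact[OF act(2), of y p e] act(4)
      unfolding act(1) tensor_map_diff tensor_map_frag_of e
      by (simp add: frag_cmul_diff_right add.left_commute)
  qed
qed

end


section \<open>The tensor product of two complexes is a complex\<close>

lemma tensor_diff_frag_of:
  "tensor_diff C D n d (frag_of (p, a, x, y)) =
     frag_of (p + 1, a, diff C p a x, y) + frag_cmul (if even p then 1 else - 1) (frag_of (p, a, x, diff D (n - p) (d - a) y))"
  by (simp add: tensor_diff_def)

lemma tensor_diff_diff: "tensor_diff C D n d (u - v) = tensor_diff C D n d u - tensor_diff C D n d v"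
  by (simp add: tensor_diff_def frag_extend_diff)

lemma tensor_diff_add: "tensor_diff C D n d (u + v) = tensor_diff C D n d u + tensor_diff C D n d v"
  by (simp add: tensor_diff_def frag_extend_add)

lemma tensor_diff_zero: "tensor_diff C D n d 0 = 0"
  by (simp add: tensor_diff_def)

lemma tensor_diff_uminus: "tensor_diff C D n d (- u) = - tensor_diff C D n d u"
  by (simp add: tensor_diff_def frag_extend_minus)

lemma tensor_diff_cmul: "tensor_diff C D n d (frag_cmul k u) = frag_cmul k (tensor_diff C D n d u)"
  by (simp add: tensor_diff_def frag_extend_cmul)

lemma tensor_diff_sum: "finite I \<Longrightarrow> tensor_diff C D n d (\<Sum>i\<in>I. u i) = (\<Sum>i\<in>I. tensor_diff C D n d (u i))"
  by (simp add: tensor_diff_def frag_extend_sum comp_def)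

lemma tensor_diff_eq_tensor_maps:
  "tensor_diff C D n d c = tensor_map (\<lambda>_. 1) 1 0 (diff C) (\<lambda>p e y. y) d c +
     tensor_map (\<lambda>p. if even p then 1 else - 1) 0 0 (\<lambda>p a x. x) (\<lambda>p. diff D (n - p)) d c"
proof -
  have "Poly_Mapping.keys c \<subseteq> UNIV" by simp
  then show ?thesis
  proof (induction c rule: frag_induction)
    case zero
    show ?case by (simp add: tensor_diff_zero tensor_map_zero)
  next
    case (one g)
    show ?case by (cases g) (simp add: tensor_diff_frag_of tensor_map_frag_of)
  next
    case (diff u v)
    then show ?case by (simp add: tensor_diff_diff tensor_map_diff)
  qed
qed

lemma tensor_act_frag_of: "tensor_act C b r (frag_of (p, a, x, y)) = frag_of (p, b + a, cact C p b a r x, y)"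
  by (simp add: tensor_act_def)

lemma tensor_act_diff: "tensor_act C b r (u - v) = tensor_act C b r u - tensor_act C b r v"
  by (simp add: tensor_act_def frag_extend_diff)

lemma tensor_act_eq_tensor_map:
  "tensor_act C b r = tensor_map (\<lambda>_. 1) 0 b (\<lambda>p a x. cact C p b a r x) (\<lambda>p e y. y) d"
  by (simp add: tensor_act_def tensor_map_def)

lemma homI_frag:
  assumes "\<And>c. c \<in> tchains C D n d \<Longrightarrow> \<Phi> c \<in> tchains C' D' n' d'"
    and "\<And>u v. \<Phi> (u - v) = \<Phi> u - (\<Phi> v :: ('u, 'v) tensor_frag)"
  shows "\<Phi> \<in> hom (free_Abelian_group (tensor_gens C D n d)) (free_Abelian_group (tensor_gens C' D' n' d'))"
proof (rule homI; unfold carrier_free_tensor)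
  show "\<Phi> c \<in> tchains C' D' n' d'" if "c \<in> tchains C D n d" for c using assms(1)[OF that] .
  fix u v
  have "\<Phi> (u + v) = \<Phi> (u - (0 - v))" by simp
  also have "\<dots> = \<Phi> u - (\<Phi> 0 - \<Phi> v)" unfolding assms(2) ..
  also have "\<Phi> 0 = 0" using assms(2)[of 0 0] by simp
  finally show "\<Phi> (u \<otimes>\<^bsub>free_Abelian_group (tensor_gens C D n d)\<^esub> v) = \<Phi> u \<otimes>\<^bsub>free_Abelian_group (tensor_gens C' D' n' d')\<^esub> \<Phi> v"
    by simp
qed

context complex_pair
begin

interpretation self: two_complex_pairs R C D C D ..

lemma id_graded_hom: "is_graded_hom R M M (\<lambda>e y. y)"
  by (auto simp: is_graded_hom_def hom_def)

lemma compatible_diff_left: "tensor_compatible R C D C D n (n + 1) 1 0 (diff C) (\<lambda>p e y. y)"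
  by (auto simp: tensor_compatible_def diff_hom[OF C] diff_act[OF C] id_graded_hom)

lemma compatible_diff_right: "tensor_compatible R C D C D n (n + 1) 0 0 (\<lambda>p a x. x) (\<lambda>p. diff D (n - p))"
proof -
  have "is_graded_hom R (term_at D (n - p)) (term_at D (n + 1 - p)) (diff D (n - p))" for p
  proof -
    have e: "n + 1 - p = n - p + 1" by simp
    show ?thesis unfolding e by (rule diff_graded_hom[OF D])
  qed
  then show ?thesis by (auto simp: tensor_compatible_def hom_def)
qed

lemma compatible_act:
  assumes "r \<in> homog R b"
  shows "tensor_compatible R C D C D n n 0 b (\<lambda>p a x. cact C p b a r x) (\<lambda>p e y. y)"
  using act_hom[OF C_module assms] act_commute[OF C_module _ assms]
  by (auto simp: tensor_compatible_def id_graded_hom)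

lemma tensor_diff_chains: "c \<in> tch n d \<Longrightarrow> tensor_diff C D n d c \<in> tch (n + 1) d"
  unfolding tensor_diff_eq_tensor_maps
  by (intro tchains_add self.tensor_map_chains[OF compatible_diff_left] self.tensor_map_chains[OF compatible_diff_right]) auto

lemma tensor_diff_rels: "c \<in> rels n d \<Longrightarrow> tensor_diff C D n d c \<in> rels (n + 1) d"
  unfolding tensor_diff_eq_tensor_maps
  by (intro rels_add self.tensor_map_rels[OF compatible_diff_left] self.tensor_map_rels[OF compatible_diff_right]) auto

lemma tensor_act_chains: "r \<in> homog R b \<Longrightarrow> c \<in> tch n d \<Longrightarrow> tensor_act C b r c \<in> tch n (b + d)"
  unfolding tensor_act_eq_tensor_map[of C b r d] by (rule self.tensor_map_chains[OF compatible_act]) auto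

lemma tensor_act_rels: "r \<in> homog R b \<Longrightarrow> c \<in> rels n d \<Longrightarrow> tensor_act C b r c \<in> rels n (b + d)"
  unfolding tensor_act_eq_tensor_map[of C b r d] by (rule self.tensor_map_rels[OF compatible_act]) auto

lemma tensor_act_hom: "r \<in> homog R b \<Longrightarrow> tensor_act C b r \<in> hom (tfree n d) (tfree n (b + d))"
  by (rule homI_frag) (auto simp: tensor_act_chains tensor_act_diff)

lemma tensor_diff_hom: "tensor_diff C D n d \<in> hom (tfree n d) (tfree (n + 1) d)"
  by (rule homI_frag) (auto simp: tensor_diff_chains tensor_diff_diff)

text \<open>
  The two mixed terms cancel, as the sign in \<open>tensor_diff\<close> changes when \<open>x\<close> is replaced by its
  differential. What remains are symbols with a trivial factor, which are relations.
\<close>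
lemma tensor_diff_tensor_diff:
  assumes "c \<in> tch n d" shows "tensor_diff C D (n + 1) d (tensor_diff C D n d c) \<in> rels (n + 2) d"
proof -
  have "tensor_diff C D (n + 1) d (tensor_diff C D n d c) - (\<lambda>_. 0) c \<in> rels (n + 2) d"
    using assms rels_zero rels_diff
  proof (rule frag_agree)
    fix p a x y assume x: "x \<in> carrier (cpart C p a)" and y: "y \<in> carrier (cpart D (n - p) (d - a))"
    let ?s = "if even p then 1 else - 1 :: int"
    have e: "n + 1 - (p + 1) = n - p" "n + 1 - p = n - p + 1" by simp_all
    have 1: "frag_of (p + 1 + 1, a, diff C (p + 1) a (diff C p a x), y) \<in> rels (n + 2) d"
    proof -
      have "diff C (p + 1) a (diff C p a x) = \<one>\<^bsub>cpart C (p + 1 + 1) a\<^esub>"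
        using diff_diff[OF C x] by (simp add: add.assoc)
      then show ?thesis using rels_unit_left[of y "n + 2" "p + 1 + 1" d a] y by simp
    qed
    have 2: "frag_of (p, a, x, diff D (n - p + 1) (d - a) (diff D (n - p) (d - a) y)) \<in> rels (n + 2) d"
    proof -
      have "n - p + 2 = n + 2 - p" by simp
      then have "diff D (n - p + 1) (d - a) (diff D (n - p) (d - a) y) = \<one>\<^bsub>cpart D (n + 2 - p) (d - a)\<^esub>"
        using diff_diff[OF D y] by (simp only:)
      then show ?thesis using rels_unit_right[OF x, of "n + 2" d] by simp
    qed
    have "tensor_diff C D (n + 1) d (tensor_diff C D n d (frag_of (p, a, x, y))) =
       frag_of (p + 1 + 1, a, diff C (p + 1) a (diff C p a x), y) +
       frag_of (p, a, x, diff D (n - p + 1) (d - a) (diff D (n - p) (d - a) y))"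
      by (simp only: tensor_diff_frag_of tensor_diff_add tensor_diff_cmul frag_cmul_distrib2 e) auto
    then show "tensor_diff C D (n + 1) d (tensor_diff C D n d (frag_of (p, a, x, y))) - 0 \<in> rels (n + 2) d"
      using rels_add[OF 1 2] by simp
  qed (simp_all add: tensor_diff_diff)
  then show ?thesis by simp
qed

lemma tfree_group: "comm_group (tfree n d)"
  by (rule abelian_free_Abelian_group)

lemma coset_eq_iff:
  assumes "c \<in> tch n d" "c' \<in> tch n d"
  shows "rels n d #>\<^bsub>tfree n d\<^esub> c = rels n d #>\<^bsub>tfree n d\<^esub> c' \<longleftrightarrow> c - c' \<in> rels n d"
  using comm_group.rcos_eq_iff[OF tfree_group rels_subgroup, of c n d c'] assms
  by (simp add: tchains_def)

lemma term_at_tensor_complex: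
  "term_at (tensor_complex R C D) n =
     \<lparr>part = \<lambda>d. tfree n d Mod rels n d,
      act = \<lambda>b d r. coset_map (tfree n (b + d)) (rels n (b + d)) (tensor_act C b r)\<rparr>"
  by (simp add: tensor_complex_def)

lemma diff_tensor_complex:
  "diff (tensor_complex R C D) n = (\<lambda>d. coset_map (tfree (n + 1) d) (rels (n + 1) d) (tensor_diff C D n d))"
  by (simp add: tensor_complex_def)

lemma tensor_act_add:
  assumes r: "r \<in> homog R b" and s: "s \<in> homog R b" and c: "c \<in> tch n d"
  shows "tensor_act C b (r \<oplus> s) c - (tensor_act C b r c + tensor_act C b s c) \<in> rels n (b + d)"
  using c rels_zero rels_diff
proof (rule frag_agree)
  fix p a x y assume x: "x \<in> carrier (cpart C p a)" and y: "y \<in> carrier (cpart D (n - p) (d - a))"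
  have "frag_of (p, b + a, cact C p b a (r \<oplus> s) x, y) - frag_of (p, b + a, cact C p b a r x, y)
     - frag_of (p, b + a, cact C p b a s x, y) \<in> rels n (b + d)"
    unfolding act_add_scalar[OF C_module r s x]
    by (rule rels_left) (simp_all add: act_closed[OF C_module _ x] r s y)
  then show "tensor_act C b (r \<oplus> s) (frag_of (p, a, x, y)) -
      (tensor_act C b r (frag_of (p, a, x, y)) + tensor_act C b s (frag_of (p, a, x, y))) \<in> rels n (b + d)"
    by (simp add: tensor_act_frag_of algebra_simps)
qed (simp_all add: tensor_act_diff)

lemma tensor_act_mult:
  assumes r: "r \<in> homog R a" and s: "s \<in> homog R b" and c: "c \<in> tch n d"
  shows "tensor_act C (a + b) (r \<otimes> s) c = tensor_act C a r (tensor_act C b s c)"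
proof -
  have "tensor_act C (a + b) (r \<otimes> s) c - tensor_act C a r (tensor_act C b s c) \<in> {0}"
    using c
    by (rule frag_agree) (auto simp: tensor_act_frag_of tensor_act_diff act_act[OF C_module r s] add.assoc)
  then show ?thesis by simp
qed

lemma tensor_act_one:
  assumes c: "c \<in> tch n d"
  shows "tensor_act C 0 \<one> c = c"
proof -
  have "tensor_act C 0 \<one> c - c \<in> {0}"
    using c by (rule frag_agree) (auto simp: tensor_act_frag_of tensor_act_diff act_one[OF C_module])
  then show ?thesis by simp
qed

lemma tensor_diff_act:
  assumes r: "r \<in> homog R b" and c: "c \<in> tch n d"
  shows "tensor_diff C D n (b + d) (tensor_act C b r c) = tensor_act C b r (tensor_diff C D n d c)"
proof -
  have "tensor_diff C D n (b + d) (tensor_act C b r c) - tensor_act C b r (tensor_diff C D n d c) \<in> {0}"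
    using c
  proof (rule frag_agree)
    fix p a x y assume x: "x \<in> carrier (cpart C p a)" and y: "y \<in> carrier (cpart D (n - p) (d - a))"
    have cm: "tensor_act C b r (frag_cmul k u) = frag_cmul k (tensor_act C b r u)" for k u
      by (simp add: tensor_act_def frag_extend_cmul)
    have ad: "tensor_act C b r (u + v) = tensor_act C b r u + tensor_act C b r v" for u v
      by (simp add: tensor_act_def frag_extend_add)
    show "tensor_diff C D n (b + d) (tensor_act C b r (frag_of (p, a, x, y))) -
        tensor_act C b r (tensor_diff C D n d (frag_of (p, a, x, y))) \<in> {0}"
      using diff_act[OF C r x] by (simp add: tensor_act_frag_of tensor_diff_frag_of ad cm)
  qed (auto simp: tensor_act_diff tensor_diff_diff)
  then show ?thesis by simp
qed

lemma is_complex_tensor: "is_complex R (tensor_complex R C D)"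
proof -
  have R: "graded_cring R" ..
  note G = tfree_group and N = rels_subgroup
  have pres: "tensor_act C b r ` rels n d \<subseteq> rels n (b + d)" if "r \<in> homog R b" for b r n d
    using tensor_act_rels[OF that] by blast
  have pres': "tensor_diff C D n d ` rels n d \<subseteq> rels (n + 1) d" for n d
    using tensor_diff_rels by blast
  have 1: "is_graded_module R (term_at (tensor_complex R C D) n)" for n
    unfolding term_at_tensor_complex
  proof (rule quotient_graded_module[OF G N tensor_act_hom pres _ _ _ R]; (unfold carrier_free_tensor)?)
    fix a b d r s c assume c: "c \<in> tch n d"
    show "rels n (b + d) #>\<^bsub>tfree n (b + d)\<^esub> tensor_act C b (r \<oplus> s) c
        = rels n (b + d) #>\<^bsub>tfree n (b + d)\<^esub> (tensor_act C b r c \<otimes>\<^bsub>tfree n (b + d)\<^esub> tensor_act C b s c)"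
      if "r \<in> homog R b" "s \<in> homog R b"
      using coset_eq_iff[of "tensor_act C b (r \<oplus> s) c" n "b + d" "tensor_act C b r c + tensor_act C b s c"]
        tensor_act_add[OF that c] tensor_act_chains c that by (simp add: homog_add tchains_add)
    show "rels n (a + b + d) #>\<^bsub>tfree n (a + b + d)\<^esub> tensor_act C (a + b) (r \<otimes> s) c
        = rels n (a + b + d) #>\<^bsub>tfree n (a + b + d)\<^esub> tensor_act C a r (tensor_act C b s c)"
      if "r \<in> homog R a" "s \<in> homog R b"
      using tensor_act_mult[OF that c] by simp
    show "rels n d #>\<^bsub>tfree n d\<^esub> tensor_act C 0 \<one> c = rels n d #>\<^bsub>tfree n d\<^esub> c"
      using tensor_act_one[OF c] by simp
  qed
  have 2: "is_graded_hom R (term_at (tensor_complex R C D) n) (term_at (tensor_complex R C D) (n + 1))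
      (diff (tensor_complex R C D) n)" for n
    unfolding term_at_tensor_complex diff_tensor_complex
    by (rule quotient_graded_hom[OF G N tensor_act_hom pres G N tensor_act_hom pres tensor_diff_hom pres'])
       (simp_all only: carrier_free_tensor tensor_diff_act)
  have cm: "coset_map (tfree (n + 1) d) (rels (n + 1) d) (tensor_diff C D n d) (rels n d #>\<^bsub>tfree n d\<^esub> c)
      = rels (n + 1) d #>\<^bsub>tfree (n + 1) d\<^esub> tensor_diff C D n d c" if "c \<in> tch n d" for n d c
    by (rule coset_map_rcos[OF G G N N tensor_diff_hom pres']) (simp only: carrier_free_tensor that)
  have 3: "diff (tensor_complex R C D) (n + 1) d (diff (tensor_complex R C D) n d K) = \<one>\<^bsub>cpart (tensor_complex R C D) (n + 2) d\<^esub>"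
    if K: "K \<in> carrier (cpart (tensor_complex R C D) n d)" for n d K
  proof -
    obtain c where c: "c \<in> tch n d" and Kc: "K = rels n d #>\<^bsub>tfree n d\<^esub> c"
      using K unfolding term_at_tensor_complex graded_module.select_convs carrier_FactGroup carrier_free_tensor by blast
    have e: "n + 1 + 1 = n + 2" by simp
    have "diff (tensor_complex R C D) (n + 1) d (diff (tensor_complex R C D) n d K)
        = rels (n + 2) d #>\<^bsub>tfree (n + 2) d\<^esub> tensor_diff C D (n + 1) d (tensor_diff C D n d c)"
      unfolding diff_tensor_complex Kc cm[OF c] cm[OF tensor_diff_chains[OF c], unfolded e] e ..
    also have "\<dots> = rels (n + 2) d"
      using comm_group.rcos_eq_self_iff[OF G N] tensor_diff_tensor_diff[OF c] rels_chains
      by (simp only: carrier_free_tensor)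
    finally show ?thesis by (simp add: term_at_tensor_complex)
  qed
  show ?thesis
    unfolding is_complex_def using 1 2 3 by blast
qed

definition tclass where "tclass n d c = rels n d #>\<^bsub>tfree n d\<^esub> c"

abbreviation "TC \<equiv> tensor_complex R C D"

lemma carrier_tensor: "carrier (cpart TC n d) = tclass n d ` tch n d"
  by (simp only: term_at_tensor_complex graded_module.select_convs carrier_FactGroup carrier_free_tensor tclass_def[abs_def])

lemma tclass_closed: "c \<in> tch n d \<Longrightarrow> tclass n d c \<in> carrier (cpart TC n d)"
  by (simp add: carrier_tensor)

lemma tclass_eq_iff: "c \<in> tch n d \<Longrightarrow> c' \<in> tch n d \<Longrightarrow> tclass n d c = tclass n d c' \<longleftrightarrow> c - c' \<in> rels n d"
  by (simp add: tclass_def coset_eq_iff)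

lemma one_tensor: "\<one>\<^bsub>cpart TC n d\<^esub> = tclass n d 0"
  using comm_group.rcos_eq_self_iff[OF tfree_group rels_subgroup, of 0 n d] rels_zero
  by (simp add: term_at_tensor_complex tclass_def)

lemma mult_tensor:
  "c \<in> tch n d \<Longrightarrow> c' \<in> tch n d \<Longrightarrow> tclass n d c \<otimes>\<^bsub>cpart TC n d\<^esub> tclass n d c' = tclass n d (c + c')"
  using comm_group.rcos_mult[OF tfree_group rels_subgroup, of c n d c']
  by (simp add: term_at_tensor_complex tclass_def tchains_def)

lemma inv_tensor: "c \<in> tch n d \<Longrightarrow> inv\<^bsub>cpart TC n d\<^esub> tclass n d c = tclass n d (- c)"
  using mult_tensor[of "- c" n d c] one_tensor[of n d]
  by (intro group.inv_equality[OF comm_group_imp_group[OF complex_group[OF is_complex_tensor]]])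
     (auto simp: tclass_closed tchains_uminus)

lemma act_tensor:
  assumes "r \<in> homog R b" "c \<in> tch n d"
  shows "cact TC n b d r (tclass n d c) = tclass n (b + d) (tensor_act C b r c)"
proof -
  have "coset_map (tfree n (b + d)) (rels n (b + d)) (tensor_act C b r) (rels n d #>\<^bsub>tfree n d\<^esub> c)
      = rels n (b + d) #>\<^bsub>tfree n (b + d)\<^esub> tensor_act C b r c"
    by (rule coset_map_rcos[OF tfree_group tfree_group rels_subgroup rels_subgroup tensor_act_hom[OF assms(1)]])
       (use assms tensor_act_rels in \<open>auto simp: carrier_free_tensor simp del: carrier_free_Abelian_group_iff\<close>)
  then show ?thesis by (simp add: term_at_tensor_complex tclass_def)
qed

lemma diff_tensor:
  assumes "c \<in> tch n d"
  shows "diff TC n d (tclass n d c) = tclass (n + 1) d (tensor_diff C D n d c)"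
proof -
  have "coset_map (tfree (n + 1) d) (rels (n + 1) d) (tensor_diff C D n d) (rels n d #>\<^bsub>tfree n d\<^esub> c)
      = rels (n + 1) d #>\<^bsub>tfree (n + 1) d\<^esub> tensor_diff C D n d c"
    by (rule coset_map_rcos[OF tfree_group tfree_group rels_subgroup rels_subgroup tensor_diff_hom])
       (use assms tensor_diff_rels in \<open>auto simp: carrier_free_tensor simp del: carrier_free_Abelian_group_iff\<close>)
  then show ?thesis by (simp add: diff_tensor_complex tclass_def)
qed

lemma tclass_eq_one_iff: "c \<in> tch n d \<Longrightarrow> tclass n d c = \<one>\<^bsub>cpart TC n d\<^esub> \<longleftrightarrow> c \<in> rels n d"
  by (simp add: one_tensor tclass_eq_iff tchains_zero)

lemma tclass_cocycle_iff:
  "c \<in> tch n d \<Longrightarrow> tclass n d c \<in> cocycles TC n d \<longleftrightarrow> tensor_diff C D n d c \<in> rels (n + 1) d"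
  by (simp add: mem_cocycles_iff tclass_closed diff_tensor tclass_eq_one_iff tensor_diff_chains)

lemma tclass_coboundary_iff:
  assumes c: "c \<in> tch n d"
  shows "tclass n d c \<in> coboundaries TC n d \<longleftrightarrow> (\<exists>b\<in>tch (n - 1) d. c - tensor_diff C D (n - 1) d b \<in> rels n d)"
proof -
  have d: "diff TC (n - 1) d (tclass (n - 1) d b) = tclass n d (tensor_diff C D (n - 1) d b)" if "b \<in> tch (n - 1) d" for b
    using diff_tensor[OF that] by simp
  have "tclass n d c \<in> coboundaries TC n d \<longleftrightarrow> (\<exists>b\<in>tch (n - 1) d. tclass n d c = diff TC (n - 1) d (tclass (n - 1) d b))"
    by (auto simp: coboundaries_def carrier_tensor)
  then show ?thesis
    using d tclass_eq_iff[OF c] tensor_diff_chains[of _ "n - 1" d] by auto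
qed

lemma acyclic_tensor_iff:
  "acyclic_complex TC \<longleftrightarrow> (\<forall>n d. \<forall>c\<in>tch n d. tensor_diff C D n d c \<in> rels (n + 1) d \<longrightarrow>
     (\<exists>b\<in>tch (n - 1) d. c - tensor_diff C D (n - 1) d b \<in> rels n d))" (is "_ \<longleftrightarrow> ?R")
proof -
  have "(\<forall>x. x \<in> cocycles TC n d \<longrightarrow> x \<in> coboundaries TC n d) \<longleftrightarrow>
     (\<forall>c\<in>tch n d. tclass n d c \<in> cocycles TC n d \<longrightarrow> tclass n d c \<in> coboundaries TC n d)" for n d
    using carrier_tensor[of n d] by (auto simp: mem_cocycles_iff)
  then show ?thesis
    unfolding acyclic_complex_iff[OF is_complex_tensor] subset_eq Ball_def
    by (simp add: tclass_cocycle_iff tclass_coboundary_iff Ball_def)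
qed

end


section \<open>Functoriality of the tensor product\<close>

definition tensor_hom where
  "tensor_hom f g n d = tensor_map (\<lambda>_. 1) 0 0 f (\<lambda>p. g (n - p)) d"

lemma tensor_hom_frag_of:
  "tensor_hom f g n d (frag_of (p, a, x, y)) = frag_of (p, a, f p a x, g (n - p) (d - a) y)"
  by (simp add: tensor_hom_def tensor_map_frag_of)

lemma tensor_hom_diff: "tensor_hom f g n d (u - v) = tensor_hom f g n d u - tensor_hom f g n d v"
  by (simp add: tensor_hom_def tensor_map_diff)

lemma tensor_hom_add: "tensor_hom f g n d (u + v) = tensor_hom f g n d u + tensor_hom f g n d v"
  by (simp add: tensor_hom_def tensor_map_add)

lemma tensor_hom_cmul: "tensor_hom f g n d (frag_cmul k u) = frag_cmul k (tensor_hom f g n d u)"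
  by (simp add: tensor_hom_def tensor_map_cmul)

locale tensor_of_chain_maps = two_complex_pairs R C D C' D'
  for R :: "'l graded_ring" (structure)
    and C :: "('l, 'u) cochain_complex" and D :: "('l, 'v) cochain_complex"
    and C' :: "('l, 'u2) cochain_complex" and D' :: "('l, 'v2) cochain_complex" +
  fixes f g
  assumes f: "is_chain_map R C C' f" and g: "is_chain_map R D D' g"
begin

lemma compatible: "tensor_compatible R C D C' D' n n 0 0 f (\<lambda>p. g (n - p))"
  by (auto simp: tensor_compatible_def chain_map_hom[OF f] chain_map_act[OF f] is_chain_mapD(1)[OF g])

lemma tensor_hom_chains: "c \<in> tch n d \<Longrightarrow> tensor_hom f g n d c \<in> T.tch n d"
  unfolding tensor_hom_def by (rule tensor_map_chains[OF compatible]) auto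

lemma tensor_hom_rels: "c \<in> rels n d \<Longrightarrow> tensor_hom f g n d c \<in> T.rels n d"
  unfolding tensor_hom_def by (rule tensor_map_rels[OF compatible]) auto

lemma tensor_hom_commute:
  assumes c: "c \<in> tch n d"
  shows "tensor_hom f g (n + 1) d (tensor_diff C D n d c) = tensor_diff C' D' n d (tensor_hom f g n d c)"
proof -
  have "tensor_hom f g (n + 1) d (tensor_diff C D n d c) - tensor_diff C' D' n d (tensor_hom f g n d c) \<in> {0}"
    using c
  proof (rule frag_agree)
    fix p a x y assume x: "x \<in> carrier (cpart C p a)" and y: "y \<in> carrier (cpart D (n - p) (d - a))"
    have e: "n + 1 - (p + 1) = n - p" "n + 1 - p = n - p + 1" by simp_all
    show "tensor_hom f g (n + 1) d (tensor_diff C D n d (frag_of (p, a, x, y))) -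
        tensor_diff C' D' n d (tensor_hom f g n d (frag_of (p, a, x, y))) \<in> {0}"
      unfolding tensor_diff_frag_of tensor_hom_add tensor_hom_cmul tensor_hom_frag_of e
        is_chain_mapD(2)[OF f x] is_chain_mapD(2)[OF g y] by simp
  qed (auto simp: tensor_hom_diff tensor_diff_diff)
  then show ?thesis by simp
qed

lemma tensor_hom_act:
  assumes r: "r \<in> homog R b" and c: "c \<in> tch n d"
  shows "tensor_hom f g n (b + d) (tensor_act C b r c) = tensor_act C' b r (tensor_hom f g n d c)"
proof -
  have "tensor_hom f g n (b + d) (tensor_act C b r c) - tensor_act C' b r (tensor_hom f g n d c) \<in> {0}"
    using c
    by (rule frag_agree)
       (auto simp: tensor_hom_frag_of tensor_act_frag_of chain_map_act[OF f r] tensor_hom_diff tensor_act_diff)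
  then show ?thesis by simp
qed

definition class_map where
  "class_map n d = coset_map (T.tfree n d) (T.rels n d) (tensor_hom f g n d)"

lemma class_map_tclass: "c \<in> tch n d \<Longrightarrow> class_map n d (tclass n d c) = T.tclass n d (tensor_hom f g n d c)"
  unfolding class_map_def tclass_def T.tclass_def
  by (rule coset_map_rcos[OF tfree_group T.tfree_group rels_subgroup T.rels_subgroup homI_frag])
     (auto simp: tensor_hom_chains tensor_hom_diff tensor_hom_rels carrier_free_tensor simp del: carrier_free_Abelian_group_iff)

lemma class_map_chain_map: "is_chain_map R TC T.TC class_map"
proof -
  have "class_map n d \<in> hom (cpart TC n d) (cpart T.TC n d)" for n d
  proof (rule homI)
    show "class_map n d K \<in> carrier (cpart T.TC n d)" if "K \<in> carrier (cpart TC n d)" for K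
      using that by (auto simp: carrier_tensor T.carrier_tensor class_map_tclass tensor_hom_chains)
    show "class_map n d (K \<otimes>\<^bsub>cpart TC n d\<^esub> L) = class_map n d K \<otimes>\<^bsub>cpart T.TC n d\<^esub> class_map n d L"
      if "K \<in> carrier (cpart TC n d)" "L \<in> carrier (cpart TC n d)" for K L
      using that by (auto simp: carrier_tensor mult_tensor T.mult_tensor class_map_tclass tensor_hom_chains tchains_add tensor_hom_add)
  qed
  moreover have "class_map n (b + d) (cact TC n b d r K) = cact T.TC n b d r (class_map n d K)"
    if "r \<in> homog R b" "K \<in> carrier (cpart TC n d)" for n b d r K
    using that by (auto simp: carrier_tensor act_tensor T.act_tensor class_map_tclass tensor_hom_chains tensor_hom_act tensor_act_chains)
  moreover have "class_map (n + 1) d (diff TC n d K) = diff T.TC n d (class_map n d K)"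
    if "K \<in> carrier (cpart TC n d)" for n d K
    using that by (auto simp: carrier_tensor diff_tensor T.diff_tensor class_map_tclass tensor_hom_chains tensor_hom_commute tensor_diff_chains)
  ultimately show ?thesis by (auto simp: is_chain_map_def is_graded_hom_def)
qed

lemma class_map_qisoI:
  assumes inj: "\<And>n d c b. c \<in> tch n d \<Longrightarrow> tensor_diff C D n d c \<in> rels (n + 1) d \<Longrightarrow> b \<in> T.tch (n - 1) d \<Longrightarrow>
      tensor_hom f g n d c - tensor_diff C' D' (n - 1) d b \<in> T.rels n d \<Longrightarrow>
      \<exists>b'\<in>tch (n - 1) d. c - tensor_diff C D (n - 1) d b' \<in> rels n d"
    and surj: "\<And>n d z. z \<in> T.tch n d \<Longrightarrow> tensor_diff C' D' n d z \<in> T.rels (n + 1) d \<Longrightarrow>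
      \<exists>c\<in>tch n d. \<exists>b\<in>T.tch (n - 1) d. tensor_diff C D n d c \<in> rels (n + 1) d \<and>
        z - tensor_hom f g n d c - tensor_diff C' D' (n - 1) d b \<in> T.rels n d"
  shows "qiso R TC T.TC class_map"
  unfolding qiso_def
proof (intro conjI allI ballI impI class_map_chain_map)
  fix n d K assume K: "K \<in> cocycles TC n d" and fK: "class_map n d K \<in> coboundaries T.TC n d"
  obtain c where c: "c \<in> tch n d" "K = tclass n d c" using K by (auto simp: mem_cocycles_iff carrier_tensor)
  show "K \<in> coboundaries TC n d"
    using inj[OF c(1)] K fK by (auto simp: c class_map_tclass tclass_cocycle_iff tclass_coboundary_iff T.tclass_coboundary_iff tensor_hom_chains)
next
  fix n d K assume K: "K \<in> cocycles T.TC n d"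
  obtain z where z: "z \<in> T.tch n d" "K = T.tclass n d z" using K by (auto simp: mem_cocycles_iff T.carrier_tensor)
  have "tensor_diff C' D' n d z \<in> T.rels (n + 1) d" using K z by (simp add: T.tclass_cocycle_iff)
  from surj[OF z(1) this] obtain c b where c: "c \<in> tch n d" "tensor_diff C D n d c \<in> rels (n + 1) d"
    and b: "b \<in> T.tch (n - 1) d" "z - tensor_hom f g n d c - tensor_diff C' D' (n - 1) d b \<in> T.rels n d" by blast
  have "K \<otimes>\<^bsub>cpart T.TC n d\<^esub> inv\<^bsub>cpart T.TC n d\<^esub> class_map n d (tclass n d c) = T.tclass n d (z - tensor_hom f g n d c)"
    using z c by (simp add: class_map_tclass T.inv_tensor T.mult_tensor tensor_hom_chains tchains_uminus)
  then show "\<exists>x\<in>cocycles TC n d. K \<otimes>\<^bsub>cpart T.TC n d\<^esub> inv\<^bsub>cpart T.TC n d\<^esub> class_map n d x \<in> coboundaries T.TC n d"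
    using c b z by (intro bexI[of _ "tclass n d c"])
      (auto simp: tclass_cocycle_iff T.tclass_coboundary_iff tchains_diff tensor_hom_chains)
qed

end


section \<open>Mapping cones\<close>

definition mapping_cone ::
    "('l, 'a) cochain_complex \<Rightarrow> ('l, 'b) cochain_complex \<Rightarrow> (int \<Rightarrow> int \<Rightarrow> 'a \<Rightarrow> 'b) \<Rightarrow> ('l, 'b \<times> 'a) cochain_complex" where
  "mapping_cone A B g =
     \<lparr>term_at = (\<lambda>p. \<lparr>part = (\<lambda>d. cpart B p d \<times>\<times> cpart A (p + 1) d),
        act = (\<lambda>a d r x. (cact B p a d r (fst x), cact A (p + 1) a d r (snd x)))\<rparr>),
      diff = (\<lambda>p d x. (diff B p d (fst x) \<otimes>\<^bsub>cpart B (p + 1) d\<^esub> g (p + 1) d (snd x),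
                       inv\<^bsub>cpart A (p + 1 + 1) d\<^esub> diff A (p + 1) d (snd x)))\<rparr>"

lemma cone_simps:
  "cpart (mapping_cone A B g) p d = cpart B p d \<times>\<times> cpart A (p + 1) d"
  "cact (mapping_cone A B g) p a d r x = (cact B p a d r (fst x), cact A (p + 1) a d r (snd x))"
  "diff (mapping_cone A B g) p d x = (diff B p d (fst x) \<otimes>\<^bsub>cpart B (p + 1) d\<^esub> g (p + 1) d (snd x),
                       inv\<^bsub>cpart A (p + 1 + 1) d\<^esub> diff A (p + 1) d (snd x))"
  by (simp_all add: mapping_cone_def)

locale chain_map_cone = graded_cring R for R :: "'l graded_ring" (structure) +
  fixes A :: "('l, 'a) cochain_complex" and B :: "('l, 'b) cochain_complex" and g
  assumes A: "is_complex R A" and B: "is_complex R B" and g: "is_chain_map R A B g"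
begin

lemma gA: "comm_group (cpart A p d)" by (rule complex_group[OF A])
lemma gB: "comm_group (cpart B p d)" by (rule complex_group[OF B])

sublocale Ag: comm_group "cpart A p d" for p d by (rule gA)
sublocale Bg: comm_group "cpart B p d" for p d by (rule gB)

lemmas A_module = complex_module[OF A] and B_module = complex_module[OF B]
lemmas g_closed = chain_map_closed[OF g]
lemmas g_mult = hom_mult[OF chain_map_hom[OF g]]
lemmas g_inv = hom_imp_inv[OF gA gB chain_map_hom[OF g]]
lemmas g_unit = hom_imp_one[OF gA gB chain_map_hom[OF g]]

lemma cone_group: "comm_group (cpart (mapping_cone A B g) p d)"
  unfolding cone_simps
proof (rule group.group_comm_groupI[OF DirProd_group])
  show "x \<otimes>\<^bsub>cpart B p d \<times>\<times> cpart A (p + 1) d\<^esub> y = y \<otimes>\<^bsub>cpart B p d \<times>\<times> cpart A (p + 1) d\<^esub> x"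
    if "x \<in> carrier (cpart B p d \<times>\<times> cpart A (p + 1) d)" "y \<in> carrier (cpart B p d \<times>\<times> cpart A (p + 1) d)" for x y
    using that by (auto simp: Ag.m_comm Bg.m_comm)
qed (rule comm_group_imp_group gA gB)+

lemma diff_A_closed: "x \<in> carrier (cpart A (p + 1) d) \<Longrightarrow> diff A (p + 1) d x \<in> carrier (cpart A (2 + p) d)"
  using diff_closed[OF A, of x "p + 1" d] by (simp add: add.commute)

lemma cone_complex: "is_complex R (mapping_cone A B g)"
proof -
  have module: "is_graded_module R (term_at (mapping_cone A B g) p)" for p
    unfolding is_graded_module_def
  proof (intro conjI allI ballI cone_group)
    show "cact (mapping_cone A B g) p a d r \<in> hom (cpart (mapping_cone A B g) p d) (cpart (mapping_cone A B g) p (a + d))"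
      if "r \<in> homog R a" for a d r
      by (rule homI) (auto simp: cone_simps act_closed[OF A_module that] act_closed[OF B_module that]
          act_mult[OF A_module that] act_mult[OF B_module that])
  qed (auto simp: cone_simps act_add_scalar[OF A_module] act_add_scalar[OF B_module]
      act_act[OF A_module] act_act[OF B_module] act_one[OF A_module] act_one[OF B_module])
  have hom: "diff (mapping_cone A B g) p d \<in> hom (cpart (mapping_cone A B g) p d) (cpart (mapping_cone A B g) (p + 1) d)" for p d
    by (rule homI)
       (auto simp: cone_simps diff_mult[OF A] diff_mult[OF B] g_mult Bg.m_ac Ag.inv_mult
          diff_A_closed diff_closed[OF B] g_closed)
  have act: "diff (mapping_cone A B g) p (a + d) (cact (mapping_cone A B g) p a d r x) = cact (mapping_cone A B g) (p + 1) a d r (diff (mapping_cone A B g) p d x)"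
    if r: "r \<in> homog R a" and x: "x \<in> carrier (cpart (mapping_cone A B g) p d)" for p a d r x
    using x by (auto simp: cone_simps diff_act[OF A r] diff_act[OF B r] chain_map_act[OF g r] act_mult[OF B_module r]
        act_inv[OF A_module r] diff_A_closed diff_closed[OF B] g_closed)
  have dd: "diff (mapping_cone A B g) (p + 1) d (diff (mapping_cone A B g) p d x) = \<one>\<^bsub>cpart (mapping_cone A B g) (p + 2) d\<^esub>"
    if x: "x \<in> carrier (cpart (mapping_cone A B g) p d)" for p d x
  proof -
    obtain b \<alpha> where xe: "x = (b, \<alpha>)" "b \<in> carrier (cpart B p d)" "\<alpha> \<in> carrier (cpart A (p + 1) d)"
      using x by (auto simp: cone_simps)
    have e: "p + 2 = p + 1 + 1" by simp
    have ddb: "diff B (p + 1) d (diff B p d b) = \<one>\<^bsub>cpart B (p + 1 + 1) d\<^esub>"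
      using diff_diff[OF B xe(2)] unfolding e .
    have dda: "diff A (p + 1 + 1) d (diff A (p + 1) d \<alpha>) = \<one>\<^bsub>cpart A (p + 1 + 1 + 1) d\<^esub>"
      using diff_diff[OF A xe(3)] by (simp add: add.assoc)
    have gd: "g (p + 1 + 1) d (diff A (p + 1) d \<alpha>) = diff B (p + 1) d (g (p + 1) d \<alpha>)"
      by (rule is_chain_mapD(2)[OF g xe(3)])
    note cl = diff_closed[OF A xe(3)] diff_closed[OF B xe(2)] g_closed[OF xe(3)] diff_closed[OF B g_closed[OF xe(3)]]
    show ?thesis
      unfolding e cone_simps xe(1) fst_conv snd_conv one_DirProd
        diff_mult[OF B cl(2,3)] ddb g_inv[OF cl(1)] gd diff_inv[OF A cl(1)] dda
      using cl by simp
  qed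
  show ?thesis
    unfolding is_complex_def is_graded_hom_def using module hom act dd by blast
qed

text \<open>
  A cocycle \<open>(b, \<alpha>)\<close> of the cone exhibits \<open>g \<alpha>\<close> as a coboundary. As \<open>g\<close> is injective on cohomology,
  \<open>\<alpha>\<close> is the differential of some \<open>a0\<close>, and then \<open>b + g a0\<close> is a cocycle. By surjectivity on
  cohomology it is, up to a coboundary \<open>d b0\<close>, the image of a cocycle \<open>z\<close>. The pair
  \<open>(b0, z - a0)\<close> bounds \<open>(b, \<alpha>)\<close>.
\<close>
lemma cone_acyclic:
  assumes q: "qiso R A B g"
  shows "acyclic_complex (mapping_cone A B g)"
  unfolding acyclic_complex_iff[OF cone_complex]
proof (intro allI subsetI)
  fix p d x assume x: "x \<in> cocycles (mapping_cone A B g) p d"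
  obtain b \<alpha> where xe: "x = (b, \<alpha>)" and b: "b \<in> carrier (cpart B p d)" and \<alpha>: "\<alpha> \<in> carrier (cpart A (p + 1) d)"
    using x by (auto simp: mem_cocycles_iff cone_simps)
  note cl = diff_closed[OF A \<alpha>] diff_closed[OF B b] g_closed[OF \<alpha>]
  have 1: "diff B p d b \<otimes>\<^bsub>cpart B (p + 1) d\<^esub> g (p + 1) d \<alpha> = \<one>\<^bsub>cpart B (p + 1) d\<^esub>"
    and 2: "inv\<^bsub>cpart A (p + 1 + 1) d\<^esub> diff A (p + 1) d \<alpha> = \<one>\<^bsub>cpart A (p + 1 + 1) d\<^esub>"
    using x by (auto simp: mem_cocycles_iff cone_simps xe)
  have "diff A (p + 1) d \<alpha> = \<one>\<^bsub>cpart A (p + 1 + 1) d\<^esub>"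
    using 2 cl(1) Ag.inv_eq_1_iff by blast
  then have \<alpha>Z: "\<alpha> \<in> cocycles A (p + 1) d" using \<alpha> by (simp add: mem_cocycles_iff)
  have "g (p + 1) d \<alpha> = diff B p d (inv\<^bsub>cpart B p d\<^esub> b)"
    using 1 cl unfolding diff_inv[OF B b] by (metis Bg.inv_equality Bg.m_comm)
  then have "g (p + 1) d \<alpha> \<in> coboundaries B (p + 1) d"
    using coboundaries_diff[OF B Bg.inv_closed[OF b]] by simp
  then have "\<alpha> \<in> coboundaries A (p + 1) d" by (rule qiso_reflects_coboundaries[OF q \<alpha>Z])
  then obtain a0 where a0: "a0 \<in> carrier (cpart A p d)" and \<alpha>a: "\<alpha> = diff A p d a0"
    by (auto simp: coboundaries_def)
  define y where "y = b \<otimes>\<^bsub>cpart B p d\<^esub> g p d a0"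
  note ga0 = g_closed[OF a0]
  have yc: "y \<in> carrier (cpart B p d)" using b ga0 by (simp add: y_def)
  have "diff B p d y = \<one>\<^bsub>cpart B (p + 1) d\<^esub>"
    unfolding y_def diff_mult[OF B b ga0] is_chain_mapD(2)[OF g a0, symmetric] \<alpha>a[symmetric] by (rule 1)
  then have "y \<in> cocycles B p d" using yc by (simp add: mem_cocycles_iff)
  then obtain z where z: "z \<in> cocycles A p d"
    and yz: "y \<otimes>\<^bsub>cpart B p d\<^esub> inv\<^bsub>cpart B p d\<^esub> g p d z \<in> coboundaries B p d"
    by (rule qiso_surj[OF q])
  then obtain b0 where b0: "b0 \<in> carrier (cpart B (p - 1) d)"
    and b0e: "y \<otimes>\<^bsub>cpart B p d\<^esub> inv\<^bsub>cpart B p d\<^esub> g p d z = diff B (p - 1) d b0"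
    by (auto simp: coboundaries_def)
  have zc: "z \<in> carrier (cpart A p d)" and dz: "diff A p d z = \<one>\<^bsub>cpart A (p + 1) d\<^esub>"
    using z by (auto simp: mem_cocycles_iff)
  define w where "w = z \<otimes>\<^bsub>cpart A p d\<^esub> inv\<^bsub>cpart A p d\<^esub> a0"
  have wc: "w \<in> carrier (cpart A p d)" using zc a0 by (simp add: w_def)
  have "diff A p d w = inv\<^bsub>cpart A (p + 1) d\<^esub> \<alpha>"
    using zc a0 dz diff_closed[OF A a0] by (simp add: w_def diff_mult[OF A] diff_inv[OF A] \<alpha>a)
  then have dw: "inv\<^bsub>cpart A (p + 1) d\<^esub> diff A p d w = \<alpha>" using \<alpha> by simp
  have gz: "g p d z \<in> carrier (cpart B p d)" using g_closed[OF zc] .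
  have gw: "g p d w = g p d z \<otimes>\<^bsub>cpart B p d\<^esub> inv\<^bsub>cpart B p d\<^esub> g p d a0"
    using zc a0 by (simp add: w_def g_mult g_inv)
  have "diff B (p - 1) d b0 \<otimes>\<^bsub>cpart B p d\<^esub> g p d w = b"
  proof -
    have "y \<otimes>\<^bsub>cpart B p d\<^esub> inv\<^bsub>cpart B p d\<^esub> g p d z \<otimes>\<^bsub>cpart B p d\<^esub>
        (g p d z \<otimes>\<^bsub>cpart B p d\<^esub> inv\<^bsub>cpart B p d\<^esub> g p d a0)
       = y \<otimes>\<^bsub>cpart B p d\<^esub> (inv\<^bsub>cpart B p d\<^esub> g p d z \<otimes>\<^bsub>cpart B p d\<^esub> g p d z) \<otimes>\<^bsub>cpart B p d\<^esub> inv\<^bsub>cpart B p d\<^esub> g p d a0"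
      using yc gz ga0 by (simp only: Bg.m_assoc Bg.m_closed Bg.inv_closed)
    also have "\<dots> = b"
      using yc gz ga0 b by (simp add: Bg.m_assoc y_def)
    finally show ?thesis unfolding b0e[symmetric] gw .
  qed
  then have "diff (mapping_cone A B g) (p - 1) d (b0, w) = x"
    using dw by (simp add: cone_simps xe)
  moreover have "(b0, w) \<in> carrier (cpart (mapping_cone A B g) (p - 1) d)"
    using b0 wc by (simp add: cone_simps)
  ultimately show "x \<in> coboundaries (mapping_cone A B g) p d" by (auto simp: coboundaries_def)
qed

end


section \<open>Tensoring a quasi-isomorphism with a complex that kills its cone\<close>

text \<open>
  Degree by degree, the cone is the product of \<open>B\<close> and \<open>A\<close>, so \<open>P \<otimes> cone\<close> splits in the same way.
  Describing its differential through the injections and projections of this splitting allows the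
  long exact sequence of \<open>P \<otimes> A \<rightarrow> P \<otimes> B \<rightarrow> P \<otimes> cone\<close> to be replaced by explicit chains.
\<close>
locale cone_tensor = chain_map_cone R A B g
  for R :: "'l graded_ring" (structure) and A :: "('l, 'a) cochain_complex" and B :: "('l, 'b) cochain_complex" and g +
  fixes P :: "('l, 'p) cochain_complex"
  assumes P: "is_complex R P"
begin

sublocale PA: complex_pair R P A by unfold_locales (rule P A)+
sublocale PB: complex_pair R P B by unfold_locales (rule P B)+
sublocale PC: complex_pair R P "mapping_cone A B g" by unfold_locales (rule P cone_complex)+
sublocale BC: two_complex_pairs R P B P "mapping_cone A B g" ..
sublocale CB: two_complex_pairs R P "mapping_cone A B g" P B ..
sublocale CA: two_complex_pairs R P "mapping_cone A B g" P A ..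
sublocale AC: two_complex_pairs R P A P "mapping_cone A B g" ..

lemma id_chain_map: "is_chain_map R P P (\<lambda>p d x. x)"
  by (rule qiso_chain_map[OF qiso_id[OF P]])

sublocale G: tensor_of_chain_maps R P A P B "\<lambda>p d x. x" g
  by unfold_locales (rule id_chain_map g)+

abbreviation "ksign p \<equiv> if even (p :: int) then 1 else - 1 :: int"

text \<open>
  The sign \<open>ksign\<close> on the component in \<open>P \<otimes> A\<close> cancels the sign with which the differential of
  \<open>P \<otimes> cone\<close> moves \<open>g\<close> past \<open>P\<close>; thus \<open>prB_diff\<close> and \<open>prA_diff\<close> have the shape of the two components
  of the differential of a cone.
\<close>
definition "inB n d = tensor_map (\<lambda>_. 1) 0 0 (\<lambda>p a x. x) (\<lambda>p e b. (b, \<one>\<^bsub>cpart A (n - p + 1) e\<^esub>)) d"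
definition "prB n d = tensor_map (\<lambda>_. 1) 0 0 (\<lambda>p a x. x) (\<lambda>p e. fst) d"
definition "prA n d = tensor_map ksign 0 0 (\<lambda>p a x. x) (\<lambda>p e. snd) d"
definition "inA n d = tensor_map ksign 0 0 (\<lambda>p a x. x) (\<lambda>p e \<alpha>. (\<one>\<^bsub>cpart B (n - p) e\<^esub>, \<alpha>)) d"

lemma cone_parts_frag_of:
  "inB n d (frag_of (p, a, x, b)) = frag_of (p, a, x, (b, \<one>\<^bsub>cpart A (n - p + 1) (d - a)\<^esub>))"
  "prB n d (frag_of (p, a, x, c)) = frag_of (p, a, x, fst c)"
  "prA n d (frag_of (p, a, x, c)) = frag_cmul (ksign p) (frag_of (p, a, x, snd c))"
  "inA n d (frag_of (p, a, x, \<alpha>)) = frag_cmul (ksign p) (frag_of (p, a, x, (\<one>\<^bsub>cpart B (n - p) (d - a)\<^esub>, \<alpha>)))"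
  by (simp_all add: inB_def prB_def prA_def inA_def tensor_map_frag_of)

lemma cone_parts_additive:
  "inB n d (u - v) = inB n d u - inB n d v" "inB n d (u + v) = inB n d u + inB n d v" "inB n d (frag_cmul k u) = frag_cmul k (inB n d u)"
  "prB n d (u' - v') = prB n d u' - prB n d v'" "prB n d (u' + v') = prB n d u' + prB n d v'" "prB n d (frag_cmul k u') = frag_cmul k (prB n d u')"
  "prA n d (u' - v') = prA n d u' - prA n d v'" "prA n d (u' + v') = prA n d u' + prA n d v'" "prA n d (frag_cmul k u') = frag_cmul k (prA n d u')"
  "inA n d (w - z) = inA n d w - inA n d z" "inA n d (w + z) = inA n d w + inA n d z" "inA n d (frag_cmul k w) = frag_cmul k (inA n d w)"
  by (simp_all add: inB_def prB_def prA_def inA_def tensor_map_diff tensor_map_add tensor_map_cmul)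

lemma compat_inB: "tensor_compatible R P B P (mapping_cone A B g) n n 0 0 (\<lambda>p a x. x) (\<lambda>p e b. (b, \<one>\<^bsub>cpart A (n - p + 1) e\<^esub>))"
  by (auto simp: tensor_compatible_def is_graded_hom_def hom_def cone_simps act_unit[OF A_module])

lemma compat_prB: "tensor_compatible R P (mapping_cone A B g) P B n n 0 0 (\<lambda>p a x. x) (\<lambda>p e. fst)"
  by (auto simp: tensor_compatible_def is_graded_hom_def hom_def cone_simps)

lemma compat_prA: "tensor_compatible R P (mapping_cone A B g) P A n (n + 1) 0 0 (\<lambda>p a x. x) (\<lambda>p e. snd)"
proof -
  have e: "n + 1 - p = n - p + 1" for p by simp
  show ?thesis by (auto simp: tensor_compatible_def is_graded_hom_def hom_def cone_simps e)
qed

lemma compat_inA: "tensor_compatible R P A P (mapping_cone A B g) (n + 1) n 0 0 (\<lambda>p a x. x) (\<lambda>p e \<alpha>. (\<one>\<^bsub>cpart B (n - p) e\<^esub>, \<alpha>))"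
proof -
  have e: "n + 1 - p = n - p + 1" for p by simp
  show ?thesis by (auto simp: tensor_compatible_def is_graded_hom_def hom_def cone_simps act_unit[OF B_module] e)
qed

lemma cone_parts_chains:
  "z \<in> PB.tch n d \<Longrightarrow> inB n d z \<in> PC.tch n d"
  "w \<in> PC.tch n d \<Longrightarrow> prB n d w \<in> PB.tch n d"
  "w \<in> PC.tch n d \<Longrightarrow> prA n d w \<in> PA.tch (n + 1) d"
  "c \<in> PA.tch (n + 1) d \<Longrightarrow> inA n d c \<in> PC.tch n d"
  unfolding inB_def prB_def prA_def inA_def
  by (rule BC.tensor_map_chains[OF compat_inB] CB.tensor_map_chains[OF compat_prB]
      CA.tensor_map_chains[OF compat_prA] AC.tensor_map_chains[OF compat_inA]; simp)+

lemma cone_parts_rels: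
  "z \<in> PB.rels n d \<Longrightarrow> inB n d z \<in> PC.rels n d"
  "w \<in> PC.rels n d \<Longrightarrow> prB n d w \<in> PB.rels n d"
  "w \<in> PC.rels n d \<Longrightarrow> prA n d w \<in> PA.rels (n + 1) d"
  "c \<in> PA.rels (n + 1) d \<Longrightarrow> inA n d c \<in> PC.rels n d"
  unfolding inB_def prB_def prA_def inA_def
  by (rule BC.tensor_map_rels[OF compat_inB] CB.tensor_map_rels[OF compat_prB]
      CA.tensor_map_rels[OF compat_prA] AC.tensor_map_rels[OF compat_inA]; simp)+

abbreviation "dA \<equiv> tensor_diff P A"
abbreviation "dB \<equiv> tensor_diff P B"
abbreviation "dC \<equiv> tensor_diff P (mapping_cone A B g)"
abbreviation "gT \<equiv> tensor_hom (\<lambda>p d x. x) g"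

lemma inB_diff:
  assumes "z \<in> PB.tch n d" shows "inB (n + 1) d (dB n d z) = dC n d (inB n d z)"
proof -
  have "inB (n + 1) d (dB n d z) - dC n d (inB n d z) \<in> {0}"
    using assms
  proof (rule frag_agree)
    fix p a x b assume x: "x \<in> carrier (cpart P p a)" and b: "b \<in> carrier (cpart B (n - p) (d - a))"
    have e: "n + 1 - (p + 1) + 1 = n - p + 1" "n + 1 - p + 1 = n - p + 1 + 1" by simp_all
    have "diff B (n - p) (d - a) b \<otimes>\<^bsub>cpart B (n - p + 1) (d - a)\<^esub> g (n - p + 1) (d - a) \<one>\<^bsub>cpart A (n - p + 1) (d - a)\<^esub>
        = diff B (n - p) (d - a) b"
      using diff_closed[OF B b] by (simp add: g_unit)
    then show "inB (n + 1) d (dB n d (frag_of (p, a, x, b))) - dC n d (inB n d (frag_of (p, a, x, b))) \<in> {0}"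
      unfolding tensor_diff_frag_of cone_parts_additive cone_parts_frag_of cone_simps fst_conv snd_conv diff_unit[OF A] e
      by simp
  qed (simp_all add: cone_parts_additive tensor_diff_diff)
  then show ?thesis by simp
qed

lemma prB_inB: "z \<in> PB.tch n d \<Longrightarrow> prB n d (inB n d z) = z"
proof -
  assume "z \<in> PB.tch n d"
  then have "prB n d (inB n d z) - z \<in> {0}"
    by (rule frag_agree) (simp_all add: cone_parts_additive cone_parts_frag_of)
  then show ?thesis by simp
qed

lemma prA_inA: "c \<in> PA.tch (n + 1) d \<Longrightarrow> prA n d (inA n d c) = c"
proof -
  assume "c \<in> PA.tch (n + 1) d"
  then have "prA n d (inA n d c) - c \<in> {0}"
    by (rule frag_agree) (simp_all add: cone_parts_additive cone_parts_frag_of)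
  then show ?thesis by simp
qed

lemma prA_inB:
  assumes "z \<in> PB.tch n d" shows "prA n d (inB n d z) \<in> PA.rels (n + 1) d"
proof -
  have "prA n d (inB n d z) - (\<lambda>_. 0) z \<in> PA.rels (n + 1) d"
    using assms PA.rels_zero PA.rels_diff
  proof (rule frag_agree)
    fix p a x b assume x: "x \<in> carrier (cpart P p a)"
    have e: "n - p + 1 = n + 1 - p" by simp
    show "prA n d (inB n d (frag_of (p, a, x, b))) - 0 \<in> PA.rels (n + 1) d"
      using PA.rels_cmul[OF PA.rels_unit_right[OF x, of "n + 1" d], of "ksign p"]
      by (simp only: cone_parts_frag_of e snd_conv diff_zero)
  qed (simp_all add: cone_parts_additive)
  then show ?thesis by simp
qed

lemma prB_inA:
  assumes "c \<in> PA.tch (n + 1) d" shows "prB n d (inA n d c) \<in> PB.rels n d"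
proof -
  have "prB n d (inA n d c) - (\<lambda>_. 0) c \<in> PB.rels n d"
    using assms PB.rels_zero PB.rels_diff
  proof (rule frag_agree)
    fix p a x b assume x: "x \<in> carrier (cpart P p a)"
    show "prB n d (inA n d (frag_of (p, a, x, b))) - 0 \<in> PB.rels n d"
      using PB.rels_cmul[OF PB.rels_unit_right[OF x, of n d], of "ksign p"]
      by (simp only: cone_parts_frag_of cone_parts_additive fst_conv diff_zero)
  qed (simp_all add: cone_parts_additive)
  then show ?thesis by simp
qed

lemma cone_parts_sum:
  assumes "w \<in> PC.tch n d" shows "w - (inB n d (prB n d w) + inA n d (prA n d w)) \<in> PC.rels n d"
  using assms PC.rels_zero PC.rels_diff
proof (rule frag_agree[where \<Phi> = "\<lambda>w. w"])
  fix p a x y assume x: "x \<in> carrier (cpart P p a)" and y: "y \<in> carrier (cpart (mapping_cone A B g) (n - p) (d - a))"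
  obtain b \<alpha> where ye: "y = (b, \<alpha>)" and b: "b \<in> carrier (cpart B (n - p) (d - a))" and \<alpha>: "\<alpha> \<in> carrier (cpart A (n - p + 1) (d - a))"
    using y by (auto simp: cone_simps)
  have "frag_of (p, a, x, (b, \<one>\<^bsub>cpart A (n - p + 1) (d - a)\<^esub>) \<otimes>\<^bsub>cpart (mapping_cone A B g) (n - p) (d - a)\<^esub> (\<one>\<^bsub>cpart B (n - p) (d - a)\<^esub>, \<alpha>))
      - frag_of (p, a, x, (b, \<one>\<^bsub>cpart A (n - p + 1) (d - a)\<^esub>)) - frag_of (p, a, x, (\<one>\<^bsub>cpart B (n - p) (d - a)\<^esub>, \<alpha>)) \<in> PC.rels n d"
    by (rule PC.rels_right) (use x b \<alpha> in \<open>auto simp: cone_simps\<close>)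
  then show "frag_of (p, a, x, y) - (inB n d (prB n d (frag_of (p, a, x, y))) + inA n d (prA n d (frag_of (p, a, x, y)))) \<in> PC.rels n d"
    using b \<alpha> by (simp add: cone_parts_frag_of cone_parts_additive ye cone_simps diff_diff_eq)
qed (simp_all add: cone_parts_additive)

lemma prB_diff:
  assumes "w \<in> PC.tch n d"
  shows "prB (n + 1) d (dC n d w) - (dB n d (prB n d w) + gT (n + 1) d (prA n d w)) \<in> PB.rels (n + 1) d"
  using assms PB.rels_zero PB.rels_diff
proof (rule frag_agree)
  fix p a x y assume x: "x \<in> carrier (cpart P p a)" and y: "y \<in> carrier (cpart (mapping_cone A B g) (n - p) (d - a))"
  obtain b \<alpha> where ye: "y = (b, \<alpha>)" and b: "b \<in> carrier (cpart B (n - p) (d - a))" and \<alpha>: "\<alpha> \<in> carrier (cpart A (n - p + 1) (d - a))"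
    using y by (auto simp: cone_simps)
  have e: "n + 1 - p = n - p + 1" by simp
  have "frag_of (p, a, x, diff B (n - p) (d - a) b \<otimes>\<^bsub>cpart B (n + 1 - p) (d - a)\<^esub> g (n - p + 1) (d - a) \<alpha>)
      - frag_of (p, a, x, diff B (n - p) (d - a) b) - frag_of (p, a, x, g (n - p + 1) (d - a) \<alpha>) \<in> PB.rels (n + 1) d"
    by (rule PB.rels_right; (unfold e)?) (rule x diff_closed[OF B b] g_closed[OF \<alpha>])+
  from PB.rels_cmul[OF this, of "ksign p"]
  show "prB (n + 1) d (dC n d (frag_of (p, a, x, y))) - (dB n d (prB n d (frag_of (p, a, x, y))) + gT (n + 1) d (prA n d (frag_of (p, a, x, y)))) \<in> PB.rels (n + 1) d"
    unfolding ye cone_parts_frag_of cone_parts_additive tensor_diff_frag_of cone_simps fst_conv snd_conv tensor_hom_cmul tensor_hom_frag_of e frag_cmul_diff_right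
    by (simp add: algebra_simps)
qed (simp_all add: cone_parts_additive tensor_diff_diff tensor_hom_diff)

lemma prA_diff:
  assumes "w \<in> PC.tch n d"
  shows "prA (n + 1) d (dC n d w) + dA (n + 1) d (prA n d w) \<in> PA.rels (n + 1 + 1) d"
proof -
  have "(prA (n + 1) d (dC n d w) + dA (n + 1) d (prA n d w)) - (\<lambda>_. 0) w \<in> PA.rels (n + 1 + 1) d"
    using assms PA.rels_zero PA.rels_diff
  proof (rule frag_agree)
    fix p a x y assume x: "x \<in> carrier (cpart P p a)" and y: "y \<in> carrier (cpart (mapping_cone A B g) (n - p) (d - a))"
    obtain b \<alpha> where ye: "y = (b, \<alpha>)" and b: "b \<in> carrier (cpart B (n - p) (d - a))" and \<alpha>: "\<alpha> \<in> carrier (cpart A (n - p + 1) (d - a))"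
      using y by (auto simp: cone_simps)
    have e: "n + 1 - p = n - p + 1" "n + 1 + 1 - p = n - p + 1 + 1" by simp_all
    have "frag_of (p, a, x, inv\<^bsub>cpart A (n + 1 + 1 - p) (d - a)\<^esub> diff A (n - p + 1) (d - a) \<alpha>)
       + frag_of (p, a, x, diff A (n - p + 1) (d - a) \<alpha>) \<in> PA.rels (n + 1 + 1) d"
      by (rule PA.rels_inv_right; (unfold e)?) (rule x diff_closed[OF A \<alpha>])+
    then show "(prA (n + 1) d (dC n d (frag_of (p, a, x, y))) + dA (n + 1) d (prA n d (frag_of (p, a, x, y)))) - 0 \<in> PA.rels (n + 1 + 1) d"
      unfolding ye cone_parts_frag_of cone_parts_additive tensor_diff_frag_of tensor_diff_cmul cone_simps fst_conv snd_conv e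
      by (cases "even p") (simp_all add: algebra_simps frag_cmul_distrib2)
  qed (simp_all add: cone_parts_additive tensor_diff_diff)
  then show ?thesis by simp
qed

text \<open>
  This is the part of the long exact sequence that shows \<open>P \<otimes> g\<close> to be bijective on cohomology when
  \<open>P \<otimes> cone\<close> has none.
\<close>
lemma acyclic_cone_imp_qiso:
  assumes ac: "acyclic_complex PC.TC"
  shows "qiso R PA.TC PB.TC G.class_map"
proof (rule G.class_map_qisoI)
  fix n d c b
  assume c: "c \<in> PA.tch n d" and dc: "dA n d c \<in> PA.rels (n + 1) d" and b: "b \<in> PB.tch (n - 1) d"
    and gc: "gT n d c - dB (n - 1) d b \<in> PB.rels n d"
  define m where "m = n - 1"
  have n: "n = m + 1" by (simp add: m_def)
  note c = c[unfolded n] and dc = dc[unfolded n] and b = b[folded m_def] and gc = gc[folded m_def, unfolded n]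
  \<comment> \<open>As \<open>g c = d b\<close>, the pair \<open>(- b, c)\<close> is a cocycle of \<open>P \<otimes> cone\<close>. The component in \<open>P \<otimes> A\<close> of a chain
    that bounds it bounds \<open>c\<close>, up to sign.\<close>
  define w where "w = inA m d c - inB m d b"
  have w: "w \<in> PC.tch m d" unfolding w_def using cone_parts_chains(1)[OF b] cone_parts_chains(4)[OF c] by (rule tchains_diff[rotated])
  have pB: "prB m d w + b \<in> PB.rels m d"
    using prB_inA[OF c] prB_inB[OF b] by (simp add: w_def cone_parts_additive)
  have pA: "prA m d w - c \<in> PA.rels (m + 1) d"
    using PA.rels_uminus[OF prA_inB[OF b]] prA_inA[OF c] by (simp add: w_def cone_parts_additive)
  have "prB (m + 1) d (dC m d w) \<in> PB.rels (m + 1) d"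
  proof -
    have 1: "dB m d (prB m d w) + dB m d b \<in> PB.rels (m + 1) d"
      using PB.tensor_diff_rels[OF pB] by (simp add: tensor_diff_add)
    have 2: "gT (m + 1) d (prA m d w) - gT (m + 1) d c \<in> PB.rels (m + 1) d"
      using G.tensor_hom_rels[OF pA] by (simp add: tensor_hom_diff)
    have "prB (m + 1) d (dC m d w) = (prB (m + 1) d (dC m d w) - (dB m d (prB m d w) + gT (m + 1) d (prA m d w)))
       + (dB m d (prB m d w) + dB m d b) + (gT (m + 1) d (prA m d w) - gT (m + 1) d c) + (gT (m + 1) d c - dB m d b)"
      by simp
    also have "\<dots> \<in> PB.rels (m + 1) d"
      by (intro PB.rels_add prB_diff w 1 2 gc)
    finally show ?thesis .
  qed
  note rB = this
  have "prA (m + 1) d (dC m d w) \<in> PA.rels (m + 1 + 1) d"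
  proof -
    have 1: "dA (m + 1) d (prA m d w) - dA (m + 1) d c \<in> PA.rels (m + 1 + 1) d"
      using PA.tensor_diff_rels[OF pA] by (simp add: tensor_diff_diff)
    have "prA (m + 1) d (dC m d w) = (prA (m + 1) d (dC m d w) + dA (m + 1) d (prA m d w))
       - (dA (m + 1) d (prA m d w) - dA (m + 1) d c) - dA (m + 1) d c"
      by simp
    also have "\<dots> \<in> PA.rels (m + 1 + 1) d"
      by (intro PA.rels_diff prA_diff w 1 dc)
    finally show ?thesis .
  qed
  note rA = this
  have "dC m d w = (dC m d w - (inB (m + 1) d (prB (m + 1) d (dC m d w)) + inA (m + 1) d (prA (m + 1) d (dC m d w))))
     + (inB (m + 1) d (prB (m + 1) d (dC m d w)) + inA (m + 1) d (prA (m + 1) d (dC m d w)))" by simp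
  also have "\<dots> \<in> PC.rels (m + 1) d"
    by (intro PC.rels_add cone_parts_sum PC.tensor_diff_chains w cone_parts_rels rA rB)
  finally obtain v where v: "v \<in> PC.tch (m - 1) d" and wv: "w - dC (m - 1) d v \<in> PC.rels m d"
    using ac w unfolding PC.acyclic_tensor_iff by blast
  have v1: "prA (m - 1) d v \<in> PA.tch m d" using cone_parts_chains(3)[OF v] by simp
  have "prA m d (dC (m - 1) d v) + dA m d (prA (m - 1) d v) \<in> PA.rels (m + 1) d"
    using prA_diff[OF v] by simp
  from PA.rels_add[OF PA.rels_diff[OF cone_parts_rels(3)[OF wv] pA] this]
  have "c + dA m d (prA (m - 1) d v) \<in> PA.rels (m + 1) d"
    by (simp add: cone_parts_additive)
  then show "\<exists>b'\<in>PA.tch (n - 1) d. c - dA (n - 1) d b' \<in> PA.rels n d"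
    using v1 by (intro bexI[of _ "- prA (m - 1) d v"]) (simp_all add: n tensor_diff_uminus tchains_uminus)
next
  fix n d z
  assume z: "z \<in> PB.tch n d" and dz: "dB n d z \<in> PB.rels (n + 1) d"
  define m where "m = n - 1"
  have n: "n = m + 1" by (simp add: m_def)
  \<comment> \<open>A cocycle \<open>z\<close> of \<open>P \<otimes> B\<close> becomes a coboundary in \<open>P \<otimes> cone\<close>. Its bounding chain \<open>w\<close> consists of a
    preimage \<open>prA w\<close> of the class of \<open>z\<close> and of a chain \<open>prB w\<close> that bounds the difference.\<close>
  have "dC n d (inB n d z) \<in> PC.rels (n + 1) d"
    using cone_parts_rels(1)[OF dz] inB_diff[OF z] by simp
  then obtain w where w: "w \<in> PC.tch m d" and zw: "inB n d z - dC m d w \<in> PC.rels n d"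
    using ac cone_parts_chains(1)[OF z] unfolding PC.acyclic_tensor_iff m_def by blast
  have 1: "z - prB n d (dC m d w) \<in> PB.rels n d"
    using cone_parts_rels(2)[OF zw] prB_inB[OF z] by (simp add: cone_parts_additive)
  have "z - gT n d (prA m d w) - dB m d (prB m d w) =
      (z - prB n d (dC m d w)) + (prB n d (dC m d w) - (dB m d (prB m d w) + gT n d (prA m d w)))" by simp
  also have "\<dots> \<in> PB.rels n d"
    using PB.rels_add[OF 1 prB_diff[OF w, folded n]] .
  finally have 2: "z - gT n d (prA m d w) - dB m d (prB m d w) \<in> PB.rels n d" .
  have "dA n d (prA m d w) = (prA n d (dC m d w) + dA n d (prA m d w)) + prA n d (inB n d z - dC m d w) - prA n d (inB n d z)"
    by (simp add: cone_parts_additive)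
  also have "\<dots> \<in> PA.rels (n + 1) d"
    by (intro PA.rels_add PA.rels_diff prA_inB z cone_parts_rels zw prA_diff[OF w, folded n])
  finally have "dA n d (prA m d w) \<in> PA.rels (n + 1) d" .
  with 2 cone_parts_chains(2,3)[OF w]
  show "\<exists>c\<in>PA.tch n d. \<exists>b\<in>PB.tch (n - 1) d. dA n d c \<in> PA.rels (n + 1) d \<and> z - gT n d c - dB (n - 1) d b \<in> PB.rels n d"
    by (intro bexI[of _ "prA m d w"] bexI[of _ "prB m d w"]) (simp_all add: n)
qed

end


section \<open>Symmetry and invariance under isomorphism\<close>

context complex_pair
begin

text \<open>
  With the Koszul sign \<open>(-1) ^ (p * q)\<close>, where \<open>p\<close> and \<open>q\<close> are the cohomological degrees of the
  factors, the exchange of factors commutes with the differential.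
\<close>
definition swap :: "int \<Rightarrow> int \<Rightarrow> ('u, 'v) tensor_frag \<Rightarrow> ('v, 'u) tensor_frag" where
  "swap n d = frag_extend (\<lambda>(p, a, x, y).
     frag_cmul (if even (p * (n - p)) then 1 else - 1) (frag_of (n - p, d - a, y, x)))"

lemma swap_frag_of:
  "swap n d (frag_of (p, a, x, y)) = frag_cmul (if even (p * (n - p)) then 1 else - 1) (frag_of (n - p, d - a, y, x))"
  by (simp add: swap_def)

lemma swap_diff: "swap n d (u - v) = swap n d u - swap n d v"
  by (simp add: swap_def frag_extend_diff)

lemma swap_add: "swap n d (u + v) = swap n d u + swap n d v"
  by (simp add: swap_def frag_extend_add)

lemma swap_cmul: "swap n d (frag_cmul k u) = frag_cmul k (swap n d u)"
  by (simp add: swap_def frag_extend_cmul)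

lemma swap_zero: "swap n d 0 = 0"
  by (simp add: swap_def)

end

locale complex_pair_swap = complex_pair R C D + S: complex_pair R D C
  for R :: "'l graded_ring" (structure)
    and C :: "('l, 'u) cochain_complex" and D :: "('l, 'v) cochain_complex"
begin

lemma swap_chains:
  assumes "c \<in> tch n d" shows "swap n d c \<in> S.tch n d"
  using assms
proof (induction rule: tchains_induct)
  case (gen p a x y)
  then show ?case by (auto simp: swap_frag_of tchains_frag_of intro!: tchains_cmul tchains_uminus)
qed (simp_all add: swap_zero swap_diff tchains_zero tchains_diff)

lemma swap_rels:
  assumes "c \<in> rels n d" shows "swap n d c \<in> S.rels n d"
  using assms relators_subset
proof (induction rule: tensor_rels_induct)
  case zero
  then show ?case by (simp add: swap_zero S.rels_zero)
next
  case (diff c c')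
  then show ?case by (simp add: swap_diff S.rels_diff)
next
  case (relator c)
  let ?s = "\<lambda>p. if even (p * (n - p)) then 1 else - 1 :: int"
  from relator show ?case
  proof (cases rule: tensor_relators_cases)
    case (left p a x x' y)
    have "frag_of (n - p, d - a, y, x \<otimes>\<^bsub>cpart C (n - (n - p)) (d - (d - a))\<^esub> x') - frag_of (n - p, d - a, y, x)
       - frag_of (n - p, d - a, y, x') \<in> S.rels n d"
      by (rule S.rels_right) (simp_all add: left)
    from S.rels_cmul[OF this, of "?s p"] show ?thesis
      unfolding left(1) swap_diff swap_frag_of by (simp add: frag_cmul_diff_right)
  next
    case (right p a x y y')
    have "frag_of (n - p, d - a, y \<otimes>\<^bsub>cpart D (n - p) (d - a)\<^esub> y', x) - frag_of (n - p, d - a, y, x)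
       - frag_of (n - p, d - a, y', x) \<in> S.rels n d"
      by (rule S.rels_left) (simp_all add: right)
    from S.rels_cmul[OF this, of "?s p"] show ?thesis
      unfolding right(1) swap_diff swap_frag_of by (simp add: frag_cmul_diff_right)
  next
    case (act p a b r x y)
    have e: "d - (b + a) = d - a - b" by simp
    have "frag_of (n - p, d - a, cact D (n - p) b (d - a - b) r y, x)
       - frag_of (n - p, d - a - b, y, cact C (n - (n - p)) b a r x) \<in> S.rels n d"
      by (rule S.rels_act) (simp_all add: act)
    from S.rels_cmul[OF S.rels_uminus[OF this], of "?s p"] show ?thesis
      unfolding act(1) swap_diff swap_frag_of e by (simp add: frag_cmul_diff_right)
  qed
qed

lemma swap_swap:
  assumes "c \<in> tch n d" shows "S.swap n d (swap n d c) = c"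
proof -
  have "S.swap n d (swap n d c) - c \<in> {0}"
    using assms
    by (rule frag_agree[where \<Psi> = "\<lambda>c. c"])
       (auto simp: swap_diff S.swap_diff swap_frag_of S.swap_frag_of S.swap_cmul mult.commute)
  then show ?thesis by simp
qed

lemma swap_tensor_diff:
  assumes "c \<in> tch n d" shows "swap (n + 1) d (tensor_diff C D n d c) = tensor_diff D C n d (swap n d c)"
proof -
  have "swap (n + 1) d (tensor_diff C D n d c) - tensor_diff D C n d (swap n d c) \<in> {0}"
    using assms
  proof (rule frag_agree)
    fix p a x y
    have e: "n + 1 - (p + 1) = n - p" "n + 1 - p = n - p + 1" "n - (n - p) = p" "d - (d - a) = a" by simp_all
    show "swap (n + 1) d (tensor_diff C D n d (frag_of (p, a, x, y))) - tensor_diff D C n d (swap n d (frag_of (p, a, x, y))) \<in> {0}"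
      unfolding swap_frag_of tensor_diff_frag_of swap_add swap_cmul tensor_diff_cmul e
      by (cases "even p"; cases "even n") (simp_all add: frag_cmul_distrib2)
  qed (auto simp: swap_diff tensor_diff_diff)
  then show ?thesis by simp
qed

lemma acyclic_swap:
  assumes ac: "acyclic_complex S.TC" shows "acyclic_complex TC"
  unfolding acyclic_tensor_iff
proof (intro allI ballI impI)
  interpret S': complex_pair_swap R D C ..
  fix n d c assume c: "c \<in> tch n d" and dc: "tensor_diff C D n d c \<in> rels (n + 1) d"
  have "tensor_diff D C n d (swap n d c) \<in> S.rels (n + 1) d"
    using swap_rels[OF dc] swap_tensor_diff[OF c] by simp
  then obtain b where b: "b \<in> S.tch (n - 1) d" and cb: "swap n d c - tensor_diff D C (n - 1) d b \<in> S.rels n d"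
    using ac swap_chains[OF c] unfolding S.acyclic_tensor_iff by blast
  have "c - tensor_diff C D (n - 1) d (S.swap (n - 1) d b) \<in> rels n d"
    using S'.swap_rels[OF cb] swap_swap[OF c] S'.swap_tensor_diff[OF b] by (simp add: S.swap_diff)
  then show "\<exists>b\<in>tch (n - 1) d. c - tensor_diff C D (n - 1) d b \<in> rels n d"
    using S'.swap_chains[OF b] by blast
qed

end

lemma (in graded_cring) acyclic_tensor_swap:
  assumes "is_complex R C" "is_complex R D" "acyclic_complex (tensor_complex R D C)"
  shows "acyclic_complex (tensor_complex R C D)"
proof -
  interpret complex_pair_swap R C D by unfold_locales (rule assms)+
  show ?thesis using acyclic_swap assms(3) .
qed

lemma (in graded_cring) tensor_qiso_of_inverse:
  assumes C: "is_complex R C" and D: "is_complex R D" and D': "is_complex R D'"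
    and g: "is_chain_map R D D' g" and h: "is_chain_map R D' D h"
    and hg: "\<And>p d x. x \<in> carrier (cpart D p d) \<Longrightarrow> h p d (g p d x) = x"
    and gh: "\<And>p d x. x \<in> carrier (cpart D' p d) \<Longrightarrow> g p d (h p d x) = x"
  obtains F where "qiso R (tensor_complex R C D) (tensor_complex R C D') F"
proof -
  have i: "is_chain_map R C C (\<lambda>p d x. x)" by (rule qiso_chain_map[OF qiso_id[OF C]])
  interpret tensor_of_chain_maps R C D C D' "\<lambda>p d x. x" g by unfold_locales (rule C D D' i g)+
  interpret H: tensor_of_chain_maps R C D' C D "\<lambda>p d x. x" h by unfold_locales (rule i h)+
  let ?G = "tensor_hom (\<lambda>p d x. x) g" and ?H = "tensor_hom (\<lambda>p d x. x) h"
  have HG: "?H n d (?G n d c) = c" if c: "c \<in> tch n d" for n d c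
  proof -
    have "?H n d (?G n d c) - c \<in> {0}"
      using c by (rule frag_agree) (auto simp: tensor_hom_diff tensor_hom_frag_of hg)
    then show ?thesis by simp
  qed
  have GH: "?G n d (?H n d c) = c" if c: "c \<in> T.tch n d" for n d c
  proof -
    have "?G n d (?H n d c) - c \<in> {0}"
      using c by (rule frag_agree) (auto simp: tensor_hom_diff tensor_hom_frag_of gh)
    then show ?thesis by simp
  qed
  have "qiso R TC T.TC class_map"
  proof (rule class_map_qisoI)
    fix n d c b
    assume c: "c \<in> tch n d" and b: "b \<in> T.tch (n - 1) d"
      and cb: "?G n d c - tensor_diff C D' (n - 1) d b \<in> T.rels n d"
    have "c - tensor_diff C D (n - 1) d (?H (n - 1) d b) \<in> rels n d"
      using H.tensor_hom_rels[OF cb] HG[OF c] H.tensor_hom_commute[OF b] by (simp add: tensor_hom_diff)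
    then show "\<exists>b'\<in>tch (n - 1) d. c - tensor_diff C D (n - 1) d b' \<in> rels n d"
      using H.tensor_hom_chains[OF b] by blast
  next
    fix n d z
    assume z: "z \<in> T.tch n d" and dz: "tensor_diff C D' n d z \<in> T.rels (n + 1) d"
    show "\<exists>c\<in>tch n d. \<exists>b\<in>T.tch (n - 1) d. tensor_diff C D n d c \<in> rels (n + 1) d \<and>
        z - ?G n d c - tensor_diff C D' (n - 1) d b \<in> T.rels n d"
      using H.tensor_hom_chains[OF z] H.tensor_hom_rels[OF dz] H.tensor_hom_commute[OF z] GH[OF z]
      by (intro bexI[of _ "?H n d z"] bexI[of _ 0]) (simp_all add: tensor_diff_zero tchains_zero T.rels_zero)
  qed
  then show thesis by (rule that)
qed


section \<open>K-flat complexes\<close>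

lemma infinite_pair_injection:
  assumes "infinite (UNIV :: 'u set)"
  obtains h :: "'u \<times> 'u \<Rightarrow> 'u" where "inj h"
proof -
  have "\<exists>h :: 'u \<times> 'u \<Rightarrow> 'u. bij h"
    using Times_same_infinite_bij_betw_types[OF assms] by blast
  then show thesis using that bij_is_inj by blast
qed

text \<open>
  By K-flatness, \<open>P \<otimes> cone\<close> is acyclic for the cone of \<open>g\<close>. The definition of \<open>K_flat\<close> only speaks of
  complexes on \<open>'u\<close>, and the cone lives on \<open>'u \<times> 'u\<close>; hence it is first replaced by a copy on \<open>'u\<close>.
\<close>
lemma (in graded_cring) K_flat_tensor_qiso:
  fixes P A B :: "('l, 'u) cochain_complex"
  assumes inf: "infinite (UNIV :: 'u set)" and Kf: "K_flat R P"
    and A: "is_complex R A" and B: "is_complex R B" and q: "qiso R A B g"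
  obtains F where "qiso R (tensor_complex R P A) (tensor_complex R P B) F"
proof -
  have Pc: "is_complex R P" using Kf by (simp add: K_flat_def)
  interpret cone_tensor R A B g P by unfold_locales (rule A B Pc qiso_chain_map[OF q])+
  obtain h :: "'u \<times> 'u \<Rightarrow> 'u" where h: "inj h" using infinite_pair_injection[OF inf] .
  obtain T :: "('l, 'u) cochain_complex" and f where T: "is_complex R T"
    and f: "is_chain_map R T (mapping_cone A B g) f" and iso: "\<And>p d. f p d \<in> iso (cpart T p d) (cpart (mapping_cone A B g) p d)"
    using complex_copy[OF cone_complex, of h] h by (metis inj_on_subset subset_UNIV)
  have "acyclic_complex T"
    using qiso_acyclic_iff[OF T cone_complex iso_imp_qiso[OF T cone_complex f iso]] cone_acyclic[OF q] by simp
  then have PT: "acyclic_complex (tensor_complex R P T)"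
    using Kf T by (simp add: K_flat_def)
  interpret PT: complex_pair R P T by unfold_locales (rule Pc T)+
  obtain k where "is_chain_map R (mapping_cone A B g) T k"
    "\<And>p d x. x \<in> carrier (cpart (mapping_cone A B g) p d) \<Longrightarrow> f p d (k p d x) = x"
    "\<And>p d x. x \<in> carrier (cpart T p d) \<Longrightarrow> k p d (f p d x) = x"
    using inverse_chain_map[OF T cone_complex f iso] by blast
  then obtain F where "qiso R (tensor_complex R P T) (tensor_complex R P (mapping_cone A B g)) F"
    using tensor_qiso_of_inverse[OF Pc T cone_complex f] by metis
  then have "acyclic_complex PC.TC"
    using qiso_acyclic_iff[OF PT.is_complex_tensor PC.is_complex_tensor] PT by blast
  from that[OF acyclic_cone_imp_qiso[OF this]] show thesis .
qed


section \<open>Flat systems\<close>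

lemma (in comm_group) mult_inv_inv:
  assumes x: "x \<in> carrier G" and y: "y \<in> carrier G"
  shows "x \<otimes> y \<otimes> inv x \<otimes> inv y = \<one>"
proof -
  have "x \<otimes> y \<otimes> inv x = y \<otimes> (x \<otimes> inv x)"
    unfolding m_comm[OF x y] by (rule m_assoc) (use x y in auto)
  then show ?thesis using x y by simp
qed

text \<open>
  The model is a colimit \<open>Y\<close>, over the stages \<open>m\<close>, of free modules with the finite basis \<open>I\<close>:
  \<open>gen i m\<close> is the image of the basis element \<open>i\<close> of stage \<open>m\<close>, and \<open>coef d y i m\<close> is the
  coordinate at \<open>i\<close> of some representative of \<open>y\<close> at stage \<open>m\<close>. Two representatives agree only
  from some stage on, which is why the laws hold only eventually. Coordinates that are eventually
  additive and linear make it possible to move a relation in \<open>P \<otimes> Y\<close> to the coordinates in \<open>P\<close>, and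
  this is the content of flatness.
\<close>
locale flat_system = graded_cring R for R :: "'l graded_ring" (structure) +
  fixes Y :: "('l, 'v) cochain_complex" and I :: "'i set" and D :: "'i \<Rightarrow> nat \<Rightarrow> int"
    and coef :: "int \<Rightarrow> 'v \<Rightarrow> 'i \<Rightarrow> nat \<Rightarrow> 'l" and gen :: "'i \<Rightarrow> nat \<Rightarrow> 'v"
  assumes Y: "is_complex R Y"
    and concentrated: "\<And>p d. p \<noteq> 0 \<Longrightarrow> carrier (cpart Y p d) = {\<one>\<^bsub>cpart Y p d\<^esub>}"
    and finite_I: "finite I"
    and gen_closed: "\<And>i m. i \<in> I \<Longrightarrow> gen i m \<in> carrier (cpart Y 0 (- D i m))"
    and coef_homog: "\<And>d y i m. y \<in> carrier (cpart Y 0 d) \<Longrightarrow> i \<in> I \<Longrightarrow> coef d y i m \<in> homog R (d + D i m)"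
    and coef_mult: "\<And>d y y' i. y \<in> carrier (cpart Y 0 d) \<Longrightarrow> y' \<in> carrier (cpart Y 0 d) \<Longrightarrow> i \<in> I \<Longrightarrow>
      \<forall>\<^sub>F m in sequentially. coef d (y \<otimes>\<^bsub>cpart Y 0 d\<^esub> y') i m = coef d y i m \<oplus> coef d y' i m"
    and coef_act: "\<And>b d r y i. r \<in> homog R b \<Longrightarrow> y \<in> carrier (cpart Y 0 d) \<Longrightarrow> i \<in> I \<Longrightarrow>
      \<forall>\<^sub>F m in sequentially. coef (b + d) (cact Y 0 b d r y) i m = r \<otimes> coef d y i m"
    and expansion: "\<And>d y. y \<in> carrier (cpart Y 0 d) \<Longrightarrow>
      \<forall>\<^sub>F m in sequentially. y = finprod (cpart Y 0 d) (\<lambda>i. cact Y 0 (d + D i m) (- D i m) (coef d y i m) (gen i m)) I"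
begin

text \<open>
  The coordinate at \<open>i\<close> of an element of \<open>P \<otimes> Y\<close> at stage \<open>m\<close>, with values in \<open>P\<close>: \<open>x \<otimes> y\<close> is sent to
  \<open>coef y i m * x\<close>. The symbols with \<open>p \<noteq> n\<close> have a trivial second factor, since \<open>Y\<close> is concentrated in
  degree 0.
\<close>
definition coord_frag where
  "coord_frag P n d i m = (\<lambda>(p, a, x, y).
     if p = n then cact P n (d - a + D i m) a (coef (d - a) y i m) x else \<one>\<^bsub>cpart P n (d + D i m)\<^esub>)"

text \<open>
  The additive extension of \<open>coord_frag\<close> to formal sums. It takes values in a group that is not
  written additively, so it is obtained from the universal property of the free abelian group.
\<close>
definition coord where
  "coord P n d i m = (SOME h. h \<in> hom (free_Abelian_group (tensor_gens P Y n d)) (cpart P n (d + D i m)) \<and>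
     (\<forall>s\<in>tensor_gens P Y n d. h (frag_of s) = coord_frag P n d i m s))"

text \<open>
  The element of \<open>P \<otimes> Y\<close> with coordinates \<open>q\<close> at stage \<open>m\<close>. Modulo relations, \<open>lift\<close> undoes \<open>coord\<close> at
  late stages (\<open>lift_coord\<close>).
\<close>
definition lift where
  "lift n d m q = (\<Sum>i\<in>I. frag_of (n :: int, d + D i m, q i, gen i m))"

context
  fixes P :: "('l, 'p) cochain_complex"
  assumes P: "is_complex R P"
begin

interpretation complex_pair R P Y by unfold_locales (rule P Y)+

lemma coord:
  assumes i: "i \<in> I"
  shows coord_hom: "coord P n d i m \<in> hom (tfree n d) (cpart P n (d + D i m))"
    and coord_frag_of: "x \<in> carrier (cpart P p a) \<Longrightarrow> y \<in> carrier (cpart Y (n - p) (d - a)) \<Longrightarrow>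
      coord P n d i m (frag_of (p, a, x, y)) =
        (if p = n then cact P n (d - a + D i m) a (coef (d - a) y i m) x else \<one>\<^bsub>cpart P n (d + D i m)\<^esub>)"
proof -
  have "coord_frag P n d i m ` tensor_gens P Y n d \<subseteq> carrier (cpart P n (d + D i m))"
  proof (clarsimp simp: mem_tensor_gens)
    fix p a x y assume x: "x \<in> carrier (cpart P p a)" and y: "y \<in> carrier (cpart Y (n - p) (d - a))"
    show "coord_frag P n d i m (p, a, x, y) \<in> carrier (cpart P n (d + D i m))"
    proof (cases "p = n")
      case True
      have "cact P n (d - a + D i m) a (coef (d - a) y i m) x \<in> carrier (cpart P n (d - a + D i m + a))"
        using x y True by (intro act_closed[OF C_module] coef_homog i) auto
      then show ?thesis using True by (simp add: coord_frag_def)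
    qed (simp add: coord_frag_def)
  qed
  then obtain h where "h \<in> hom (tfree n d) (cpart P n (d + D i m))"
    "\<And>s. s \<in> tensor_gens P Y n d \<Longrightarrow> h (frag_of s) = coord_frag P n d i m s"
    by (rule Cg.free_Abelian_group_universal) blast
  then have *: "coord P n d i m \<in> hom (tfree n d) (cpart P n (d + D i m)) \<and>
     (\<forall>s\<in>tensor_gens P Y n d. coord P n d i m (frag_of s) = coord_frag P n d i m s)"
    unfolding coord_def by (intro someI_ex[of "\<lambda>h. h \<in> _ \<and> _ h"]) blast
  then show "coord P n d i m \<in> hom (tfree n d) (cpart P n (d + D i m))" by blast
  show "coord P n d i m (frag_of (p, a, x, y)) =
        (if p = n then cact P n (d - a + D i m) a (coef (d - a) y i m) x else \<one>\<^bsub>cpart P n (d + D i m)\<^esub>)"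
    if "x \<in> carrier (cpart P p a)" "y \<in> carrier (cpart Y (n - p) (d - a))"
    using * that by (auto simp: mem_tensor_gens coord_frag_def)
qed

context
  fixes i assumes i: "i \<in> I"
begin

lemma coord_closed: "c \<in> tch n d \<Longrightarrow> coord P n d i m c \<in> carrier (cpart P n (d + D i m))"
  using hom_imp_closed[OF coord_hom[OF i], of c n d m] by (simp only: carrier_free_tensor)

lemma coord_add: "c \<in> tch n d \<Longrightarrow> c' \<in> tch n d \<Longrightarrow>
    coord P n d i m (c + c') = coord P n d i m c \<otimes>\<^bsub>cpart P n (d + D i m)\<^esub> coord P n d i m c'"
  using hom_mult[OF coord_hom[OF i], of c n d c' m] by (simp only: carrier_free_tensor mult_free_Abelian_group)

lemma coord_zero: "coord P n d i m 0 = \<one>\<^bsub>cpart P n (d + D i m)\<^esub>"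
  using hom_imp_one[OF tfree_group C_group coord_hom[OF i], of n d m] by simp

lemma coord_uminus: "c \<in> tch n d \<Longrightarrow> coord P n d i m (- c) = inv\<^bsub>cpart P n (d + D i m)\<^esub> coord P n d i m c"
  using hom_imp_inv[OF tfree_group C_group coord_hom[OF i], of c n d m] by (simp add: tchains_def)

lemma coord_diff: "c \<in> tch n d \<Longrightarrow> c' \<in> tch n d \<Longrightarrow>
    coord P n d i m (c - c') = coord P n d i m c \<otimes>\<^bsub>cpart P n (d + D i m)\<^esub> inv\<^bsub>cpart P n (d + D i m)\<^esub> coord P n d i m c'"
  using coord_add[OF _ tchains_uminus, of c n d c' m] by (simp add: coord_uminus)

text \<open>
  Each relator is eventually annihilated: bilinearity relators by additivity of \<open>P\<close> and of \<open>coef\<close>, the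
  relator that moves a scalar across by linearity of \<open>coef\<close>. The stage from which on this holds
  depends on the relator; a given relation involves only finitely many.
\<close>
lemma coord_rels:
  assumes "c \<in> rels n d"
  shows "\<forall>\<^sub>F m in sequentially. coord P n d i m c = \<one>\<^bsub>cpart P n (d + D i m)\<^esub>"
proof -
  have "c \<in> tch n d \<and> (\<forall>\<^sub>F m in sequentially. coord P n d i m c = \<one>\<^bsub>cpart P n (d + D i m)\<^esub>)"
    using assms relators_subset
  proof (induction rule: tensor_rels_induct)
    case zero
    show ?case by (simp add: coord_zero tchains_zero)
  next
    case (diff c c')
    then have c: "c \<in> tch n d" and c': "c' \<in> tch n d" by auto
    have "\<forall>\<^sub>F m in sequentially. coord P n d i m (c - c') = \<one>\<^bsub>cpart P n (d + D i m)\<^esub>"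
      using diff[THEN conjunct2] by eventually_elim (simp add: coord_diff[OF c c'])
    then show ?case using c c' by (simp add: tchains_diff)
  next
    case (relator c)
    then have c: "c \<in> tch n d" using relators_subset by blast
    from relator have "\<forall>\<^sub>F m in sequentially. coord P n d i m c = \<one>\<^bsub>cpart P n (d + D i m)\<^esub>"
    proof (cases rule: tensor_relators_cases)
      case (left p a x x' y)
      have t: "frag_of (p, a, x \<otimes>\<^bsub>cpart P p a\<^esub> x', y) \<in> tch n d" "frag_of (p, a, x, y) \<in> tch n d" "frag_of (p, a, x', y) \<in> tch n d"
        using left by (simp_all add: tchains_frag_of)
      have "coord P n d i m c = \<one>\<^bsub>cpart P n (d + D i m)\<^esub>" for m
      proof (cases "p = n")
        case True
        have \<kappa>: "coef (d - a) y i m \<in> homog R (d - a + D i m)"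
          using left(4) True by (intro coef_homog i) auto
        have e: "d - a + D i m + a = d + D i m" by simp
        have cl: "cact P n (d - a + D i m) a (coef (d - a) y i m) x \<in> carrier (cpart P n (d + D i m))"
          "cact P n (d - a + D i m) a (coef (d - a) y i m) x' \<in> carrier (cpart P n (d + D i m))"
          using act_closed[OF C_module \<kappa>, of _ n a] left(2,3) True unfolding e by auto
        have "cact P n (d - a + D i m) a (coef (d - a) y i m) (x \<otimes>\<^bsub>cpart P n a\<^esub> x') =
          cact P n (d - a + D i m) a (coef (d - a) y i m) x \<otimes>\<^bsub>cpart P n (d + D i m)\<^esub> cact P n (d - a + D i m) a (coef (d - a) y i m) x'"
          using act_mult[OF C_module \<kappa>, of x n a x'] left(2,3) True unfolding e by auto
        then show ?thesis
          using left(2-4) t cl True unfolding left(1)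
          by (simp add: coord_diff tchains_diff coord_frag_of[OF i] Cg.mult_inv_inv)
      next
        case False
        then show ?thesis
          using left(2-4) t unfolding left(1) by (simp add: coord_diff tchains_diff coord_frag_of[OF i])
      qed
      then show ?thesis by simp
    next
      case (right p a x y y')
      have t: "frag_of (p, a, x, y \<otimes>\<^bsub>cpart Y (n - p) (d - a)\<^esub> y') \<in> tch n d" "frag_of (p, a, x, y) \<in> tch n d" "frag_of (p, a, x, y') \<in> tch n d"
        using right by (simp_all add: tchains_frag_of)
      show ?thesis
      proof (cases "p = n")
        case True
        have yy: "y \<in> carrier (cpart Y 0 (d - a))" "y' \<in> carrier (cpart Y 0 (d - a))"
          and x: "x \<in> carrier (cpart P n a)" using right True by simp_all
        from coef_mult[OF yy i] show ?thesis
        proof eventually_elim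
          case (elim m)
          note \<kappa> = coef_homog[OF yy(1) i, of m] coef_homog[OF yy(2) i, of m]
          have e: "d - a + D i m + a = d + D i m" by simp
          have cl: "cact P n (d - a + D i m) a (coef (d - a) y i m) x \<in> carrier (cpart P n (d + D i m))"
            "cact P n (d - a + D i m) a (coef (d - a) y' i m) x \<in> carrier (cpart P n (d + D i m))"
            using act_closed[OF C_module \<kappa>(1) x] act_closed[OF C_module \<kappa>(2) x] unfolding e by auto
          have "cact P n (d - a + D i m) a (coef (d - a) (y \<otimes>\<^bsub>cpart Y 0 (d - a)\<^esub> y') i m) x =
            cact P n (d - a + D i m) a (coef (d - a) y i m) x \<otimes>\<^bsub>cpart P n (d + D i m)\<^esub> cact P n (d - a + D i m) a (coef (d - a) y' i m) x"
            unfolding elim act_add_scalar[OF C_module \<kappa> x] e ..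
          then show ?case
            using right(2-4) t cl True unfolding right(1)
            by (simp add: coord_diff tchains_diff coord_frag_of[OF i] Cg.mult_inv_inv)
        qed
      next
        case False
        then show ?thesis
          using right(2-4) t unfolding right(1) by (simp add: coord_diff tchains_diff coord_frag_of[OF i])
      qed
    next
      case (act p a b r x y)
      define e where "e = d - a - b"
      have e: "d - (b + a) = e" "d - a = b + e" "d - a - b = e" by (simp_all add: e_def)
      have y: "y \<in> carrier (cpart Y (n - p) e)" using act(4) by (simp add: e_def)
      have ry: "cact Y (n - p) b e r y \<in> carrier (cpart Y (n - p) (b + e))" by (rule act_closed[OF D_module act(2) y])
      have rx: "cact P p b a r x \<in> carrier (cpart P p (b + a))" by (rule act_closed[OF C_module act(2,3)])
      have t: "frag_of (p, b + a, cact P p b a r x, y) \<in> tch n d" "frag_of (p, a, x, cact Y (n - p) b e r y) \<in> tch n d"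
        using act(3) y rx ry by (simp_all only: tchains_frag_of e simp_thms)
      show ?thesis
      proof (cases "p = n")
        case True
        have y0: "y \<in> carrier (cpart Y 0 e)" and x: "x \<in> carrier (cpart P n a)" using y act(3) True by simp_all
        from coef_act[OF act(2) y0 i] show ?thesis
        proof eventually_elim
          case (elim m)
          note \<kappa> = coef_homog[OF y0 i, of m]
          have k: "coef e y i m \<otimes> r = r \<otimes> coef e y i m"
            using homog_carrier[OF \<kappa>] homog_carrier[OF act(2)] by (rule m_comm)
          have e3: "e + D i m + b = b + e + D i m" by simp
          have "cact P n (e + D i m) (b + a) (coef e y i m) (cact P n b a r x) = cact P n (b + e + D i m) a (r \<otimes> coef e y i m) x"
            unfolding act_act[OF C_module \<kappa> act(2) x] k e3 ..
          moreover have "coord P n d i m (frag_of (p, b + a, cact P p b a r x, y)) =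
              cact P n (e + D i m) (b + a) (coef e y i m) (cact P n b a r x)"
            using coord_frag_of[OF i rx, of y n d m] y True unfolding e(1) by simp
          moreover have "coord P n d i m (frag_of (p, a, x, cact Y (n - p) b e r y)) =
              cact P n (b + e + D i m) a (coef (b + e) (cact Y 0 b e r y) i m) x"
            using coord_frag_of[OF i act(3), of "cact Y (n - p) b e r y" n d m] ry True unfolding e(2) by simp
          ultimately have "coord P n d i m (frag_of (p, b + a, cact P p b a r x, y)) = coord P n d i m (frag_of (p, a, x, cact Y (n - p) b e r y))"
            using elim by simp
          then show ?case
            unfolding act(1) e_def[symmetric] using t coord_closed[OF t(2)] by (simp add: coord_diff)
        qed
      next
        case False
        have "coord P n d i m (frag_of (p, b + a, cact P p b a r x, y)) = \<one>\<^bsub>cpart P n (d + D i m)\<^esub>"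
          "coord P n d i m (frag_of (p, a, x, cact Y (n - p) b e r y)) = \<one>\<^bsub>cpart P n (d + D i m)\<^esub>" for m
          using coord_frag_of[OF i rx, of y n d m] y False coord_frag_of[OF i act(3), of "cact Y (n - p) b e r y" n d m] ry
          unfolding e(1,2) by simp_all
        then show ?thesis
          unfolding act(1) e_def[symmetric] using t by (simp add: coord_diff)
      qed
    qed
    with c show ?case by blast
  qed
  then show ?thesis by blast
qed

lemma coord_tensor_diff:
  assumes "c \<in> tch n d"
  shows "\<forall>\<^sub>F m in sequentially. coord P (n + 1) d i m (tensor_diff P Y n d c) = diff P n (d + D i m) (coord P n d i m c)"
  using assms
proof (induction rule: tchains_induct)
  case zero
  show ?case by (simp add: coord_zero tensor_diff_zero diff_unit[OF P])
next
  case (diff c c')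
  from diff.IH show ?case
  proof eventually_elim
    case (elim m)
    then show ?case
      using diff.hyps
      by (simp add: tensor_diff_diff coord_diff tensor_diff_chains diff_mult[OF P] diff_inv[OF P] coord_closed)
  qed
next
  case (gen p a x y)
  let ?y = "diff Y (n - p) (d - a) y"
  have dy: "?y = \<one>\<^bsub>cpart Y (n - p + 1) (d - a)\<^esub>"
  proof (cases "n - p = 0")
    case True
    then have "n - p + 1 \<noteq> 0" by simp
    then show ?thesis using concentrated diff_closed[OF Y gen(2)] by blast
  next
    case False
    then have "y = \<one>\<^bsub>cpart Y (n - p) (d - a)\<^esub>" using concentrated gen(2) by blast
    then show ?thesis using diff_unit[OF Y] by simp
  qed
  have e: "n + 1 - p = n - p + 1" "n + 1 - (p + 1) = n - p" by simp_all
  have r: "frag_cmul (if even p then 1 else - 1) (frag_of (p, a, x, ?y)) \<in> rels (n + 1) d"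
    using rels_cmul[OF rels_unit_right[OF gen(1), of "n + 1" d]] unfolding dy e by simp
  have t: "frag_of (p + 1, a, diff P p a x, y) \<in> tch (n + 1) d"
    using gen diff_closed[OF P gen(1)] by (simp add: tchains_frag_of)
  have 1: "coord P (n + 1) d i m (frag_of (p + 1, a, diff P p a x, y)) = diff P n (d + D i m) (coord P n d i m (frag_of (p, a, x, y)))" for m
  proof (cases "p = n")
    case True
    have \<kappa>: "coef (d - a) y i m \<in> homog R (d - a + D i m)" using gen(2) True by (intro coef_homog i) auto
    have x: "x \<in> carrier (cpart P n a)" using gen(1) True by simp
    have "cact P (n + 1) (d - a + D i m) a (coef (d - a) y i m) (diff P n a x)
        = diff P n (d + D i m) (cact P n (d - a + D i m) a (coef (d - a) y i m) x)"
      using diff_act[OF P \<kappa> x] by simp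
    then show ?thesis using gen True diff_closed[OF P gen(1)] by (simp add: coord_frag_of[OF i])
  next
    case False
    then show ?thesis using gen diff_closed[OF P gen(1)] by (simp add: coord_frag_of[OF i] diff_unit[OF P])
  qed
  from coord_rels[OF r] show ?case
  proof eventually_elim
    case (elim m)
    then show ?case
      using coord_closed[OF t] by (simp add: tensor_diff_frag_of coord_add[OF t rels_chains[OF r]] 1)
  qed
qed

end

lemma lift_chains:
  assumes "\<And>i. i \<in> I \<Longrightarrow> q i \<in> carrier (cpart P n (d + D i m))"
  shows "lift n d m q \<in> tch n d"
  unfolding lift_def using assms gen_closed by (auto simp: tchains_frag_of intro!: tchains_sum)

lemma lift_unit: "lift n d m (\<lambda>i. \<one>\<^bsub>cpart P n (d + D i m)\<^esub>) \<in> rels n d"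
  unfolding lift_def using gen_closed by (intro rels_sum rels_unit_left) simp

lemma lift_mult:
  assumes "\<And>i. i \<in> I \<Longrightarrow> q i \<in> carrier (cpart P n (d + D i m))" "\<And>i. i \<in> I \<Longrightarrow> q' i \<in> carrier (cpart P n (d + D i m))"
  shows "lift n d m (\<lambda>i. q i \<otimes>\<^bsub>cpart P n (d + D i m)\<^esub> q' i) - (lift n d m q + lift n d m q') \<in> rels n d"
proof -
  have "(\<Sum>i\<in>I. frag_of (n, d + D i m, q i \<otimes>\<^bsub>cpart P n (d + D i m)\<^esub> q' i, gen i m)
     - frag_of (n, d + D i m, q i, gen i m) - frag_of (n, d + D i m, q' i, gen i m)) \<in> rels n d"
    using assms gen_closed by (intro rels_sum rels_left) auto
  then show ?thesis by (simp add: lift_def sum_subtractf sum.distrib diff_diff_eq)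
qed

lemma lift_mult_inv:
  assumes q: "\<And>i. i \<in> I \<Longrightarrow> q i \<in> carrier (cpart P n (d + D i m))" and q': "\<And>i. i \<in> I \<Longrightarrow> q' i \<in> carrier (cpart P n (d + D i m))"
  shows "lift n d m (\<lambda>i. q i \<otimes>\<^bsub>cpart P n (d + D i m)\<^esub> inv\<^bsub>cpart P n (d + D i m)\<^esub> q' i) - (lift n d m q - lift n d m q') \<in> rels n d"
proof -
  let ?z = "\<lambda>i. q i \<otimes>\<^bsub>cpart P n (d + D i m)\<^esub> inv\<^bsub>cpart P n (d + D i m)\<^esub> q' i"
  have z: "?z i \<in> carrier (cpart P n (d + D i m))" if "i \<in> I" for i using q q' that by simp
  have "lift n d m (\<lambda>i. ?z i \<otimes>\<^bsub>cpart P n (d + D i m)\<^esub> q' i) = lift n d m q"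
    unfolding lift_def
  proof (rule sum.cong[OF refl])
    fix i assume i: "i \<in> I"
    have "?z i \<otimes>\<^bsub>cpart P n (d + D i m)\<^esub> q' i = q i" using q[OF i] q'[OF i] by (simp add: Cg.m_assoc)
    then show "frag_of (n, d + D i m, ?z i \<otimes>\<^bsub>cpart P n (d + D i m)\<^esub> q' i, gen i m) = frag_of (n, d + D i m, q i, gen i m)" by simp
  qed
  then have "lift n d m q - (lift n d m ?z + lift n d m q') \<in> rels n d"
    using lift_mult[OF z q'] by simp
  from rels_uminus[OF this] show ?thesis by (simp add: algebra_simps)
qed

lemma lift_tensor_diff:
  assumes q: "\<And>i. i \<in> I \<Longrightarrow> q i \<in> carrier (cpart P n (d + D i m))"
  shows "tensor_diff P Y n d (lift n d m q) - lift (n + 1) d m (\<lambda>i. diff P n (d + D i m) (q i)) \<in> rels (n + 1) d"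
proof -
  have "tensor_diff P Y n d (lift n d m q) - lift (n + 1) d m (\<lambda>i. diff P n (d + D i m) (q i))
     = (\<Sum>i\<in>I. frag_cmul (if even n then 1 else - 1) (frag_of (n, d + D i m, q i, diff Y 0 (- D i m) (gen i m))))"
    by (simp add: lift_def tensor_diff_sum finite_I tensor_diff_frag_of sum.distrib)
  also have "\<dots> \<in> rels (n + 1) d"
  proof (intro rels_sum rels_cmul)
    fix i assume i: "i \<in> I"
    have "diff Y 0 (- D i m) (gen i m) = \<one>\<^bsub>cpart Y 1 (- D i m)\<^esub>"
      using diff_closed[OF Y gen_closed[OF i]] concentrated[of 1] by simp
    then show "frag_of (n, d + D i m, q i, diff Y 0 (- D i m) (gen i m)) \<in> rels (n + 1) d"
      using rels_unit_right[OF q[OF i], of "n + 1" d] by simp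
  qed
  finally show ?thesis .
qed

text \<open>
  Expanding \<open>y\<close> in the generators of a late stage and moving the coefficients to the left factor turns
  \<open>x \<otimes> y\<close> into \<open>\<Sum> (coef y i m * x) \<otimes> gen i m\<close>.
\<close>
lemma lift_coord:
  assumes "c \<in> tch n d"
  shows "\<forall>\<^sub>F m in sequentially. c - lift n d m (\<lambda>i. coord P n d i m c) \<in> rels n d"
  using assms
proof (induction rule: tchains_induct)
  case zero
  have "lift n d m (\<lambda>i. coord P n d i m 0) = lift n d m (\<lambda>i. \<one>\<^bsub>cpart P n (d + D i m)\<^esub>)" for m
    unfolding lift_def by (rule sum.cong) (simp_all add: coord_zero)
  then show ?case using rels_uminus[OF lift_unit] by simp
next
  case (diff c c')
  from diff.IH show ?case
  proof eventually_elim
    case (elim m)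
    have e: "lift n d m (\<lambda>i. coord P n d i m (c - c')) =
       lift n d m (\<lambda>i. coord P n d i m c \<otimes>\<^bsub>cpart P n (d + D i m)\<^esub> inv\<^bsub>cpart P n (d + D i m)\<^esub> coord P n d i m c')"
      unfolding lift_def by (rule sum.cong) (simp_all add: coord_diff diff.hyps)
    have "lift n d m (\<lambda>i. coord P n d i m (c - c')) -
        (lift n d m (\<lambda>i. coord P n d i m c) - lift n d m (\<lambda>i. coord P n d i m c')) \<in> rels n d"
      unfolding e by (rule lift_mult_inv) (simp_all add: coord_closed diff.hyps)
    from rels_diff[OF rels_diff[OF elim] this] show ?case by (simp add: algebra_simps)
  qed
next
  case (gen p a x y)
  show ?case
  proof (cases "p = n")
    case False
    then have "y = \<one>\<^bsub>cpart Y (n - p) (d - a)\<^esub>" using concentrated[of "n - p"] gen(2) by auto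
    then have 1: "frag_of (p, a, x, y) \<in> rels n d" using rels_unit_right[OF gen(1)] by simp
    have "lift n d m (\<lambda>i. coord P n d i m (frag_of (p, a, x, y))) = lift n d m (\<lambda>i. \<one>\<^bsub>cpart P n (d + D i m)\<^esub>)" for m
      unfolding lift_def by (rule sum.cong) (simp_all add: coord_frag_of gen False)
    then show ?thesis using rels_diff[OF 1 lift_unit] by simp
  next
    case True
    have x: "x \<in> carrier (cpart P n a)" and y: "y \<in> carrier (cpart Y 0 (d - a))" using gen True by simp_all
    from expansion[OF y] show ?thesis
    proof eventually_elim
      case (elim m)
      let ?\<kappa> = "\<lambda>i. coef (d - a) y i m"
      let ?z = "\<lambda>i. cact Y 0 (d - a + D i m) (- D i m) (?\<kappa> i) (gen i m)"
      have z: "?z i \<in> carrier (cpart Y 0 (d - a))" if "i \<in> I" for i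
        using act_closed[OF D_module coef_homog[OF y that, of m] gen_closed[OF that, of m]] by simp
      have 1: "frag_of (n, a, x, y) - (\<Sum>i\<in>I. frag_of (n, a, x, ?z i)) \<in> rels n d"
        using rels_finprod_right[OF x, of I ?z n d] z finite_I elim by simp
      have 2: "(\<Sum>i\<in>I. frag_of (n, d + D i m, cact P n (d - a + D i m) a (?\<kappa> i) x, gen i m) - frag_of (n, a, x, ?z i)) \<in> rels n d"
      proof (rule rels_sum)
        fix i assume i: "i \<in> I"
        show "frag_of (n, d + D i m, cact P n (d - a + D i m) a (?\<kappa> i) x, gen i m) - frag_of (n, a, x, ?z i) \<in> rels n d"
        proof -
          have "gen i m \<in> carrier (cpart Y (n - n) (- D i m))"
            unfolding diff_self by (rule gen_closed[OF i])
          then have "frag_of (n, d + D i m, cact P n (d - a + D i m) a (?\<kappa> i) x, gen i m)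
              - frag_of (n, a, x, cact Y (n - n) (d - a + D i m) (- D i m) (?\<kappa> i) (gen i m)) \<in> rels n d"
            by (rule rels_act[OF coef_homog[OF y i] x]) linarith+
          then show ?thesis unfolding diff_self .
        qed
      qed
      have 3: "lift n d m (\<lambda>i. coord P n d i m (frag_of (p, a, x, y))) =
         (\<Sum>i\<in>I. frag_of (n, d + D i m, cact P n (d - a + D i m) a (?\<kappa> i) x, gen i m))"
        unfolding lift_def
      proof (rule sum.cong[OF refl])
        fix i assume i: "i \<in> I"
        show "frag_of (n, d + D i m, coord P n d i m (frag_of (p, a, x, y)), gen i m) =
            frag_of (n, d + D i m, cact P n (d - a + D i m) a (?\<kappa> i) x, gen i m)"
          unfolding coord_frag_of[OF i gen] using True by simp
      qed
      have "(\<Sum>i\<in>I. frag_of (n, a, x, ?z i)) - lift n d m (\<lambda>i. coord P n d i m (frag_of (p, a, x, y))) \<in> rels n d"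
        using rels_uminus[OF 2] unfolding 3 by (simp add: sum_subtractf)
      with 1 show ?case unfolding True by (rule rels_trans)
    qed
  qed
qed

lemma eventually_all_I: "(\<And>i. i \<in> I \<Longrightarrow> \<forall>\<^sub>F m in sequentially. Q i m) \<Longrightarrow> \<forall>\<^sub>F m in sequentially. \<forall>i\<in>I. Q i m"
  using finite_I by (simp add: eventually_ball_finite_distrib)

lemma coord_cocycle:
  assumes c: "c \<in> tch n d" and dc: "tensor_diff P Y n d c \<in> rels (n + 1) d"
  shows "\<forall>\<^sub>F m in sequentially. \<forall>i\<in>I. coord P n d i m c \<in> cocycles P n (d + D i m)"
proof (rule eventually_all_I)
  fix i assume i: "i \<in> I"
  from coord_tensor_diff[OF i c] coord_rels[OF i dc]
  show "\<forall>\<^sub>F m in sequentially. coord P n d i m c \<in> cocycles P n (d + D i m)"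
    by eventually_elim (simp add: mem_cocycles_iff coord_closed[OF i c])
qed

lemma lift_coboundaries:
  assumes q: "\<And>i. i \<in> I \<Longrightarrow> q i \<in> coboundaries P n (d + D i m)"
  obtains b where "b \<in> tch (n - 1) d" "lift n d m q - tensor_diff P Y (n - 1) d b \<in> rels n d"
proof -
  have "\<forall>i\<in>I. \<exists>w. w \<in> carrier (cpart P (n - 1) (d + D i m)) \<and> q i = diff P (n - 1) (d + D i m) w"
    using q by (fastforce simp: coboundaries_def)
  then obtain w where w: "\<And>i. i \<in> I \<Longrightarrow> w i \<in> carrier (cpart P (n - 1) (d + D i m))"
    and qw: "\<And>i. i \<in> I \<Longrightarrow> q i = diff P (n - 1) (d + D i m) (w i)" by metis
  have "lift n d m (\<lambda>i. diff P (n - 1) (d + D i m) (w i)) = lift n d m q"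
    unfolding lift_def by (rule sum.cong) (simp_all add: qw)
  then have "tensor_diff P Y (n - 1) d (lift (n - 1) d m w) - lift n d m q \<in> rels n d"
    using lift_tensor_diff[of w "n - 1" d m] w by simp
  from rels_uminus[OF this] show thesis using that[OF lift_chains[OF w]] by simp
qed

text \<open>
  At a late stage a cocycle is the lift of its coordinates, these are cocycles of \<open>P\<close>, hence
  coboundaries, and lifts of coboundaries are coboundaries.
\<close>
lemma acyclic_tensor_flat:
  assumes ac: "acyclic_complex P" shows "acyclic_complex (tensor_complex R P Y)"
  unfolding acyclic_tensor_iff
proof (intro allI ballI impI)
  fix n d c assume c: "c \<in> tch n d" and dc: "tensor_diff P Y n d c \<in> rels (n + 1) d"
  from eventually_conj[OF lift_coord[OF c] coord_cocycle[OF c dc]]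
  obtain m where m: "c - lift n d m (\<lambda>i. coord P n d i m c) \<in> rels n d"
    "\<And>i. i \<in> I \<Longrightarrow> coord P n d i m c \<in> cocycles P n (d + D i m)"
    using eventually_happens'[OF sequentially_bot] by fastforce
  obtain b where "b \<in> tch (n - 1) d" "lift n d m (\<lambda>i. coord P n d i m c) - tensor_diff P Y (n - 1) d b \<in> rels n d"
    using lift_coboundaries[of "\<lambda>i. coord P n d i m c" n d m] m(2) ac unfolding acyclic_complex_iff[OF P] by blast
  then show "\<exists>b\<in>tch (n - 1) d. c - tensor_diff P Y (n - 1) d b \<in> rels n d"
    using rels_trans[OF m(1)] by blast
qed

end

text \<open>
  Coordinates are natural in \<open>P\<close> and \<open>I\<close> is finite, so a class in the kernel of the induced map, or a
  class to be hit by it, can be treated coordinate by coordinate at a common late stage, where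
  \<open>f\<close> is known to be injective and surjective on cohomology.
\<close>
lemma tensor_flat_qiso:
  fixes P :: "('l, 'p) cochain_complex" and Q :: "('l, 'q) cochain_complex"
  assumes P: "is_complex R P" and Q: "is_complex R Q" and q: "qiso R P Q f"
  obtains F where "qiso R (tensor_complex R P Y) (tensor_complex R Q Y) F"
proof -
  note f = qiso_chain_map[OF q]
  have idY: "is_chain_map R Y Y (\<lambda>p d x. x)" by (rule qiso_chain_map[OF qiso_id[OF Y]])
  interpret tensor_of_chain_maps R P Y Q Y f "\<lambda>p d x. x" by unfold_locales (rule P Q Y f idY)+
  let ?F = "tensor_hom f (\<lambda>p d (x :: 'v). x)"
  have nat: "coord Q n d i m (?F n d c) = f n (d + D i m) (coord P n d i m c)"
    if i: "i \<in> I" and c: "c \<in> tch n d" for n d i m c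
    using c
  proof (induction rule: tchains_induct)
    case zero
    have "?F n d 0 = 0" using tensor_hom_diff[of f _ n d 0 0] by simp
    then show ?case
      by (simp add: coord_zero[OF P i] coord_zero[OF Q i] hom_imp_one[OF C_group T.C_group chain_map_hom[OF f]])
  next
    case (diff c c')
    note h = diff.hyps
    show ?case
      unfolding tensor_hom_diff coord_diff[OF Q i tensor_hom_chains[OF h(1)] tensor_hom_chains[OF h(2)]]
        coord_diff[OF P i h] diff.IH
        hom_mult[OF chain_map_hom[OF f] coord_closed[OF P i h(1)] Cg.inv_closed[OF coord_closed[OF P i h(2)]]]
        hom_imp_inv[OF C_group T.C_group chain_map_hom[OF f] coord_closed[OF P i h(2)]] ..
  next
    case (gen p a x y)
    show ?case
    proof (cases "p = n")
      case True
      have \<kappa>: "coef (d - a) y i m \<in> homog R (d - a + D i m)" using gen(2) True by (intro coef_homog i) auto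
      have x: "x \<in> carrier (cpart P n a)" using gen(1) True by simp
      have "f n (d + D i m) (cact P n (d - a + D i m) a (coef (d - a) y i m) x)
          = cact Q n (d - a + D i m) a (coef (d - a) y i m) (f n a x)"
        using chain_map_act[OF f \<kappa> x] by simp
      then show ?thesis
        using gen True chain_map_closed[OF f gen(1)]
        by (simp add: tensor_hom_frag_of coord_frag_of[OF P i] coord_frag_of[OF Q i])
    next
      case False
      then show ?thesis
        using gen chain_map_closed[OF f gen(1)]
        by (simp add: tensor_hom_frag_of coord_frag_of[OF P i] coord_frag_of[OF Q i]
            hom_imp_one[OF C_group T.C_group chain_map_hom[OF f]])
    qed
  qed
  have F_lift: "?F n d (lift n d m z) = lift n d m (\<lambda>i. f n (d + D i m) (z i))" for n d m z
    unfolding lift_def tensor_hom_def tensor_map_def by (simp add: frag_extend_sum[OF finite_I])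
  have "qiso R TC T.TC class_map"
  proof (rule class_map_qisoI)
    fix n d c b
    assume c: "c \<in> tch n d" and dc: "tensor_diff P Y n d c \<in> rels (n + 1) d" and b: "b \<in> T.tch (n - 1) d"
      and cb: "?F n d c - tensor_diff Q Y (n - 1) d b \<in> T.rels n d"
    have db: "tensor_diff Q Y (n - 1) d b \<in> T.tch n d" using T.tensor_diff_chains[OF b] by simp
    have 1: "\<forall>\<^sub>F m in sequentially. \<forall>i\<in>I. f n (d + D i m) (coord P n d i m c) \<in> coboundaries Q n (d + D i m)"
    proof (rule eventually_all_I[OF P])
      fix i assume i: "i \<in> I"
      have "\<forall>\<^sub>F m in sequentially. coord Q n d i m (tensor_diff Q Y (n - 1) d b) = diff Q (n - 1) (d + D i m) (coord Q (n - 1) d i m b)"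
        using coord_tensor_diff[OF Q i b] by simp
      with coord_rels[OF Q i cb]
      show "\<forall>\<^sub>F m in sequentially. f n (d + D i m) (coord P n d i m c) \<in> coboundaries Q n (d + D i m)"
      proof eventually_elim
        case (elim m)
        have "f n (d + D i m) (coord P n d i m c) = coord Q n d i m (tensor_diff Q Y (n - 1) d b)"
          using elim(1) coord_closed[OF Q i db] chain_map_closed[OF f coord_closed[OF P i c]]
          unfolding coord_diff[OF Q i tensor_hom_chains[OF c] db] nat[OF i c]
          by (simp add: T.Cg.mult_inv_eq_one_iff)
        then show ?case using elim(2) coord_closed[OF Q i b] by (auto simp: coboundaries_def)
      qed
    qed
    from eventually_conj[OF 1 eventually_conj[OF lift_coord[OF P c] coord_cocycle[OF P c dc]]]
    obtain m where m: "c - lift n d m (\<lambda>i. coord P n d i m c) \<in> rels n d"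
      "\<And>i. i \<in> I \<Longrightarrow> coord P n d i m c \<in> cocycles P n (d + D i m)"
      "\<And>i. i \<in> I \<Longrightarrow> f n (d + D i m) (coord P n d i m c) \<in> coboundaries Q n (d + D i m)"
      using eventually_happens'[OF sequentially_bot] by fastforce
    obtain b where "b \<in> tch (n - 1) d" "lift n d m (\<lambda>i. coord P n d i m c) - tensor_diff P Y (n - 1) d b \<in> rels n d"
      using lift_coboundaries[OF P, of "\<lambda>i. coord P n d i m c" n d m] qiso_reflects_coboundaries[OF q m(2) m(3)] by blast
    then show "\<exists>b'\<in>tch (n - 1) d. c - tensor_diff P Y (n - 1) d b' \<in> rels n d"
      using rels_trans[OF m(1)] by blast
  next
    fix n d z
    assume z: "z \<in> T.tch n d" and dz: "tensor_diff Q Y n d z \<in> T.rels (n + 1) d"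
    from eventually_conj[OF lift_coord[OF Q z] coord_cocycle[OF Q z dz]]
    obtain m where m: "z - lift n d m (\<lambda>i. coord Q n d i m z) \<in> T.rels n d"
      "\<And>i. i \<in> I \<Longrightarrow> coord Q n d i m z \<in> cocycles Q n (d + D i m)"
      using eventually_happens'[OF sequentially_bot] by fastforce
    let ?z = "\<lambda>i. coord Q n d i m z"
    have "\<forall>i\<in>I. \<exists>x\<in>cocycles P n (d + D i m). ?z i \<otimes>\<^bsub>cpart Q n (d + D i m)\<^esub> inv\<^bsub>cpart Q n (d + D i m)\<^esub> f n (d + D i m) x \<in> coboundaries Q n (d + D i m)"
      using m(2) qiso_surj[OF q] by metis
    then obtain x where x: "\<And>i. i \<in> I \<Longrightarrow> x i \<in> cocycles P n (d + D i m)"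
      and zx: "\<And>i. i \<in> I \<Longrightarrow> ?z i \<otimes>\<^bsub>cpart Q n (d + D i m)\<^esub> inv\<^bsub>cpart Q n (d + D i m)\<^esub> f n (d + D i m) (x i) \<in> coboundaries Q n (d + D i m)"
      by metis
    have xc: "x i \<in> carrier (cpart P n (d + D i m))" if "i \<in> I" for i using x[OF that] by (simp add: mem_cocycles_iff)
    obtain b where b: "b \<in> T.tch (n - 1) d"
      and b': "lift n d m (\<lambda>i. ?z i \<otimes>\<^bsub>cpart Q n (d + D i m)\<^esub> inv\<^bsub>cpart Q n (d + D i m)\<^esub> f n (d + D i m) (x i)) - tensor_diff Q Y (n - 1) d b \<in> T.rels n d"
      using lift_coboundaries[OF Q zx] .
    have lx: "lift n d m x \<in> tch n d" by (rule lift_chains[OF P xc])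
    have "lift (n + 1) d m (\<lambda>i. diff P n (d + D i m) (x i)) = lift (n + 1) d m (\<lambda>i. \<one>\<^bsub>cpart P (n + 1) (d + D i m)\<^esub>)"
      unfolding lift_def using x by (intro sum.cong) (simp_all add: mem_cocycles_iff)
    then have dlx: "tensor_diff P Y n d (lift n d m x) \<in> rels (n + 1) d"
      using rels_add[OF lift_tensor_diff[OF P xc] lift_unit[OF P, where m = m]] by simp
    have 2: "lift n d m (\<lambda>i. ?z i \<otimes>\<^bsub>cpart Q n (d + D i m)\<^esub> inv\<^bsub>cpart Q n (d + D i m)\<^esub> f n (d + D i m) (x i))
        - (lift n d m ?z - lift n d m (\<lambda>i. f n (d + D i m) (x i))) \<in> T.rels n d"
      by (rule lift_mult_inv[OF Q]) (simp_all add: coord_closed[OF Q _ z] chain_map_closed[OF f xc])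
    have "z - ?F n d (lift n d m x) - tensor_diff Q Y (n - 1) d b \<in> T.rels n d"
      using T.rels_add[OF T.rels_diff[OF m(1) 2] b'] by (simp add: F_lift algebra_simps)
    then show "\<exists>c\<in>tch n d. \<exists>b\<in>T.tch (n - 1) d. tensor_diff P Y n d c \<in> rels (n + 1) d \<and>
        z - ?F n d c - tensor_diff Q Y (n - 1) d b \<in> T.rels n d"
      using lx dlx b by blast
  qed
  then show thesis by (rule that)
qed

end

text \<open>
  \<open>K_flat\<close> has the flat complex as the left factor, \<open>acyclic_tensor_flat\<close> as the right one.
\<close>
lemma (in flat_system) K_flat: "K_flat R Y"
  unfolding K_flat_def
  using Y acyclic_tensor_flat acyclic_tensor_swap by blast


section \<open>Tensor products of flat systems\<close>

lemma hom_finprod: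
  assumes G: "comm_group G" and H: "comm_group H" and h: "h \<in> hom G H" and f: "\<And>i. i \<in> A \<Longrightarrow> f i \<in> carrier G"
  shows "h (finprod G f A) = finprod H (\<lambda>i. h (f i)) A"
proof -
  interpret G: comm_group G by fact
  interpret H: comm_group H by fact
  show ?thesis
    using f
  proof (induction A rule: infinite_finite_induct)
    case (insert i A)
    then have "f \<in> A \<rightarrow> carrier G" "f i \<in> carrier G" "(\<lambda>i. h (f i)) \<in> A \<rightarrow> carrier H" "h (f i) \<in> carrier H"
      using hom_imp_closed[OF h] by auto
    then show ?case using insert h by (simp add: hom_mult)
  qed (simp_all add: hom_imp_one[OF G H h])
qed

lemma (in flat_system) reindex:
  assumes e: "bij_betw e J I"
  shows "flat_system R Y J (\<lambda>j. D (e j)) (\<lambda>d y j. coef d y (e j)) (\<lambda>j. gen (e j))"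
proof -
  have eJ: "e j \<in> I" if "j \<in> J" for j using e that by (auto simp: bij_betw_def)
  show ?thesis
  proof (unfold_locales; (intro Y concentrated coef_homog coef_mult coef_act gen_closed eJ; assumption)?)
    show "finite J" using bij_betw_finite[OF e] finite_I by simp
    fix d y assume y: "y \<in> carrier (cpart Y 0 d)"
    interpret Yg: comm_group "cpart Y 0 d" by (rule complex_group[OF Y])
    have z: "cact Y 0 (d + D i m) (- D i m) (coef d y i m) (gen i m) \<in> carrier (cpart Y 0 d)" if "i \<in> I" for i m
      using act_closed[OF complex_module[OF Y] coef_homog[OF y that, of m] gen_closed[OF that, of m]] by simp
    from expansion[OF y]
    show "\<forall>\<^sub>F m in sequentially. y = finprod (cpart Y 0 d)
        (\<lambda>j. cact Y 0 (d + D (e j) m) (- D (e j) m) (coef d y (e j) m) (gen (e j) m)) J"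
    proof eventually_elim
      case (elim m)
      have "inj_on e J" "e ` J = I" using e by (auto simp: bij_betw_def)
      then show ?case
        using elim Yg.finprod_reindex[of "\<lambda>i. cact Y 0 (d + D i m) (- D i m) (coef d y i m) (gen i m)" e J] z by auto
    qed
  qed
qed

lemma (in flat_system) transport:
  assumes T: "is_complex R T" and f: "is_chain_map R T Y f" and g: "is_chain_map R Y T g"
    and fg: "\<And>p d y. y \<in> carrier (cpart Y p d) \<Longrightarrow> f p d (g p d y) = y"
    and gf: "\<And>p d x. x \<in> carrier (cpart T p d) \<Longrightarrow> g p d (f p d x) = x"
  shows "flat_system R T I D (\<lambda>d x. coef d (f 0 d x)) (\<lambda>i m. g 0 (- D i m) (gen i m))"
proof unfold_locales
  note fc = chain_map_closed[OF f] and gc = chain_map_closed[OF g]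
  show "is_complex R T" by fact
  show "carrier (cpart T p d) = {\<one>\<^bsub>cpart T p d\<^esub>}" if "p \<noteq> 0" for p d
  proof -
    interpret Tg: comm_group "cpart T p d" by (rule complex_group[OF T])
    have "x = \<one>\<^bsub>cpart T p d\<^esub>" if x: "x \<in> carrier (cpart T p d)" for x
    proof -
      have "f p d x = \<one>\<^bsub>cpart Y p d\<^esub>" using fc[OF x] concentrated[OF \<open>p \<noteq> 0\<close>] by blast
      then show ?thesis
        using gf[OF x] hom_imp_one[OF complex_group[OF Y] complex_group[OF T] chain_map_hom[OF g]] by simp
    qed
    then show ?thesis using Tg.one_closed by blast
  qed
  show "finite I" by (rule finite_I)
  show "g 0 (- D i m) (gen i m) \<in> carrier (cpart T 0 (- D i m))" if "i \<in> I" for i m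
    by (rule gc[OF gen_closed[OF that]])
  show "coef d (f 0 d x) i m \<in> homog R (d + D i m)" if "x \<in> carrier (cpart T 0 d)" "i \<in> I" for d x i m
    by (rule coef_homog[OF fc[OF that(1)] that(2)])
  show "\<forall>\<^sub>F m in sequentially. coef d (f 0 d (x \<otimes>\<^bsub>cpart T 0 d\<^esub> y)) i m = coef d (f 0 d x) i m \<oplus> coef d (f 0 d y) i m"
    if "x \<in> carrier (cpart T 0 d)" "y \<in> carrier (cpart T 0 d)" "i \<in> I" for d x y i
    unfolding hom_mult[OF chain_map_hom[OF f] that(1,2)] by (rule coef_mult[OF fc[OF that(1)] fc[OF that(2)] that(3)])
  show "\<forall>\<^sub>F m in sequentially. coef (b + d) (f 0 (b + d) (cact T 0 b d r y)) i m = r \<otimes> coef d (f 0 d y) i m"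
    if "r \<in> homog R b" "y \<in> carrier (cpart T 0 d)" "i \<in> I" for b d r y i
    unfolding chain_map_act[OF f that(1,2)] by (rule coef_act[OF that(1) fc[OF that(2)] that(3)])
  fix d x assume x: "x \<in> carrier (cpart T 0 d)"
  from expansion[OF fc[OF x]]
  show "\<forall>\<^sub>F m in sequentially. x = finprod (cpart T 0 d)
      (\<lambda>i. cact T 0 (d + D i m) (- D i m) (coef d (f 0 d x) i m) (g 0 (- D i m) (gen i m))) I"
  proof eventually_elim
    case (elim m)
    let ?z = "\<lambda>i. cact Y 0 (d + D i m) (- D i m) (coef d (f 0 d x) i m) (gen i m)"
    have z: "?z i \<in> carrier (cpart Y 0 d)" if "i \<in> I" for i
      using act_closed[OF complex_module[OF Y] coef_homog[OF fc[OF x] that, of m] gen_closed[OF that, of m]] by simp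
    have gz: "g 0 d (?z i) = cact T 0 (d + D i m) (- D i m) (coef d (f 0 d x) i m) (g 0 (- D i m) (gen i m))" if "i \<in> I" for i
      using chain_map_act[OF g coef_homog[OF fc[OF x] that, of m] gen_closed[OF that, of m]] by simp
    interpret Tg: comm_group "cpart T 0 d" by (rule complex_group[OF T])
    have "x = g 0 d (finprod (cpart Y 0 d) ?z I)" using elim gf[OF x] by simp
    also have "\<dots> = finprod (cpart T 0 d) (\<lambda>i. g 0 d (?z i)) I"
      by (rule hom_finprod[OF complex_group[OF Y] complex_group[OF T] chain_map_hom[OF g] z])
    also have "\<dots> = finprod (cpart T 0 d)
      (\<lambda>i. cact T 0 (d + D i m) (- D i m) (coef d (f 0 d x) i m) (g 0 (- D i m) (gen i m))) I"
      using gc[OF z] by (intro Tg.finprod_cong') (auto simp: gz[symmetric])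
    finally show ?case .
  qed
qed

context graded_cring
begin

text \<open>
  The homogeneous elements of one degree in multiplicative notation, as the target of additive maps
  out of free abelian groups.
\<close>
definition homog_group :: "int \<Rightarrow> 'l monoid" where
  "homog_group e = \<lparr>carrier = homog R e, monoid.mult = (\<lambda>x y. x \<oplus> y), one = \<zero>\<rparr>"

lemma homog_group_simps:
  "carrier (homog_group e) = homog R e" "x \<otimes>\<^bsub>homog_group e\<^esub> y = x \<oplus> y" "\<one>\<^bsub>homog_group e\<^esub> = \<zero>"
  by (simp_all add: homog_group_def)

lemma homog_group_comm: "comm_group (homog_group e)"
proof (rule comm_groupI; unfold homog_group_simps)
  show "\<exists>y\<in>homog R e. y \<oplus> x = \<zero>" if "x \<in> homog R e" for x
    using that by (intro bexI[of _ "\<ominus> x"]) (auto simp: homog_minus l_neg homog_carrier)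
qed (auto simp: homog_add homog_zero a_ac homog_carrier)

lemma homog_group_inv: "x \<in> homog R e \<Longrightarrow> inv\<^bsub>homog_group e\<^esub> x = \<ominus> x"
  by (rule group.inv_equality[OF comm_group_imp_group[OF homog_group_comm]])
     (auto simp: homog_group_simps homog_minus l_neg homog_carrier)

lemma act_minus_scalar:
  assumes M: "is_graded_module R M" and r: "r \<in> homog R a" and s: "s \<in> homog R a" and x: "x \<in> carrier (part M d)"
  shows "act M a d (r \<ominus> s) x = act M a d r x \<otimes>\<^bsub>part M (a + d)\<^esub> inv\<^bsub>part M (a + d)\<^esub> act M a d s x"
proof -
  interpret P: comm_group "part M (a + d)" by (rule part_comm_group[OF M])
  note cl = act_closed[OF M _ x]
  have "act M a d (\<ominus> s) x \<otimes>\<^bsub>part M (a + d)\<^esub> act M a d s x = \<one>\<^bsub>part M (a + d)\<^esub>"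
    using act_add_scalar[OF M homog_minus[OF s] s x] act_zero_scalar[OF M x, of a] s
    by (simp add: l_neg homog_carrier)
  then have "inv\<^bsub>part M (a + d)\<^esub> act M a d s x = act M a d (\<ominus> s) x"
    by (rule P.inv_equality) (simp_all add: cl s homog_minus)
  then show ?thesis
    using act_add_scalar[OF M r homog_minus[OF s] x] by (simp add: a_minus_def)
qed

end

context complex_pair
begin

lemma rels_left_inv:
  assumes x: "x \<in> carrier (cpart C p a)" and x': "x' \<in> carrier (cpart C p a)" and y: "y \<in> carrier (cpart D (n - p) (d - a))"
  shows "frag_of (p, a, x \<otimes>\<^bsub>cpart C p a\<^esub> inv\<^bsub>cpart C p a\<^esub> x', y) - (frag_of (p, a, x, y) - frag_of (p, a, x', y)) \<in> rels n d"
proof -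
  have "x \<otimes>\<^bsub>cpart C p a\<^esub> inv\<^bsub>cpart C p a\<^esub> x' \<otimes>\<^bsub>cpart C p a\<^esub> x' = x" using x x' by (simp add: Cg.m_assoc)
  then have "frag_of (p, a, x, y) - frag_of (p, a, x \<otimes>\<^bsub>cpart C p a\<^esub> inv\<^bsub>cpart C p a\<^esub> x', y) - frag_of (p, a, x', y) \<in> rels n d"
    using rels_left[of "x \<otimes>\<^bsub>cpart C p a\<^esub> inv\<^bsub>cpart C p a\<^esub> x'" p a x' y n d] x x' y by simp
  from rels_uminus[OF this] show ?thesis by (simp add: algebra_simps)
qed

lemma rels_finprod_left:
  assumes "y \<in> carrier (cpart D (n - p) (d - a))" "\<And>i. i \<in> I \<Longrightarrow> x i \<in> carrier (cpart C p a)" "finite I"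
  shows "frag_of (p, a, finprod (cpart C p a) x I, y) - (\<Sum>i\<in>I. frag_of (p, a, x i, y)) \<in> rels n d"
  using assms(3,2)
proof (induction I)
  case empty
  then show ?case using rels_unit_left[OF assms(1)] by simp
next
  case (insert i I)
  have c: "x \<in> I \<rightarrow> carrier (cpart C p a)" "x i \<in> carrier (cpart C p a)"
    using insert.prems by auto
  have "frag_of (p, a, finprod (cpart C p a) x (insert i I), y) - frag_of (p, a, x i, y)
      - frag_of (p, a, finprod (cpart C p a) x I, y) \<in> rels n d"
    using rels_left[OF c(2) Cg.finprod_closed[OF c(1)] assms(1)] insert c by simp
  from rels_add[OF this insert.IH] insert.prems show ?case
    using insert.hyps by (simp add: algebra_simps)
qed

lemma finprod_tclass:
  assumes "\<And>i. i \<in> I \<Longrightarrow> c i \<in> tch n d" "finite I"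
  shows "finprod (cpart TC n d) (\<lambda>i. tclass n d (c i)) I = tclass n d (\<Sum>i\<in>I. c i)"
proof -
  interpret T: comm_group "cpart TC n d" by (rule complex_group[OF is_complex_tensor])
  show ?thesis
    using assms(2,1)
  proof (induction I)
    case empty
    show ?case by (simp add: one_tensor)
  next
    case (insert i I)
    then have "(\<lambda>i. tclass n d (c i)) \<in> I \<rightarrow> carrier (cpart TC n d)" "tclass n d (c i) \<in> carrier (cpart TC n d)"
      by (auto simp: tclass_closed)
    then show ?case using insert by (simp add: mult_tensor tchains_sum)
  qed
qed

end

locale two_flat_systems = graded_cring R + U: flat_system R U I DX coefX genX + Y: flat_system R Y J DY coefY genY
  for R :: "'l graded_ring" (structure)
    and U :: "('l, 'x) cochain_complex" and I :: "'i set" and DX coefX genX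
    and Y :: "('l, 'y) cochain_complex" and J :: "'j set" and DY coefY genY
begin

sublocale complex_pair R U Y by unfold_locales (rule U.Y Y.Y)+

text \<open>
  A tensor product of free modules has the pairs of basis elements as its basis, so the coordinate of
  \<open>x \<otimes> y\<close> at \<open>(i, j)\<close> is the product of those of \<open>x\<close> at \<open>i\<close> and of \<open>y\<close> at \<open>j\<close>. The symbols with
  \<open>p \<noteq> 0\<close> have trivial factors.
\<close>
definition pcoef_frag where
  "pcoef_frag d i j m = (\<lambda>(p, a, x, y). if p = (0 :: int) then coefX a x i m \<otimes> coefY (d - a) y j m else \<zero>)"

definition pcoef where
  "pcoef d i j m = (SOME h. h \<in> hom (tfree 0 d) (homog_group (d + (DX i m + DY j m))) \<and>
     (\<forall>s\<in>tensor_gens U Y 0 d. h (frag_of s) = pcoef_frag d i j m s))"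

definition pgen where
  "pgen ij m = tclass 0 (- (DX (fst ij) m + DY (snd ij) m)) (frag_of (0, - DX (fst ij) m, genX (fst ij) m, genY (snd ij) m))"

text \<open>
  Equal classes have coordinates that agree from some stage on (\<open>pcoef_rels\<close>). To obtain a function
  of the class at every stage, a representative is fixed.
\<close>
definition pcoef_class where
  "pcoef_class d K ij m = pcoef d (fst ij) (snd ij) m (SOME c. c \<in> tch 0 d \<and> K = tclass 0 d c)"

context
  fixes i j assumes i: "i \<in> I" and j: "j \<in> J"
begin

lemma product_homog:
  assumes "x \<in> carrier (cpart U 0 a)" "y \<in> carrier (cpart Y 0 (d - a))"
  shows "coefX a x i m \<otimes> coefY (d - a) y j m \<in> homog R (d + (DX i m + DY j m))"
proof -
  have e: "a + DX i m + (d - a + DY j m) = d + (DX i m + DY j m)" by simp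
  show ?thesis using homog_mult[OF U.coef_homog[OF assms(1) i] Y.coef_homog[OF assms(2) j], of m m] unfolding e .
qed

lemma pcoef:
  shows pcoef_hom: "pcoef d i j m \<in> hom (tfree 0 d) (homog_group (d + (DX i m + DY j m)))"
    and pcoef_frag_of: "x \<in> carrier (cpart U p a) \<Longrightarrow> y \<in> carrier (cpart Y (0 - p) (d - a)) \<Longrightarrow>
      pcoef d i j m (frag_of (p, a, x, y)) = (if p = 0 then coefX a x i m \<otimes> coefY (d - a) y j m else \<zero>)"
proof -
  interpret H: comm_group "homog_group (d + (DX i m + DY j m))" by (rule homog_group_comm)
  have "pcoef_frag d i j m ` tensor_gens U Y 0 d \<subseteq> carrier (homog_group (d + (DX i m + DY j m)))"
    by (clarsimp simp: mem_tensor_gens pcoef_frag_def homog_group_simps homog_zero product_homog)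
  then obtain h where "h \<in> hom (tfree 0 d) (homog_group (d + (DX i m + DY j m)))"
    "\<And>s. s \<in> tensor_gens U Y 0 d \<Longrightarrow> h (frag_of s) = pcoef_frag d i j m s"
    by (rule H.free_Abelian_group_universal) blast
  then have *: "pcoef d i j m \<in> hom (tfree 0 d) (homog_group (d + (DX i m + DY j m))) \<and>
     (\<forall>s\<in>tensor_gens U Y 0 d. pcoef d i j m (frag_of s) = pcoef_frag d i j m s)"
    unfolding pcoef_def by (intro someI_ex[of "\<lambda>h. h \<in> _ \<and> _ h"]) blast
  then show "pcoef d i j m \<in> hom (tfree 0 d) (homog_group (d + (DX i m + DY j m)))" by blast
  show "pcoef d i j m (frag_of (p, a, x, y)) = (if p = 0 then coefX a x i m \<otimes> coefY (d - a) y j m else \<zero>)"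
    if "x \<in> carrier (cpart U p a)" "y \<in> carrier (cpart Y (0 - p) (d - a))"
    using * that by (auto simp: mem_tensor_gens pcoef_frag_def)
qed

lemma pcoef_closed: "c \<in> tch 0 d \<Longrightarrow> pcoef d i j m c \<in> homog R (d + (DX i m + DY j m))"
  using hom_imp_closed[OF pcoef_hom, of c d m] by (simp only: carrier_free_tensor homog_group_simps)

lemma pcoef_carrier: "c \<in> tch 0 d \<Longrightarrow> pcoef d i j m c \<in> carrier R"
  by (rule homog_carrier[OF pcoef_closed])

lemma pcoef_add: "c \<in> tch 0 d \<Longrightarrow> c' \<in> tch 0 d \<Longrightarrow> pcoef d i j m (c + c') = pcoef d i j m c \<oplus> pcoef d i j m c'"
  using hom_mult[OF pcoef_hom, of c d c' m] by (simp only: carrier_free_tensor mult_free_Abelian_group homog_group_simps)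

lemma pcoef_zero: "pcoef d i j m 0 = \<zero>"
  using hom_imp_one[OF tfree_group homog_group_comm pcoef_hom, of d m] by (simp add: homog_group_simps)

lemma pcoef_uminus: "c \<in> tch 0 d \<Longrightarrow> pcoef d i j m (- c) = \<ominus> pcoef d i j m c"
  using hom_imp_inv[OF tfree_group homog_group_comm pcoef_hom, of c d m] homog_group_inv[OF pcoef_closed, of c d m]
  by (simp add: tchains_def)

lemma pcoef_diff: "c \<in> tch 0 d \<Longrightarrow> c' \<in> tch 0 d \<Longrightarrow> pcoef d i j m (c - c') = pcoef d i j m c \<ominus> pcoef d i j m c'"
  using pcoef_add[OF _ tchains_uminus, of c d c' m] by (simp add: pcoef_uminus a_minus_def)

text \<open>
  As for \<open>coord_rels\<close>, each relator is annihilated eventually, now by additivity and linearity of the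
  coordinates of both factors.
\<close>
lemma pcoef_rels:
  assumes "c \<in> rels 0 d"
  shows "\<forall>\<^sub>F m in sequentially. pcoef d i j m c = \<zero>"
proof -
  have "c \<in> tch 0 d \<and> (\<forall>\<^sub>F m in sequentially. pcoef d i j m c = \<zero>)"
    using assms relators_subset
  proof (induction rule: tensor_rels_induct)
    case zero
    show ?case by (simp add: pcoef_zero tchains_zero)
  next
    case (diff c c')
    then have c: "c \<in> tch 0 d" and c': "c' \<in> tch 0 d" by auto
    have "\<forall>\<^sub>F m in sequentially. pcoef d i j m (c - c') = \<zero>"
      using diff[THEN conjunct2] by eventually_elim (simp add: pcoef_diff[OF c c'] a_minus_def)
    then show ?case using c c' by (simp add: tchains_diff)
  next
    case (relator c)
    then have c: "c \<in> tch 0 d" using relators_subset by blast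
    from relator have "\<forall>\<^sub>F m in sequentially. pcoef d i j m c = \<zero>"
    proof (cases rule: tensor_relators_cases)
      case (left p a x x' y)
      have t: "frag_of (p, a, x \<otimes>\<^bsub>cpart U p a\<^esub> x', y) \<in> tch 0 d" "frag_of (p, a, x, y) \<in> tch 0 d" "frag_of (p, a, x', y) \<in> tch 0 d"
        using left by (simp_all add: tchains_frag_of)
      show ?thesis
      proof (cases "p = 0")
        case True
        have xx: "x \<in> carrier (cpart U 0 a)" "x' \<in> carrier (cpart U 0 a)" and y: "y \<in> carrier (cpart Y 0 (d - a))"
          using left True by simp_all
        from U.coef_mult[OF xx i] show ?thesis
        proof eventually_elim
          case (elim m)
          have k: "coefX a x i m \<in> carrier R" "coefX a x' i m \<in> carrier R" "coefY (d - a) y j m \<in> carrier R"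
            by (rule homog_carrier U.coef_homog[OF xx(1) i] U.coef_homog[OF xx(2) i] Y.coef_homog[OF y j])+
          show ?case
            unfolding left(1) pcoef_diff[OF tchains_diff[OF t(1,2)] t(3)] pcoef_diff[OF t(1,2)]
            using left(2-4) xx k elim True by (simp add: pcoef_frag_of) algebra
        qed
      next
        case False
        then show ?thesis
          unfolding left(1) pcoef_diff[OF tchains_diff[OF t(1,2)] t(3)] pcoef_diff[OF t(1,2)]
          using left(2-4) by (simp add: pcoef_frag_of a_minus_def)
      qed
    next
      case (right p a x y y')
      have t: "frag_of (p, a, x, y \<otimes>\<^bsub>cpart Y (0 - p) (d - a)\<^esub> y') \<in> tch 0 d" "frag_of (p, a, x, y) \<in> tch 0 d" "frag_of (p, a, x, y') \<in> tch 0 d"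
        using right by (simp_all add: tchains_frag_of)
      show ?thesis
      proof (cases "p = 0")
        case True
        have yy: "y \<in> carrier (cpart Y 0 (d - a))" "y' \<in> carrier (cpart Y 0 (d - a))" and x: "x \<in> carrier (cpart U 0 a)"
          using right True by simp_all
        from Y.coef_mult[OF yy j] show ?thesis
        proof eventually_elim
          case (elim m)
          have k: "coefX a x i m \<in> carrier R" "coefY (d - a) y j m \<in> carrier R" "coefY (d - a) y' j m \<in> carrier R"
            by (rule homog_carrier U.coef_homog[OF x i] Y.coef_homog[OF yy(1) j] Y.coef_homog[OF yy(2) j])+
          show ?case
            unfolding right(1) pcoef_diff[OF tchains_diff[OF t(1,2)] t(3)] pcoef_diff[OF t(1,2)]
            using right(2-4) x yy k elim True by (simp add: pcoef_frag_of) algebra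
        qed
      next
        case False
        then show ?thesis
          unfolding right(1) pcoef_diff[OF tchains_diff[OF t(1,2)] t(3)] pcoef_diff[OF t(1,2)]
          using right(2-4) by (simp add: pcoef_frag_of a_minus_def)
      qed
    next
      case (act p a b r x y)
      define e where "e = d - a - b"
      have e: "d - (b + a) = e" "d - a = b + e" by (simp_all add: e_def)
      have y: "y \<in> carrier (cpart Y (0 - p) e)" using act(4) by (simp add: e_def)
      have ry: "cact Y (0 - p) b e r y \<in> carrier (cpart Y (0 - p) (b + e))" by (rule act_closed[OF D_module act(2) y])
      have rx: "cact U p b a r x \<in> carrier (cpart U p (b + a))" by (rule act_closed[OF C_module act(2,3)])
      have t: "frag_of (p, b + a, cact U p b a r x, y) \<in> tch 0 d" "frag_of (p, a, x, cact Y (0 - p) b e r y) \<in> tch 0 d"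
        using act(3) y rx ry by (simp_all only: tchains_frag_of e simp_thms)
      have 1: "pcoef d i j m (frag_of (p, b + a, cact U p b a r x, y)) =
          (if p = 0 then coefX (b + a) (cact U p b a r x) i m \<otimes> coefY e y j m else \<zero>)" for m
        using pcoef_frag_of[OF rx, of y d m] y unfolding e(1) by simp
      have 2: "pcoef d i j m (frag_of (p, a, x, cact Y (0 - p) b e r y)) =
          (if p = 0 then coefX a x i m \<otimes> coefY (b + e) (cact Y (0 - p) b e r y) j m else \<zero>)" for m
        using pcoef_frag_of[OF act(3), of "cact Y (0 - p) b e r y" d m] ry unfolding e(2) by simp
      show ?thesis
      proof (cases "p = 0")
        case True
        have y0: "y \<in> carrier (cpart Y 0 e)" and x: "x \<in> carrier (cpart U 0 a)" using y act(3) True by simp_all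
        from U.coef_act[OF act(2) x i] Y.coef_act[OF act(2) y0 j] show ?thesis
        proof eventually_elim
          case (elim m)
          have k: "coefX a x i m \<in> carrier R" "coefY e y j m \<in> carrier R" "r \<in> carrier R"
            by (rule homog_carrier U.coef_homog[OF x i] Y.coef_homog[OF y0 j] act(2))+
          show ?case
            unfolding act(1) e_def[symmetric] pcoef_diff[OF t] 1 2 using elim k True by simp algebra
        qed
      next
        case False
        then show ?thesis
          unfolding act(1) e_def[symmetric] pcoef_diff[OF t] 1 2 by (simp add: a_minus_def)
      qed
    qed
    with c show ?case by blast
  qed
  then show ?thesis by blast
qed

lemma pcoef_act:
  assumes r: "r \<in> homog R b" and c: "c \<in> tch 0 d"
  shows "\<forall>\<^sub>F m in sequentially. pcoef (b + d) i j m (tensor_act U b r c) = r \<otimes> pcoef d i j m c"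
  using c
proof (induction rule: tchains_induct)
  case zero
  have "tensor_act U b r (0 :: ('x, 'y) tensor_frag) = 0" by (simp add: tensor_act_def)
  then show ?case using homog_carrier[OF r] by (simp add: pcoef_zero)
next
  case (diff c c')
  from diff.IH show ?case
  proof eventually_elim
    case (elim m)
    have "r \<in> carrier R" "pcoef d i j m c \<in> carrier R" "pcoef d i j m c' \<in> carrier R"
      using homog_carrier[OF r] diff.hyps by (simp_all add: pcoef_carrier)
    then show ?case
      unfolding tensor_act_diff pcoef_diff[OF diff.hyps]
        pcoef_diff[OF tensor_act_chains[OF r diff.hyps(1)] tensor_act_chains[OF r diff.hyps(2)]] elim by algebra
  qed
next
  case (gen p a x y)
  have rx: "cact U p b a r x \<in> carrier (cpart U p (b + a))" by (rule act_closed[OF C_module r gen(1)])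
  have 1: "pcoef (b + d) i j m (frag_of (p, b + a, cact U p b a r x, y)) =
      (if p = 0 then coefX (b + a) (cact U p b a r x) i m \<otimes> coefY (d - a) y j m else \<zero>)" for m
    using pcoef_frag_of[OF rx, of y "b + d" m] gen(2) by simp
  show ?case
  proof (cases "p = 0")
    case True
    have x: "x \<in> carrier (cpart U 0 a)" and y: "y \<in> carrier (cpart Y 0 (d - a))" using gen True by simp_all
    from U.coef_act[OF r x i] show ?thesis
    proof eventually_elim
      case (elim m)
      have k: "coefX a x i m \<in> carrier R" "coefY (d - a) y j m \<in> carrier R" "r \<in> carrier R"
        by (rule homog_carrier U.coef_homog[OF x i] Y.coef_homog[OF y j] r)+
      show ?case
        unfolding tensor_act_frag_of 1 pcoef_frag_of[OF gen] using elim k True by (simp add: m_assoc)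
    qed
  next
    case False
    then show ?thesis
      unfolding tensor_act_frag_of 1 pcoef_frag_of[OF gen] using homog_carrier[OF r] by simp
  qed
qed

lemma pcoef_class_tclass:
  assumes c: "c \<in> tch 0 d"
  shows "\<forall>\<^sub>F m in sequentially. pcoef_class d (tclass 0 d c) (i, j) m = pcoef d i j m c"
proof -
  define c' where "c' = (SOME c'. c' \<in> tch 0 d \<and> tclass 0 d c = tclass 0 d c')"
  have c': "c' \<in> tch 0 d" "tclass 0 d c = tclass 0 d c'"
    using someI[of "\<lambda>c'. c' \<in> tch 0 d \<and> tclass 0 d c = tclass 0 d c'" c] c by (auto simp: c'_def)
  have "c' - c \<in> rels 0 d" using c' tclass_eq_iff[OF c'(1) c] by simp
  from pcoef_rels[OF this] show ?thesis
  proof eventually_elim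
    case (elim m)
    have "pcoef d i j m c' \<ominus> pcoef d i j m c = \<zero>" using elim pcoef_diff[OF c'(1) c] by simp
    then have "pcoef d i j m c' = pcoef d i j m c"
      using pcoef_carrier[OF c] pcoef_carrier[OF c'(1)] by (simp add: r_right_minus_eq)
    then show ?case by (simp add: pcoef_class_def c'_def)
  qed
qed

end

lemma tensor_concentrated:
  assumes n: "n \<noteq> 0" and c: "c \<in> tch n d" shows "c \<in> rels n d"
  using c
proof (induction rule: tchains_induct)
  case zero
  show ?case by (rule rels_zero)
next
  case (diff c c')
  show ?case using diff.IH by (rule rels_diff)
next
  case (gen p a x y)
  show ?case
  proof (cases "p = 0")
    case True
    then have "y = \<one>\<^bsub>cpart Y (n - p) (d - a)\<^esub>" using Y.concentrated[of "n - p"] gen(2) n by auto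
    then show ?thesis using rels_unit_right[OF gen(1)] by simp
  next
    case False
    then have "x = \<one>\<^bsub>cpart U p a\<^esub>" using U.concentrated gen(1) by auto
    then show ?thesis using rels_unit_left[OF gen(2)] by simp
  qed
qed

text \<open>
  The symbol that represents \<open>k * (genX i \<otimes> genY j)\<close>. Its internal degree is left in the unsimplified
  form in which \<open>tensor_act\<close> produces it.
\<close>
definition pterm where
  "pterm d m ij k = frag_of (0 :: int, d + (DX (fst ij) m + DY (snd ij) m) + - DX (fst ij) m,
      cact U 0 (d + (DX (fst ij) m + DY (snd ij) m)) (- DX (fst ij) m) k (genX (fst ij) m), genY (snd ij) m)"

lemma genY_closed':
  assumes "j \<in> J"
  shows "genY j m \<in> carrier (cpart Y (0 - 0) (d - (d + (e + DY j m) + - e)))"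
proof -
  have "d - (d + (e + DY j m) + - e) = - DY j m" by simp
  then show ?thesis using Y.gen_closed[OF assms] by simp
qed

lemma pterm_chains:
  assumes ij: "ij \<in> I \<times> J" and k: "k \<in> homog R (d + (DX (fst ij) m + DY (snd ij) m))"
  shows "pterm d m ij k \<in> tch 0 d"
proof -
  have i: "fst ij \<in> I" and j: "snd ij \<in> J" using ij by auto
  show ?thesis
    unfolding pterm_def tchains_frag_of
    by (rule conjI[OF act_closed[OF C_module k U.gen_closed[OF i]] genY_closed'[OF j]])
qed

lemma pterm_minus:
  assumes ij: "ij \<in> I \<times> J" and k: "k \<in> homog R (d + (DX (fst ij) m + DY (snd ij) m))"
    and k': "k' \<in> homog R (d + (DX (fst ij) m + DY (snd ij) m))"
  shows "pterm d m ij (k \<ominus> k') - (pterm d m ij k - pterm d m ij k') \<in> rels 0 d"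
proof -
  have i: "fst ij \<in> I" and j: "snd ij \<in> J" using ij by auto
  note g = U.gen_closed[OF i, of m]
  show ?thesis
    unfolding pterm_def act_minus_scalar[OF C_module k k' g]
    by (rule rels_left_inv[OF act_closed[OF C_module k g] act_closed[OF C_module k' g] genY_closed'[OF j]])
qed

lemma pterm_zero:
  assumes ij: "ij \<in> I \<times> J" shows "pterm d m ij \<zero> \<in> rels 0 d"
proof -
  have i: "fst ij \<in> I" and j: "snd ij \<in> J" using ij by auto
  show ?thesis
    unfolding pterm_def act_zero_scalar[OF C_module U.gen_closed[OF i]]
    by (rule rels_unit_left[OF genY_closed'[OF j]])
qed

text \<open>
  For \<open>x \<otimes> y\<close> the two expansions are multiplied out, and the coefficient of \<open>y\<close> is moved across the
  tensor sign.
\<close>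
lemma pcoef_expansion:
  assumes "c \<in> tch 0 d"
  shows "\<forall>\<^sub>F m in sequentially. c - (\<Sum>ij\<in>I \<times> J. pterm d m ij (pcoef d (fst ij) (snd ij) m c)) \<in> rels 0 d"
  using assms
proof (induction rule: tchains_induct)
  case zero
  have "(\<Sum>ij\<in>I \<times> J. pterm d m ij (pcoef d (fst ij) (snd ij) m 0)) \<in> rels 0 d" for m
    by (rule rels_sum) (auto simp: pcoef_zero pterm_zero)
  then show ?case using rels_uminus by simp
next
  case (diff c c')
  from diff.IH show ?case
  proof eventually_elim
    case (elim m)
    have "(\<Sum>ij\<in>I \<times> J. pterm d m ij (pcoef d (fst ij) (snd ij) m (c - c')) -
        (pterm d m ij (pcoef d (fst ij) (snd ij) m c) - pterm d m ij (pcoef d (fst ij) (snd ij) m c'))) \<in> rels 0 d"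
    proof (rule rels_sum)
      fix ij assume ij: "ij \<in> I \<times> J"
      then have i: "fst ij \<in> I" and j: "snd ij \<in> J" by auto
      show "pterm d m ij (pcoef d (fst ij) (snd ij) m (c - c')) -
        (pterm d m ij (pcoef d (fst ij) (snd ij) m c) - pterm d m ij (pcoef d (fst ij) (snd ij) m c')) \<in> rels 0 d"
        unfolding pcoef_diff[OF i j diff.hyps]
        by (rule pterm_minus[OF ij pcoef_closed[OF i j diff.hyps(1)] pcoef_closed[OF i j diff.hyps(2)]])
    qed
    from rels_diff[OF rels_diff[OF elim] this] show ?case by (simp add: sum_subtractf sum.distrib algebra_simps)
  qed
next
  case (gen p a x y)
  show ?case
  proof (cases "p = 0")
    case False
    then have "x = \<one>\<^bsub>cpart U p a\<^esub>" using U.concentrated gen(1) by auto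
    then have 1: "frag_of (p, a, x, y) \<in> rels 0 d" using rels_unit_left[OF gen(2)] by simp
    have "(\<Sum>ij\<in>I \<times> J. pterm d m ij (pcoef d (fst ij) (snd ij) m (frag_of (p, a, x, y)))) \<in> rels 0 d" for m
      using gen False by (intro rels_sum) (auto simp: pcoef_frag_of pterm_zero)
    from rels_diff[OF 1 this] show ?thesis by simp
  next
    case True
    have x: "x \<in> carrier (cpart U 0 a)" and y: "y \<in> carrier (cpart Y 0 (d - a))" using gen True by simp_all
    from U.expansion[OF x] Y.expansion[OF y] show ?thesis
    proof eventually_elim
      case (elim m)
      let ?k = "\<lambda>i. coefX a x i m" and ?l = "\<lambda>j. coefY (d - a) y j m"
      let ?u = "\<lambda>i. cact U 0 (a + DX i m) (- DX i m) (?k i) (genX i m)"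
      let ?v = "\<lambda>j. cact Y 0 (d - a + DY j m) (- DY j m) (?l j) (genY j m)"
      have u: "?u i \<in> carrier (cpart U 0 a)" if "i \<in> I" for i
        using act_closed[OF C_module U.coef_homog[OF x that, of m] U.gen_closed[OF that, of m]] by simp
      have v: "?v j \<in> carrier (cpart Y 0 (d - a))" if "j \<in> J" for j
        using act_closed[OF D_module Y.coef_homog[OF y that, of m] Y.gen_closed[OF that, of m]] by simp
      have y': "y \<in> carrier (cpart Y (0 - 0) (d - a))" using y by simp
      have 1: "frag_of (0, a, x, y) - (\<Sum>i\<in>I. frag_of (0, a, ?u i, y)) \<in> rels 0 d"
        using rels_finprod_left[OF y', of I ?u] u U.finite_I elim(1) by simp
      have 2: "(\<Sum>i\<in>I. frag_of (0, a, ?u i, y) - (\<Sum>j\<in>J. frag_of (0, a, ?u i, ?v j))) \<in> rels 0 d"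
      proof (rule rels_sum)
        fix i assume i: "i \<in> I"
        show "frag_of (0, a, ?u i, y) - (\<Sum>j\<in>J. frag_of (0, a, ?u i, ?v j)) \<in> rels 0 d"
          using rels_finprod_right[OF u[OF i], of J ?v 0 d] v Y.finite_I elim(2) by simp
      qed
      have 3: "(\<Sum>ij\<in>I \<times> J. pterm d m ij (pcoef d (fst ij) (snd ij) m (frag_of (p, a, x, y))) - frag_of (0, a, ?u (fst ij), ?v (snd ij))) \<in> rels 0 d"
      proof (rule rels_sum)
        fix ij assume ij: "ij \<in> I \<times> J"
        define i j where "i = fst ij" and "j = snd ij"
        have i: "i \<in> I" and j: "j \<in> J" using ij by (auto simp: i_def j_def)
        note kh = U.coef_homog[OF x i, of m] and lh = Y.coef_homog[OF y j, of m]
        have "genY j m \<in> carrier (cpart Y (0 - 0) (- DY j m))" using Y.gen_closed[OF j] by simp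
        then have r: "frag_of (0, d + (DX i m + DY j m) + - DX i m, cact U 0 (d - a + DY j m) a (?l j) (?u i), genY j m)
            - frag_of (0, a, ?u i, cact Y (0 - 0) (d - a + DY j m) (- DY j m) (?l j) (genY j m)) \<in> rels 0 d"
          by (rule rels_act[OF lh u[OF i]]) linarith+
        have e: "d - a + DY j m + (a + DX i m) = d + (DX i m + DY j m)" "a + DX i m + - DX i m = a" by simp_all
        have "cact U 0 (d - a + DY j m) a (?l j) (?u i) = cact U 0 (d + (DX i m + DY j m)) (- DX i m) (?l j \<otimes> ?k i) (genX i m)"
          using act_act[OF C_module lh kh U.gen_closed[OF i, of m]] unfolding e .
        moreover have "?l j \<otimes> ?k i = pcoef d i j m (frag_of (p, a, x, y))"
          unfolding pcoef_frag_of[OF i j gen] using True homog_carrier[OF kh] homog_carrier[OF lh] by (simp add: m_comm)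
        ultimately show "pterm d m ij (pcoef d (fst ij) (snd ij) m (frag_of (p, a, x, y))) - frag_of (0, a, ?u (fst ij), ?v (snd ij)) \<in> rels 0 d"
          using r unfolding pterm_def i_def[symmetric] j_def[symmetric] diff_self by simp
      qed
      have "(\<Sum>i\<in>I. \<Sum>j\<in>J. frag_of (0, a, ?u i, ?v j)) = (\<Sum>ij\<in>I \<times> J. frag_of (0, a, ?u (fst ij), ?v (snd ij)))"
        by (simp add: sum.cartesian_product case_prod_unfold)
      note 4 = this
      have "frag_of (0, a, x, y) - (\<Sum>i\<in>I. \<Sum>j\<in>J. frag_of (0, a, ?u i, ?v j)) -
          ((\<Sum>ij\<in>I \<times> J. pterm d m ij (pcoef d (fst ij) (snd ij) m (frag_of (p, a, x, y))))
            - (\<Sum>ij\<in>I \<times> J. frag_of (0, a, ?u (fst ij), ?v (snd ij)))) \<in> rels 0 d"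
        using rels_diff[OF rels_add[OF 1 2] 3] by (simp add: sum_subtractf)
      then show ?case unfolding 4 True by (simp add: algebra_simps)
    qed
  qed
qed

lemma pcoef_class_rep:
  assumes "K \<in> carrier (cpart TC 0 d)"
  obtains c where "c \<in> tch 0 d" "K = tclass 0 d c" "\<And>ij m. pcoef_class d K ij m = pcoef d (fst ij) (snd ij) m c"
proof -
  define c where "c = (SOME c. c \<in> tch 0 d \<and> K = tclass 0 d c)"
  have "c \<in> tch 0 d \<and> K = tclass 0 d c"
    unfolding c_def by (rule someI_ex) (use assms in \<open>auto simp: carrier_tensor\<close>)
  moreover have "pcoef_class d K ij m = pcoef d (fst ij) (snd ij) m c" for ij m
    unfolding pcoef_class_def c_def ..
  ultimately show thesis using that by blast
qed

lemma tensor_flat_system: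
  "flat_system R TC (I \<times> J) (\<lambda>ij m. DX (fst ij) m + DY (snd ij) m) pcoef_class pgen"
proof unfold_locales
  show "is_complex R TC" by (rule is_complex_tensor)
  show "carrier (cpart TC p d) = {\<one>\<^bsub>cpart TC p d\<^esub>}" if "p \<noteq> 0" for p d
  proof -
    have "tclass p d c = \<one>\<^bsub>cpart TC p d\<^esub>" if "c \<in> tch p d" for c
      using tclass_eq_one_iff[OF that] tensor_concentrated[OF \<open>p \<noteq> 0\<close> that] by simp
    then show ?thesis unfolding carrier_tensor using tchains_zero by blast
  qed
  show "finite (I \<times> J)" using U.finite_I Y.finite_I by simp
  fix ij :: "'i \<times> 'j" and m d assume "ij \<in> I \<times> J"
  then obtain i j where ij: "ij = (i, j)" and i: "i \<in> I" and j: "j \<in> J" by blast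
  show "pgen ij m \<in> carrier (cpart TC 0 (- (DX (fst ij) m + DY (snd ij) m)))"
    unfolding pgen_def ij fst_conv snd_conv
    by (rule tclass_closed) (simp add: tchains_frag_of U.gen_closed[OF i] Y.gen_closed[OF j])
  show "pcoef_class d K ij m \<in> homog R (d + (DX (fst ij) m + DY (snd ij) m))" if "K \<in> carrier (cpart TC 0 d)" for K
  proof -
    obtain c where "c \<in> tch 0 d" "\<And>ij m. pcoef_class d K ij m = pcoef d (fst ij) (snd ij) m c"
      using pcoef_class_rep[OF \<open>K \<in> _\<close>] by metis
    then show ?thesis using pcoef_closed[OF i j] by (simp add: ij)
  qed
  show "\<forall>\<^sub>F m in sequentially. pcoef_class d (K \<otimes>\<^bsub>cpart TC 0 d\<^esub> L) ij m = pcoef_class d K ij m \<oplus> pcoef_class d L ij m"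
    if K: "K \<in> carrier (cpart TC 0 d)" and L: "L \<in> carrier (cpart TC 0 d)" for K L
  proof -
    obtain c where c: "c \<in> tch 0 d" "K = tclass 0 d c" "\<And>ij m. pcoef_class d K ij m = pcoef d (fst ij) (snd ij) m c"
      using pcoef_class_rep[OF K] by metis
    obtain c' where c': "c' \<in> tch 0 d" "L = tclass 0 d c'" "\<And>ij m. pcoef_class d L ij m = pcoef d (fst ij) (snd ij) m c'"
      using pcoef_class_rep[OF L] by metis
    have "K \<otimes>\<^bsub>cpart TC 0 d\<^esub> L = tclass 0 d (c + c')" using mult_tensor[OF c(1) c'(1)] c(2) c'(2) by simp
    then show ?thesis
      using pcoef_class_tclass[OF i j tchains_add[OF c(1) c'(1)]] pcoef_add[OF i j c(1) c'(1)] by (simp add: ij c(3) c'(3))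
  qed
  show "\<forall>\<^sub>F m in sequentially. pcoef_class (b + d) (cact TC 0 b d r K) ij m = r \<otimes> pcoef_class d K ij m"
    if r: "r \<in> homog R b" and K: "K \<in> carrier (cpart TC 0 d)" for b r K
  proof -
    obtain c where c: "c \<in> tch 0 d" "K = tclass 0 d c" "\<And>ij m. pcoef_class d K ij m = pcoef d (fst ij) (snd ij) m c"
      using pcoef_class_rep[OF K] by metis
    have "cact TC 0 b d r K = tclass 0 (b + d) (tensor_act U b r c)" using act_tensor[OF r c(1)] c(2) by simp
    with pcoef_class_tclass[OF i j tensor_act_chains[OF r c(1)]] pcoef_act[OF i j r c(1)]
    show ?thesis
      by (auto simp: ij c(3) elim: eventually_elim2)
  qed
next
  fix d K assume K: "K \<in> carrier (cpart TC 0 d)"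
  obtain c where c: "c \<in> tch 0 d" "K = tclass 0 d c" "\<And>ij m. pcoef_class d K ij m = pcoef d (fst ij) (snd ij) m c"
    using pcoef_class_rep[OF K] by metis
  from pcoef_expansion[OF c(1)]
  show "\<forall>\<^sub>F m in sequentially. K = finprod (cpart TC 0 d)
      (\<lambda>ij. cact TC 0 (d + (DX (fst ij) m + DY (snd ij) m)) (- (DX (fst ij) m + DY (snd ij) m)) (pcoef_class d K ij m) (pgen ij m)) (I \<times> J)"
  proof eventually_elim
    case (elim m)
    interpret T: comm_group "cpart TC 0 d" by (rule complex_group[OF is_complex_tensor])
    let ?p = "\<lambda>ij. pterm d m ij (pcoef d (fst ij) (snd ij) m c)"
    have p: "?p ij \<in> tch 0 d" if "ij \<in> I \<times> J" for ij
      by (rule pterm_chains[OF that]) (use that pcoef_closed[OF _ _ c(1)] in auto)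
    have s: "(\<Sum>ij\<in>I \<times> J. ?p ij) \<in> tch 0 d" using p by (rule tchains_sum)
    have fin: "finite (I \<times> J)" using U.finite_I Y.finite_I by simp
    have "K = tclass 0 d (\<Sum>ij\<in>I \<times> J. ?p ij)"
      unfolding c(2) using elim tclass_eq_iff[OF c(1) s] by simp
    also have "\<dots> = finprod (cpart TC 0 d) (\<lambda>ij. tclass 0 d (?p ij)) (I \<times> J)"
      using finprod_tclass[OF p fin] by simp
    also have "\<dots> = finprod (cpart TC 0 d)
      (\<lambda>ij. cact TC 0 (d + (DX (fst ij) m + DY (snd ij) m)) (- (DX (fst ij) m + DY (snd ij) m)) (pcoef_class d K ij m) (pgen ij m)) (I \<times> J)"
    proof -
      let ?g = "\<lambda>ij. cact TC 0 (d + (DX (fst ij) m + DY (snd ij) m)) (- (DX (fst ij) m + DY (snd ij) m)) (pcoef_class d K ij m) (pgen ij m)"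
      have eq: "tclass 0 d (?p ij) = ?g ij" if ij: "ij \<in> I \<times> J" for ij
      proof -
      have i: "fst ij \<in> I" and j: "snd ij \<in> J" using ij by auto
      let ?D = "DX (fst ij) m + DY (snd ij) m"
      have f: "frag_of (0, - DX (fst ij) m, genX (fst ij) m, genY (snd ij) m) \<in> tch 0 (- ?D)"
        by (simp add: tchains_frag_of U.gen_closed[OF i] Y.gen_closed[OF j])
      have e: "d + ?D + - ?D = d" by simp
      show ?thesis
        unfolding pgen_def c(3) act_tensor[OF pcoef_closed[OF i j c(1)] f] tensor_act_frag_of e pterm_def ..
      qed
      show ?thesis
        by (rule T.finprod_cong'[OF refl]) (use eq tclass_closed[OF p] in auto)
    qed
    finally show ?case .
  qed
qed

end


section \<open>Modules as complexes\<close>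

definition degree_zero_complex :: "('l, 'v) graded_module \<Rightarrow> ('l, 'v) cochain_complex" where
  "degree_zero_complex M =
     \<lparr>term_at = (\<lambda>p. if p = 0 then M else term_at zero_complex p),
      diff = (\<lambda>p d x. \<one>\<^bsub>part (if p + 1 = 0 then M else term_at zero_complex (p + 1)) d\<^esub>)\<rparr>"

lemma term_at_degree_zero: "term_at (degree_zero_complex M) p = (if p = 0 then M else term_at zero_complex p)"
  by (simp add: degree_zero_complex_def)

lemma degree_zero_complex:
  fixes M :: "('l, 'v) graded_module"
  assumes M: "is_graded_module R M" shows "is_complex R (degree_zero_complex M)"
proof -
  have mod: "is_graded_module R (term_at (degree_zero_complex M) p)" for p
    using M complex_module[OF is_complex_zero[where 'b = 'v], of R p] by (simp add: term_at_degree_zero)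
  have d: "diff (degree_zero_complex M) p d x = \<one>\<^bsub>cpart (degree_zero_complex M) (p + 1) d\<^esub>" for p d x
    by (simp add: degree_zero_complex_def)
  have 1: "diff (degree_zero_complex M) p d \<in> hom (cpart (degree_zero_complex M) p d) (cpart (degree_zero_complex M) (p + 1) d)" for p d
  proof (rule homI)
    interpret comm_group "cpart (degree_zero_complex M) (p + 1) d" by (rule part_comm_group[OF mod])
    show "diff (degree_zero_complex M) p d x \<in> carrier (cpart (degree_zero_complex M) (p + 1) d)" for x
      unfolding d by simp
    show "diff (degree_zero_complex M) p d (x \<otimes>\<^bsub>cpart (degree_zero_complex M) p d\<^esub> y) =
        diff (degree_zero_complex M) p d x \<otimes>\<^bsub>cpart (degree_zero_complex M) (p + 1) d\<^esub> diff (degree_zero_complex M) p d y" for x y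
      unfolding d by simp
  qed
  have 2: "is_graded_hom R (term_at (degree_zero_complex M) p) (term_at (degree_zero_complex M) (p + 1)) (diff (degree_zero_complex M) p)" for p
    using 1 by (simp add: is_graded_hom_def d act_unit[OF mod])
  have "p + 1 + 1 = p + 2" for p :: int by simp
  then show ?thesis
    unfolding is_complex_def using mod 2 by (simp only: d) simp
qed


section \<open>The telescopes\<close>

text \<open>
  All that the argument needs to know about the ring: \<open>N\<close> sequences of homogeneous elements of square
  zero.
\<close>
locale nilpotent_telescopes = graded_cring R for R :: "'l graded_ring" (structure) +
  fixes N :: nat and a :: "nat \<Rightarrow> nat \<Rightarrow> 'l" and \<delta> :: "nat \<Rightarrow> nat \<Rightarrow> int"
  assumes a_homog: "a j m \<in> homog R (\<delta> j m)"
    and a_square: "a j m \<otimes> a j m = \<zero>"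
begin

text \<open>
  For \<open>m \<le> m'\<close> this is \<open>a j m * \<cdots> * a j (m' - 1)\<close>, the transition from stage \<open>m\<close> to stage \<open>m'\<close> of the
  telescope \<open>j\<close>. Its degree is the difference of the degrees \<open>\<Delta>\<close> of the stages.
\<close>
primrec transition :: "nat \<Rightarrow> nat \<Rightarrow> nat \<Rightarrow> 'l" where
  "transition j m 0 = \<one>"
| "transition j m (Suc m') = (if m \<le> m' then a j m' \<otimes> transition j m m' else \<one>)"

definition \<Delta> :: "nat \<Rightarrow> nat \<Rightarrow> int" where "\<Delta> j m = (\<Sum>t<m. \<delta> j t)"

lemma \<Delta>_Suc: "\<Delta> j (Suc m) = \<delta> j m + \<Delta> j m"
  by (simp add: \<Delta>_def)

lemma a_carrier: "a j m \<in> carrier R"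
  by (rule homog_carrier[OF a_homog])

lemma transition_self: "transition j m m = \<one>"
  by (cases m) simp_all

lemma transition_homog: "m \<le> m' \<Longrightarrow> transition j m m' \<in> homog R (\<Delta> j m' - \<Delta> j m)"
proof (induction m' rule: dec_induct)
  case base
  then show ?case by (simp add: transition_self homog_one)
next
  case (step m')
  then show ?case using homog_mult[OF a_homog step.IH, of j m'] by (simp add: \<Delta>_Suc algebra_simps)
qed

lemma transition_carrier: "transition j m m' \<in> carrier R"
  by (induction m') (simp_all add: a_carrier)

text \<open>
  A sequential colimit consists of the sequences that eventually follow the transition maps, modulo
  those that eventually vanish. This describes it without a quotient of a disjoint union of stages,
  and the sequence itself supplies the coordinates of a flat system. The first index runs over the
  \<open>N\<close> telescopes, whose direct sum is formed at the same time.
\<close>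
definition seqs :: "int \<Rightarrow> (nat \<Rightarrow> nat \<Rightarrow> 'l) monoid" where
  "seqs d = \<lparr>carrier = {s. (\<forall>j m. s j m \<in> homog R (d + \<Delta> j m)) \<and> (\<forall>j\<ge>N. \<forall>m. s j m = \<zero>) \<and>
       (\<forall>j. \<forall>\<^sub>F m in sequentially. s j (Suc m) = a j m \<otimes> s j m)},
     monoid.mult = (\<lambda>s t j m. s j m \<oplus> t j m), one = (\<lambda>j m. \<zero>)\<rparr>"

definition null_seqs :: "int \<Rightarrow> (nat \<Rightarrow> nat \<Rightarrow> 'l) set" where
  "null_seqs d = {s \<in> carrier (seqs d). \<forall>j. \<forall>\<^sub>F m in sequentially. s j m = \<zero>}"

definition seq_act :: "int \<Rightarrow> int \<Rightarrow> 'l \<Rightarrow> (nat \<Rightarrow> nat \<Rightarrow> 'l) \<Rightarrow> (nat \<Rightarrow> nat \<Rightarrow> 'l)" where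
  "seq_act b d r s = (\<lambda>j m. r \<otimes> s j m)"

definition telescope :: "('l, (nat \<Rightarrow> nat \<Rightarrow> 'l) set) graded_module" where
  "telescope = \<lparr>part = \<lambda>d. seqs d Mod null_seqs d,
     act = \<lambda>b d r. coset_map (seqs (b + d)) (null_seqs (b + d)) (seq_act b d r)\<rparr>"

lemma seqs_simps:
  "s \<in> carrier (seqs d) \<longleftrightarrow> (\<forall>j m. s j m \<in> homog R (d + \<Delta> j m)) \<and> (\<forall>j\<ge>N. \<forall>m. s j m = \<zero>) \<and>
       (\<forall>j. \<forall>\<^sub>F m in sequentially. s j (Suc m) = a j m \<otimes> s j m)"
  "s \<otimes>\<^bsub>seqs d\<^esub> t = (\<lambda>j m. s j m \<oplus> t j m)"
  "\<one>\<^bsub>seqs d\<^esub> = (\<lambda>j m. \<zero>)"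
  by (simp_all add: seqs_def)

lemma seqs_homog: "s \<in> carrier (seqs d) \<Longrightarrow> s j m \<in> homog R (d + \<Delta> j m)"
  by (simp add: seqs_simps)

lemma seqs_carrier: "s \<in> carrier (seqs d) \<Longrightarrow> s j m \<in> carrier R"
  by (rule homog_carrier[OF seqs_homog])

lemma seqs_comm_group: "comm_group (seqs d)"
proof (rule comm_groupI)
  fix s t assume s: "s \<in> carrier (seqs d)" and t: "t \<in> carrier (seqs d)"
  have "\<forall>\<^sub>F m in sequentially. s j (Suc m) \<oplus> t j (Suc m) = a j m \<otimes> (s j m \<oplus> t j m)" for j
  proof -
    have "\<forall>\<^sub>F m in sequentially. s j (Suc m) = a j m \<otimes> s j m" "\<forall>\<^sub>F m in sequentially. t j (Suc m) = a j m \<otimes> t j m"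
      using s t by (auto simp: seqs_simps)
    then show ?thesis
      by eventually_elim (simp add: r_distr a_carrier seqs_carrier[OF s] seqs_carrier[OF t])
  qed
  then show "s \<otimes>\<^bsub>seqs d\<^esub> t \<in> carrier (seqs d)"
    using s t by (simp add: seqs_simps homog_add)
next
  fix s assume s: "s \<in> carrier (seqs d)"
  have "\<forall>\<^sub>F m in sequentially. \<ominus> s j (Suc m) = a j m \<otimes> \<ominus> s j m" for j
  proof -
    have "\<forall>\<^sub>F m in sequentially. s j (Suc m) = a j m \<otimes> s j m" using s by (auto simp: seqs_simps)
    then show ?thesis by eventually_elim (simp add: r_minus a_carrier seqs_carrier[OF s])
  qed
  then have "(\<lambda>j m. \<ominus> s j m) \<in> carrier (seqs d)"
    using s by (simp add: seqs_simps homog_minus)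
  then show "\<exists>t\<in>carrier (seqs d). t \<otimes>\<^bsub>seqs d\<^esub> s = \<one>\<^bsub>seqs d\<^esub>"
    by (rule bexI[rotated]) (simp add: seqs_simps(2,3) l_neg seqs_carrier[OF s])
next
  show "\<one>\<^bsub>seqs d\<^esub> \<in> carrier (seqs d)" by (simp add: seqs_simps homog_zero a_carrier)
qed (auto simp: seqs_simps(2,3) a_ac seqs_carrier)

lemma seqs_inv: "s \<in> carrier (seqs d) \<Longrightarrow> inv\<^bsub>seqs d\<^esub> s = (\<lambda>j m. \<ominus> s j m)"
proof -
  assume s: "s \<in> carrier (seqs d)"
  interpret comm_group "seqs d" by (rule seqs_comm_group)
  have i: "inv\<^bsub>seqs d\<^esub> s \<in> carrier (seqs d)" using s by simp
  show ?thesis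
  proof (intro ext)
    fix j m
    have "(inv\<^bsub>seqs d\<^esub> s) j m \<oplus> s j m = (inv\<^bsub>seqs d\<^esub> s \<otimes>\<^bsub>seqs d\<^esub> s) j m" by (simp only: seqs_simps(2))
    also have "\<dots> = \<zero>" using s by (simp add: seqs_simps(3))
    finally have "\<ominus> s j m = (inv\<^bsub>seqs d\<^esub> s) j m"
      using seqs_carrier[OF s] seqs_carrier[OF i] by (simp add: minus_equality)
    then show "(inv\<^bsub>seqs d\<^esub> s) j m = \<ominus> s j m" ..
  qed
qed

lemma null_seqs_subgroup: "subgroup (null_seqs d) (seqs d)"
proof -
  interpret comm_group "seqs d" by (rule seqs_comm_group)
  show ?thesis
  proof (rule subgroupI)
    show "null_seqs d \<subseteq> carrier (seqs d)" by (auto simp: null_seqs_def)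
    have "\<one>\<^bsub>seqs d\<^esub> \<in> null_seqs d" by (simp add: null_seqs_def) (simp add: seqs_simps(3))
    then show "null_seqs d \<noteq> {}" by blast
    fix s t assume s: "s \<in> null_seqs d" and t: "t \<in> null_seqs d"
    have "\<forall>\<^sub>F m in sequentially. \<ominus> s j m = \<zero>" for j
    proof -
      have "\<forall>\<^sub>F m in sequentially. s j m = \<zero>" using s by (simp add: null_seqs_def)
      then show ?thesis by eventually_elim simp
    qed
    then show "inv\<^bsub>seqs d\<^esub> s \<in> null_seqs d" using s inv_closed[of s] by (simp add: null_seqs_def seqs_inv)
    have "\<forall>\<^sub>F m in sequentially. s j m \<oplus> t j m = \<zero>" for j
    proof -
      have "\<forall>\<^sub>F m in sequentially. s j m = \<zero>" "\<forall>\<^sub>F m in sequentially. t j m = \<zero>"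
        using s t by (simp_all add: null_seqs_def)
      then show ?thesis by eventually_elim simp
    qed
    then show "s \<otimes>\<^bsub>seqs d\<^esub> t \<in> null_seqs d"
      using s t m_closed[of s t] by (simp add: null_seqs_def) (simp add: seqs_simps(2))
  qed
qed

lemma seq_act_closed:
  assumes r: "r \<in> homog R b" and s: "s \<in> carrier (seqs d)"
  shows "seq_act b d r s \<in> carrier (seqs (b + d))"
proof -
  have "\<forall>\<^sub>F m in sequentially. r \<otimes> s j (Suc m) = a j m \<otimes> (r \<otimes> s j m)" for j
  proof -
    have "\<forall>\<^sub>F m in sequentially. s j (Suc m) = a j m \<otimes> s j m" using s by (auto simp: seqs_simps)
    then show ?thesis
      by eventually_elim (simp add: m_lcomm a_carrier seqs_carrier[OF s] homog_carrier[OF r])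
  qed
  moreover have "r \<otimes> s j m \<in> homog R (b + d + \<Delta> j m)" for j m
    using homog_mult[OF r seqs_homog[OF s]] by (simp add: add.assoc)
  ultimately show ?thesis using s homog_carrier[OF r] by (simp add: seqs_simps seq_act_def)
qed

lemma seq_act_hom: "r \<in> homog R b \<Longrightarrow> seq_act b d r \<in> hom (seqs d) (seqs (b + d))"
proof (rule homI)
  assume r: "r \<in> homog R b"
  show "seq_act b d r s \<in> carrier (seqs (b + d))" if "s \<in> carrier (seqs d)" for s
    by (rule seq_act_closed[OF r that])
  show "seq_act b d r (s \<otimes>\<^bsub>seqs d\<^esub> t) = seq_act b d r s \<otimes>\<^bsub>seqs (b + d)\<^esub> seq_act b d r t"
    if "s \<in> carrier (seqs d)" "t \<in> carrier (seqs d)" for s t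
    by (simp add: seqs_simps(2) seq_act_def r_distr homog_carrier[OF r] seqs_carrier[OF that(1)] seqs_carrier[OF that(2)])
qed

lemma seq_act_null: "r \<in> homog R b \<Longrightarrow> seq_act b d r ` null_seqs d \<subseteq> null_seqs (b + d)"
proof
  fix t assume r: "r \<in> homog R b" and "t \<in> seq_act b d r ` null_seqs d"
  then obtain s where s: "s \<in> null_seqs d" "t = seq_act b d r s" by blast
  have "\<forall>\<^sub>F m in sequentially. r \<otimes> s j m = \<zero>" for j
  proof -
    have "\<forall>\<^sub>F m in sequentially. s j m = \<zero>" using s(1) by (simp add: null_seqs_def)
    then show ?thesis by eventually_elim (simp add: homog_carrier[OF r])
  qed
  then show "t \<in> null_seqs (b + d)"
    using seq_act_closed[OF r, of s d] s by (simp add: null_seqs_def) (simp add: seq_act_def)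
qed

lemma telescope_module: "is_graded_module R telescope"
proof -
  have R: "graded_cring R" ..
  show ?thesis
    unfolding telescope_def
  proof (rule quotient_graded_module[OF seqs_comm_group null_seqs_subgroup seq_act_hom seq_act_null _ _ _ R])
    fix b d r s t assume t: "t \<in> carrier (seqs d)"
    show "null_seqs (b + d) #>\<^bsub>seqs (b + d)\<^esub> seq_act b d (r \<oplus> s) t =
        null_seqs (b + d) #>\<^bsub>seqs (b + d)\<^esub> (seq_act b d r t \<otimes>\<^bsub>seqs (b + d)\<^esub> seq_act b d s t)"
      if "r \<in> homog R b" "s \<in> homog R b"
    proof -
      have "seq_act b d (r \<oplus> s) t = seq_act b d r t \<otimes>\<^bsub>seqs (b + d)\<^esub> seq_act b d s t"
        using that by (simp add: seqs_simps(2) seq_act_def l_distr homog_carrier seqs_carrier[OF t])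
      then show ?thesis by simp
    qed
    show "null_seqs (c + b + d) #>\<^bsub>seqs (c + b + d)\<^esub> seq_act (c + b) d (r \<otimes> s) t =
        null_seqs (c + b + d) #>\<^bsub>seqs (c + b + d)\<^esub> seq_act c (b + d) r (seq_act b d s t)"
      if "r \<in> homog R c" "s \<in> homog R b" for c
    proof -
      have "seq_act (c + b) d (r \<otimes> s) t = seq_act c (b + d) r (seq_act b d s t)"
        using that by (simp add: seq_act_def m_assoc homog_carrier seqs_carrier[OF t])
      then show ?thesis by simp
    qed
    have "seq_act 0 d \<one> t = t" by (simp add: seq_act_def seqs_carrier[OF t])
    then show "null_seqs d #>\<^bsub>seqs d\<^esub> seq_act 0 d \<one> t = null_seqs d #>\<^bsub>seqs d\<^esub> t" by simp
  qed
qed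

definition seq_class where "seq_class d s = null_seqs d #>\<^bsub>seqs d\<^esub> s"

lemma carrier_telescope: "carrier (part telescope d) = seq_class d ` carrier (seqs d)"
  by (simp add: telescope_def carrier_FactGroup seq_class_def[abs_def])

lemma seq_class_eq_iff:
  assumes s: "s \<in> carrier (seqs d)" and t: "t \<in> carrier (seqs d)"
  shows "seq_class d s = seq_class d t \<longleftrightarrow> (\<forall>j. \<forall>\<^sub>F m in sequentially. s j m = t j m)"
proof -
  interpret comm_group "seqs d" by (rule seqs_comm_group)
  have "s \<otimes>\<^bsub>seqs d\<^esub> inv\<^bsub>seqs d\<^esub> t = (\<lambda>j m. s j m \<ominus> t j m)"
    by (simp add: seqs_inv[OF t] seqs_simps(2) a_minus_def)
  moreover have "s j m \<ominus> t j m = \<zero> \<longleftrightarrow> s j m = t j m" for j m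
    using seqs_carrier[OF s] seqs_carrier[OF t] by simp
  ultimately have "s \<otimes>\<^bsub>seqs d\<^esub> inv\<^bsub>seqs d\<^esub> t \<in> null_seqs d \<longleftrightarrow> (\<forall>j. \<forall>\<^sub>F m in sequentially. s j m = t j m)"
    using m_closed[OF s inv_closed[OF t]] by (simp add: null_seqs_def)
  then show ?thesis unfolding seq_class_def rcos_eq_iff[OF null_seqs_subgroup s t] .
qed

lemma seq_class_mult:
  "s \<in> carrier (seqs d) \<Longrightarrow> t \<in> carrier (seqs d) \<Longrightarrow>
    seq_class d s \<otimes>\<^bsub>part telescope d\<^esub> seq_class d t = seq_class d (\<lambda>j m. s j m \<oplus> t j m)"
  using comm_group.rcos_mult[OF seqs_comm_group null_seqs_subgroup, of s d t]
  by (simp add: telescope_def seq_class_def seqs_simps(2))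

lemma seq_class_one: "\<one>\<^bsub>part telescope d\<^esub> = seq_class d (\<lambda>j m. \<zero>)"
proof -
  interpret comm_group "seqs d" by (rule seqs_comm_group)
  have "seq_class d \<one>\<^bsub>seqs d\<^esub> = null_seqs d"
    unfolding seq_class_def using rcos_eq_self_iff[OF null_seqs_subgroup one_closed] subgroup.one_closed[OF null_seqs_subgroup] by simp
  then show ?thesis by (simp add: telescope_def seqs_simps(3))
qed

lemma seq_class_act:
  assumes "r \<in> homog R b" "s \<in> carrier (seqs d)"
  shows "act telescope b d r (seq_class d s) = seq_class (b + d) (seq_act b d r s)"
  using coset_map_rcos[OF seqs_comm_group seqs_comm_group null_seqs_subgroup null_seqs_subgroup
      seq_act_hom[OF assms(1)] seq_act_null[OF assms(1)] assms(2)]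
  by (simp add: telescope_def seq_class_def)

abbreviation "tel \<equiv> degree_zero_complex telescope"

lemma cpart_tel: "cpart tel 0 d = part telescope d" "cact tel 0 = act telescope"
  by (simp_all add: term_at_degree_zero)

text \<open>
  The values of some representing sequence; only its behaviour for large \<open>m\<close> depends on \<open>K\<close> alone.
\<close>
definition tel_coef where
  "tel_coef d K j m = (SOME s. s \<in> carrier (seqs d) \<and> K = seq_class d s) j m"

text \<open>
  The sequence that represents the element \<open>l j\<close> of stage \<open>m\<close> of the telescope \<open>j\<close>, for all \<open>j \<in> J\<close> at
  once.
\<close>
definition tail :: "nat set \<Rightarrow> nat \<Rightarrow> (nat \<Rightarrow> 'l) \<Rightarrow> nat \<Rightarrow> nat \<Rightarrow> 'l" where
  "tail J m l = (\<lambda>j m'. if j \<in> J \<and> m \<le> m' then transition j m m' \<otimes> l j else \<zero>)"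

definition tel_gen where
  "tel_gen j m = seq_class (- \<Delta> j m) (tail {j} m (\<lambda>_. \<one>))"

lemma tail_closed:
  assumes J: "J \<subseteq> {..<N}" and l: "\<And>j. j \<in> J \<Longrightarrow> l j \<in> homog R (d + \<Delta> j m)"
  shows "tail J m l \<in> carrier (seqs d)"
proof -
  have "tail J m l j m' \<in> homog R (d + \<Delta> j m')" for j m'
  proof (cases "j \<in> J \<and> m \<le> m'")
    case True
    then have "transition j m m' \<otimes> l j \<in> homog R (\<Delta> j m' - \<Delta> j m + (d + \<Delta> j m))"
      by (intro homog_mult transition_homog l) auto
    then show ?thesis using True by (simp add: tail_def algebra_simps)
  qed (auto simp: tail_def homog_zero)
  moreover have "\<forall>\<^sub>F m' in sequentially. tail J m l j (Suc m') = a j m' \<otimes> tail J m l j m'" for j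
    using eventually_ge_at_top[of m]
  proof eventually_elim
    case (elim m')
    show ?case
    proof (cases "j \<in> J")
      case True
      then show ?thesis using elim homog_carrier[OF l[OF True]] by (simp add: tail_def m_assoc a_carrier transition_carrier)
    qed (simp add: tail_def a_carrier)
  qed
  ultimately show ?thesis using J by (auto simp: seqs_simps tail_def)
qed

text \<open>
  From the stage on at which a sequence follows the transition maps of the finitely many telescopes, it
  is determined by its values at that stage, up to a sequence that eventually vanishes.
\<close>
lemma seqs_stable:
  assumes s: "s \<in> carrier (seqs d)"
  shows "\<forall>\<^sub>F m in sequentially. seq_class d s = seq_class d (tail {..<N} m (\<lambda>j. s j m))"
proof -
  have "\<forall>\<^sub>F m in sequentially. \<forall>j\<in>{..<N}. \<forall>m'\<ge>m. s j (Suc m') = a j m' \<otimes> s j m'"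
    using s by (subst eventually_ball_finite_distrib) (auto simp: seqs_simps eventually_all_ge_at_top)
  then show ?thesis
  proof eventually_elim
    case (elim m)
    have step: "s j m' = transition j m m' \<otimes> s j m" if j: "j < N" and m: "m \<le> m'" for j m'
      using m
    proof (induction m' rule: dec_induct)
      case base
      then show ?case by (simp add: transition_self seqs_carrier[OF s])
    next
      case (step m')
      then have "s j (Suc m') = a j m' \<otimes> (transition j m m' \<otimes> s j m)" using elim j by auto
      then show ?case using step.hyps by (simp add: m_assoc a_carrier transition_carrier seqs_carrier[OF s])
    qed
    have t: "tail {..<N} m (\<lambda>j. s j m) \<in> carrier (seqs d)" by (rule tail_closed) (auto simp: seqs_homog[OF s])
    have "\<forall>\<^sub>F m' in sequentially. s j m' = tail {..<N} m (\<lambda>j. s j m) j m'" for j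
      using eventually_ge_at_top[of m]
    proof eventually_elim
      case (elim m')
      show ?case
      proof (cases "j < N")
        case False
        then have "s j m' = \<zero>" using s unfolding seqs_simps(1) by (meson not_less)
        then show ?thesis using False by (simp add: tail_def)
      next
        case True
        have "s j m' = transition j m m' \<otimes> s j m" by (rule step[OF True elim])
        then show ?thesis unfolding tail_def using True elim by (simp only: lessThan_iff if_True simp_thms)
      qed
    qed
    then show ?case unfolding seq_class_eq_iff[OF s t] by (rule allI)
  qed
qed

lemma tel_coef_seq_class:
  assumes s: "s \<in> carrier (seqs d)"
  shows "\<forall>\<^sub>F m in sequentially. tel_coef d (seq_class d s) j m = s j m"
proof -
  define t where "t = (SOME t. t \<in> carrier (seqs d) \<and> seq_class d s = seq_class d t)"
  have t: "t \<in> carrier (seqs d)" "seq_class d s = seq_class d t"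
    using someI[of "\<lambda>t. t \<in> carrier (seqs d) \<and> seq_class d s = seq_class d t" s] s by (auto simp: t_def)
  have "\<forall>\<^sub>F m in sequentially. s j m = t j m" using seq_class_eq_iff[OF s t(1)] t(2) by blast
  then show ?thesis by eventually_elim (simp add: tel_coef_def t_def)
qed

lemma tel_coef_rep:
  assumes "K \<in> carrier (part telescope d)"
  obtains s where "s \<in> carrier (seqs d)" "K = seq_class d s" "tel_coef d K = s"
proof -
  define s where "s = (SOME s. s \<in> carrier (seqs d) \<and> K = seq_class d s)"
  have "\<exists>s. s \<in> carrier (seqs d) \<and> K = seq_class d s" using assms unfolding carrier_telescope by blast
  then have s: "s \<in> carrier (seqs d) \<and> K = seq_class d s" unfolding s_def by (rule someI_ex)
  have "tel_coef d K = s"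
    by (intro ext) (simp only: tel_coef_def s_def)
  then show thesis by (rule that[OF conjunct1[OF s] conjunct2[OF s]])
qed

lemma finprod_tails:
  assumes l: "\<And>j. j < N \<Longrightarrow> l j \<in> homog R (d + \<Delta> j m)" and k: "k \<le> N"
  shows "finprod (part telescope d) (\<lambda>j. seq_class d (tail {j} m l)) {..<k} = seq_class d (tail {..<k} m l)"
  using k
proof (induction k)
  case 0
  interpret comm_group "part telescope d" by (rule part_comm_group[OF telescope_module])
  show ?case by (simp add: seq_class_one tail_def)
next
  case (Suc k)
  interpret comm_group "part telescope d" by (rule part_comm_group[OF telescope_module])
  have t: "tail {j} m l \<in> carrier (seqs d)" if "j \<le> k" for j
    by (rule tail_closed) (use that Suc.prems l in auto)
  have tk: "tail {..<k} m l \<in> carrier (seqs d)" by (rule tail_closed) (use Suc.prems l in auto)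
  have c: "seq_class d (tail {j} m l) \<in> carrier (part telescope d)" if "j \<le> k" for j
    using t[OF that] by (auto simp: carrier_telescope)
  have lc: "l j \<in> carrier R" if "j \<le> k" for j using homog_carrier[OF l] that Suc.prems by auto
  have s: "(\<lambda>j m'. tail {k} m l j m' \<oplus> tail {..<k} m l j m') = tail {..<Suc k} m l"
    using lc by (auto simp: tail_def fun_eq_iff transition_carrier less_Suc_eq)
  have "finprod (part telescope d) (\<lambda>j. seq_class d (tail {j} m l)) {..<Suc k} =
      seq_class d (tail {k} m l) \<otimes>\<^bsub>part telescope d\<^esub> finprod (part telescope d) (\<lambda>j. seq_class d (tail {j} m l)) {..<k}"
    unfolding lessThan_Suc by (rule finprod_insert) (use c in auto)
  also have "\<dots> = seq_class d (tail {..<Suc k} m l)"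
    using Suc t tk by (simp add: seq_class_mult s)
  finally show ?case .
qed

lemma tel_flat_system: "flat_system R tel {..<N} \<Delta> tel_coef tel_gen"
proof unfold_locales
  show "is_complex R tel" by (rule degree_zero_complex[OF telescope_module])
  show "carrier (cpart tel p d) = {\<one>\<^bsub>cpart tel p d\<^esub>}" if "p \<noteq> 0" for p d
    using that by (simp add: term_at_degree_zero zero_complex_def singleton_group_def)
  show "finite {..<N}" by simp
  show "tel_gen j m \<in> carrier (cpart tel 0 (- \<Delta> j m))" if "j \<in> {..<N}" for j m
    unfolding cpart_tel carrier_telescope tel_gen_def
    by (intro imageI tail_closed) (use that homog_one in auto)
  show "tel_coef d K j m \<in> homog R (d + \<Delta> j m)" if K: "K \<in> carrier (cpart tel 0 d)" for d K j m
  proof -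
    obtain s where s: "s \<in> carrier (seqs d)" "K = seq_class d s" "tel_coef d K = s"
      using tel_coef_rep[OF K[unfolded cpart_tel]] .
    show ?thesis unfolding s(3) by (rule seqs_homog[OF s(1)])
  qed
  show "\<forall>\<^sub>F m in sequentially. tel_coef d (K \<otimes>\<^bsub>cpart tel 0 d\<^esub> L) j m = tel_coef d K j m \<oplus> tel_coef d L j m"
    if K: "K \<in> carrier (cpart tel 0 d)" and L: "L \<in> carrier (cpart tel 0 d)" for d K L j
  proof -
    obtain s where s: "s \<in> carrier (seqs d)" "K = seq_class d s" "tel_coef d K = s"
      using tel_coef_rep[OF K[unfolded cpart_tel]] .
    obtain t where t: "t \<in> carrier (seqs d)" "L = seq_class d t" "tel_coef d L = t"
      using tel_coef_rep[OF L[unfolded cpart_tel]] .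
    interpret comm_group "seqs d" by (rule seqs_comm_group)
    have "(\<lambda>j m. s j m \<oplus> t j m) \<in> carrier (seqs d)" using m_closed[OF s(1) t(1)] by (simp only: seqs_simps(2))
    from tel_coef_seq_class[OF this] show ?thesis
      unfolding cpart_tel s(3) t(3) by (simp add: s(2) t(2) seq_class_mult s(1) t(1))
  qed
  show "\<forall>\<^sub>F m in sequentially. tel_coef (b + d) (cact tel 0 b d r K) j m = r \<otimes> tel_coef d K j m"
    if r: "r \<in> homog R b" and K: "K \<in> carrier (cpart tel 0 d)" for b d r K j
  proof -
    obtain s where s: "s \<in> carrier (seqs d)" "K = seq_class d s" "tel_coef d K = s"
      using tel_coef_rep[OF K[unfolded cpart_tel]] .
    from tel_coef_seq_class[OF seq_act_closed[OF r s(1)], of j] show ?thesis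
      unfolding cpart_tel s(3) by (simp add: s(2) seq_class_act[OF r s(1)] seq_act_def)
  qed
  fix d K assume K: "K \<in> carrier (cpart tel 0 d)"
  obtain s where s: "s \<in> carrier (seqs d)" "K = seq_class d s" "tel_coef d K = s"
    using tel_coef_rep[OF K[unfolded cpart_tel]] .
  from seqs_stable[OF s(1)]
  show "\<forall>\<^sub>F m in sequentially. K = finprod (cpart tel 0 d)
      (\<lambda>j. cact tel 0 (d + \<Delta> j m) (- \<Delta> j m) (tel_coef d K j m) (tel_gen j m)) {..<N}"
  proof eventually_elim
    case (elim m)
    interpret T: comm_group "part telescope d" by (rule part_comm_group[OF telescope_module])
    have g: "act telescope (d + \<Delta> j m) (- \<Delta> j m) (s j m) (tel_gen j m) = seq_class d (tail {j} m (\<lambda>j. s j m))"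
      if j: "j < N" for j
    proof -
      have t: "tail {j} m (\<lambda>_. \<one>) \<in> carrier (seqs (- \<Delta> j m))"
        by (rule tail_closed) (use j homog_one in auto)
      have "seq_act (d + \<Delta> j m) (- \<Delta> j m) (s j m) (tail {j} m (\<lambda>_. \<one>)) = tail {j} m (\<lambda>j. s j m)"
        by (auto simp: seq_act_def tail_def fun_eq_iff transition_carrier seqs_carrier[OF s(1)] m_comm)
      then show ?thesis
        unfolding tel_gen_def seq_class_act[OF seqs_homog[OF s(1)] t] by simp
    qed
    have c: "seq_class d (tail {j} m (\<lambda>j. s j m)) \<in> carrier (part telescope d)" if "j < N" for j
      unfolding carrier_telescope by (intro imageI tail_closed) (simp_all add: that seqs_homog[OF s(1)])
    have "K = seq_class d (tail {..<N} m (\<lambda>j. s j m))" using s(2) elim by (rule trans)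
    also have "\<dots> = finprod (part telescope d) (\<lambda>j. seq_class d (tail {j} m (\<lambda>j. s j m))) {..<N}"
      by (rule finprod_tails[OF seqs_homog[OF s(1)] order_refl, symmetric])
    also have "\<dots> = finprod (part telescope d) (\<lambda>j. act telescope (d + \<Delta> j m) (- \<Delta> j m) (s j m) (tel_gen j m)) {..<N}"
      using c by (intro T.finprod_cong'[OF refl] funcsetI) (simp_all only: g lessThan_iff)
    finally show ?case unfolding cpart_tel s(3) .
  qed
qed

lemma tel_coef_Suc:
  assumes "K \<in> carrier (cpart tel 0 d)"
  shows "\<forall>\<^sub>F m in sequentially. tel_coef d K j (Suc m) = a j m \<otimes> tel_coef d K j m"
proof -
  obtain s where s: "s \<in> carrier (seqs d)" "K = seq_class d s" "tel_coef d K = s"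
    using tel_coef_rep[OF assms[unfolded cpart_tel]] .
  have "\<forall>\<^sub>F m in sequentially. s j (Suc m) = a j m \<otimes> s j m"
    using s(1) unfolding seqs_simps(1) by (elim conjE allE[of _ j])
  then show ?thesis unfolding s(3) .
qed

lemma tel_coef_gen:
  assumes j: "j < N"
  shows "\<forall>\<^sub>F m in sequentially. tel_coef 0 (tel_gen j 0) j m = transition j 0 m"
proof -
  have t: "tail {j} 0 (\<lambda>_. \<one>) \<in> carrier (seqs 0)"
    by (rule tail_closed) (simp_all add: j homog_one \<Delta>_def)
  have "tel_gen j 0 = seq_class 0 (tail {j} 0 (\<lambda>_. \<one>))"
    by (simp add: tel_gen_def \<Delta>_def)
  moreover have "tail {j} 0 (\<lambda>_. \<one>) j m = transition j 0 m" for m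
    by (simp add: tail_def transition_carrier)
  ultimately show ?thesis using tel_coef_seq_class[OF t, of j] by simp
qed

text \<open>
  By \<open>seqs_stable\<close> an element is given by a stage and by \<open>N\<close> elements of the ring.
\<close>
lemma countable_tel:
  assumes "countable (carrier R)" shows "countable (\<Union>p d. carrier (cpart tel p d))"
proof -
  have "carrier (part telescope d) \<subseteq> (\<lambda>(m, l). seq_class d (tail {..<N} m (\<lambda>j. l ! j))) ` (UNIV \<times> lists (carrier R))" for d
  proof
    fix K assume "K \<in> carrier (part telescope d)"
    then obtain s where s: "s \<in> carrier (seqs d)" "K = seq_class d s" by (auto simp: carrier_telescope)
    obtain m where m: "seq_class d s = seq_class d (tail {..<N} m (\<lambda>j. s j m))"
      using eventually_happens'[OF sequentially_bot seqs_stable[OF s(1)]] ..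
    define l where "l = map (\<lambda>j. s j m) [0..<N]"
    have "tail {..<N} m (\<lambda>j. s j m) = tail {..<N} m (\<lambda>j. l ! j)"
      by (auto simp: tail_def fun_eq_iff l_def)
    moreover have "l \<in> lists (carrier R)" using seqs_carrier[OF s(1)] by (auto simp: l_def)
    ultimately show "K \<in> (\<lambda>(m, l). seq_class d (tail {..<N} m (\<lambda>j. l ! j))) ` (UNIV \<times> lists (carrier R))"
      using m s(2) by (intro image_eqI[of _ _ "(m, l)"]) simp_all
  qed
  then have "countable (carrier (part telescope d))" for d
    by (rule countable_subset) (intro countable_image countable_SIGMA countable_lists assms, auto)
  moreover have "countable (carrier (cpart (zero_complex :: ('l, (nat \<Rightarrow> nat \<Rightarrow> 'l) set) cochain_complex) p d))" for p d
    by (simp add: zero_complex_def)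
  ultimately have "countable (carrier (cpart tel p d))" for p d
    by (simp add: term_at_degree_zero)
  then show ?thesis by (intro countable_UN) auto
qed

end


section \<open>Derived tensor products exist\<close>

text \<open>
  An infinite set has as many finite formal sums as elements.
\<close>
lemma tensor_frag_injection:
  assumes inf: "infinite (UNIV :: 'u set)"
  obtains h :: "('u, 'u) tensor_frag \<Rightarrow> 'u" where "inj h"
proof -
  obtain k :: "'u \<times> 'u \<Rightarrow> 'u" where k: "inj k" using infinite_pair_injection[OF inf] .
  obtain z0 :: "nat \<Rightarrow> 'u" where z0: "inj z0" using inf infinite_countable_subset by blast
  define z :: "int \<Rightarrow> 'u" where "z = (\<lambda>i. z0 (to_nat i))"
  have z: "inj z" using inj_compose[OF z0 inj_to_nat] by (simp add: z_def comp_def)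
  define g where "g = (\<lambda>(p, b, x, y). k (z p, k (z b, k (x, y))))"
  have g: "inj g" by (rule injI) (auto simp: g_def inj_eq[OF k] inj_eq[OF z])
  have "infinite (UNIV :: (int \<times> int \<times> 'u \<times> 'u) set)"
    by (simp add: finite_prod infinite_UNIV_int)
  then have "carrier (free_Abelian_group (UNIV :: (int \<times> int \<times> 'u \<times> 'u) set)) \<lesssim> (UNIV :: (int \<times> int \<times> 'u \<times> 'u) set)"
    by (rule eqpoll_imp_lepoll[OF eqpoll_free_Abelian_group_infinite])
  then obtain e :: "('u, 'u) tensor_frag \<Rightarrow> int \<times> int \<times> 'u \<times> 'u" where e: "inj_on e (carrier (free_Abelian_group UNIV))"
    by (auto simp: lepoll_def)
  have "carrier (free_Abelian_group (UNIV :: (int \<times> int \<times> 'u \<times> 'u) set)) = UNIV" by auto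
  then have "inj e" using e by simp
  from inj_compose[OF g this] show thesis by (rule that)
qed

lemma (in complex_pair) tclass_member:
  assumes "x \<in> tclass n d c" "c \<in> tch n d"
  shows "tclass n d x = tclass n d c"
proof -
  interpret G: comm_group "tfree n d" by (rule tfree_group)
  have "c \<in> carrier (tfree n d)" using assms(2) by (simp only: carrier_free_tensor)
  from G.repr_independence[OF assms(1)[unfolded tclass_def] this rels_subgroup] show ?thesis
    unfolding tclass_def by (rule sym)
qed

text \<open>
  Classes are disjoint sets of formal sums, so picking a member is injective on them.
\<close>
lemma (in graded_cring) tensor_copy:
  fixes C D :: "('l, 'u) cochain_complex"
  assumes inf: "infinite (UNIV :: 'u set)" and C: "is_complex R C" and D: "is_complex R D"
  obtains T :: "('l, 'u) cochain_complex" and f where "is_complex R T"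
    "is_chain_map R T (tensor_complex R C D) f" "\<And>p d. f p d \<in> iso (cpart T p d) (cpart (tensor_complex R C D) p d)"
proof -
  interpret complex_pair R C D by unfold_locales (rule C D)+
  obtain h :: "('u, 'u) tensor_frag \<Rightarrow> 'u" where h: "inj h" using tensor_frag_injection[OF inf] .
  define k where "k K = h (SOME c. c \<in> K)" for K
  have "inj_on k (carrier (cpart TC n d))" for n d
  proof (rule inj_onI)
    fix K L assume K: "K \<in> carrier (cpart TC n d)" and L: "L \<in> carrier (cpart TC n d)" and e: "k K = k L"
    obtain b c where b: "b \<in> tch n d" "K = tclass n d b" and c: "c \<in> tch n d" "L = tclass n d c"
      using K L by (auto simp: carrier_tensor)
    interpret G: comm_group "tfree n d" by (rule tfree_group)
    have ne: "b \<in> K" "c \<in> L"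
      using G.rcos_self[OF _ rels_subgroup] b c
      by (simp_all add: tclass_def carrier_free_tensor del: carrier_free_Abelian_group_iff)
    have "(SOME c. c \<in> K) = (SOME c. c \<in> L)" using e h by (auto simp: k_def inj_def)
    moreover have "(SOME c. c \<in> K) \<in> K" "(SOME c. c \<in> L) \<in> L" using ne by (auto intro: someI)
    ultimately obtain x where "x \<in> K" "x \<in> L" by metis
    then show "K = L" using tclass_member[OF _ b(1)] tclass_member[OF _ c(1)] b(2) c(2) by metis
  qed
  from complex_copy[OF is_complex_tensor this] show thesis using that by metis
qed

text \<open>
  A K-flat complex is its own resolution, which shows that the choice in the definition of the derived
  tensor product succeeds.
\<close>
lemma (in graded_cring) is_derived_tensor_derived_tensor:
  fixes C D :: "('l, 'u) cochain_complex"
  assumes inf: "infinite (UNIV :: 'u set)" and C: "K_flat R C" and D: "is_complex R D"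
  shows "is_derived_tensor R C D (derived_tensor R C D)"
proof -
  have Cc: "is_complex R C" using C by (simp add: K_flat_def)
  obtain T :: "('l, 'u) cochain_complex" and f where T: "is_complex R T"
    and f: "is_chain_map R T (tensor_complex R C D) f" "\<And>p d. f p d \<in> iso (cpart T p d) (cpart (tensor_complex R C D) p d)"
    using tensor_copy[OF inf Cc D] by metis
  have "is_quasi_iso R C C (\<lambda>p d x. x)" using qiso_id[OF Cc] by (simp add: quasi_iso_iff[OF Cc Cc])
  then have "is_derived_tensor R C D T"
    unfolding is_derived_tensor_def complexes_isomorphic_def using T C f by blast
  then show ?thesis unfolding derived_tensor_def by (rule someI)
qed


section \<open>Tensor powers of the telescopes\<close>

context nilpotent_telescopes
begin

text \<open>
  The summands of the \<open>r\<close>-fold tensor power of the sum of \<open>N\<close> telescopes are indexed by these words.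
\<close>
definition words :: "nat \<Rightarrow> nat list set" where
  "words r = {w. length w = r \<and> set w \<subseteq> {..<N}}"

text \<open>
  The image at stage \<open>m\<close> of the element \<open>1\<close> of stage 0 of the summand \<open>w\<close>.
\<close>
primrec wprod :: "nat list \<Rightarrow> nat \<Rightarrow> 'l" where
  "wprod [] m = \<one>"
| "wprod (j # w) m = transition j 0 m \<otimes> wprod w m"

text \<open>
  The induction hypothesis that is carried along the tensor powers. Besides flatness it says three
  things. If \<open>j\<close> is a letter of \<open>w\<close>, then the coordinate at \<open>w\<close> at stage \<open>m + 1\<close> is killed by \<open>a j m\<close>
  (in a tensor power it is a multiple of \<open>a j m\<close>, whose square is zero). The summands of words with a
  repeated letter are zero. The image of \<open>1\<close> exists in every summand. The first of these is what makes
  the second one inductive.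
\<close>
definition word_system where
  "word_system r Y D coef gen \<longleftrightarrow> flat_system R Y (words r) D coef gen \<and>
     (\<forall>w\<in>words r. \<forall>j\<in>set w. \<forall>d. \<forall>y\<in>carrier (cpart Y 0 d). \<forall>\<^sub>F m in sequentially. a j m \<otimes> coef d y w (Suc m) = \<zero>) \<and>
     (\<forall>w\<in>words r. \<not> distinct w \<longrightarrow> (\<forall>d. \<forall>y\<in>carrier (cpart Y 0 d). \<forall>\<^sub>F m in sequentially. coef d y w m = \<zero>)) \<and>
     (\<forall>w\<in>words r. \<exists>d. \<exists>y\<in>carrier (cpart Y 0 d). \<forall>\<^sub>F m in sequentially. coef d y w m = wprod w m)"

lemma wprod_carrier: "wprod w m \<in> carrier R"
  by (induction w) (simp_all add: transition_carrier)

end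

text \<open>
  An isomorphic copy of the sum of the telescopes on the type \<open>'u\<close>, described by the properties of its
  coordinates that are used.
\<close>
locale telescope_copy = nilpotent_telescopes R N a \<delta> + U: flat_system R U "{..<N}" DX coefX genX
  for R :: "'l graded_ring" (structure) and N a \<delta> and U :: "('l, 'u) cochain_complex" and DX coefX genX +
  assumes coefX_Suc: "x \<in> carrier (cpart U 0 d) \<Longrightarrow> \<forall>\<^sub>F m in sequentially. coefX d x j (Suc m) = a j m \<otimes> coefX d x j m"
    and coefX_gen: "j < N \<Longrightarrow> \<exists>d. \<exists>x\<in>carrier (cpart U 0 d). \<forall>\<^sub>F m in sequentially. coefX d x j m = transition j 0 m"
begin

lemma a_coefX_Suc:
  assumes x: "x \<in> carrier (cpart U 0 d)" and j: "j < N"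
  shows "\<forall>\<^sub>F m in sequentially. a j m \<otimes> coefX d x j (Suc m) = \<zero>"
  using coefX_Suc[OF x, of j]
proof eventually_elim
  case (elim m)
  have k: "coefX d x j m \<in> carrier R" using U.coef_homog[OF x, of j m] j by (intro homog_carrier) auto
  then show ?case
    unfolding elim using m_assoc[OF a_carrier a_carrier k, of j m j m] by (simp add: a_square)
qed

lemma words_1: "w \<in> words 1 \<Longrightarrow> \<exists>j<N. w = [j]"
  by (cases w) (auto simp: words_def)

lemma word_system_1: "word_system 1 U (\<lambda>w. DX (hd w)) (\<lambda>d x w. coefX d x (hd w)) (\<lambda>w. genX (hd w))"
proof -
  have "bij_betw hd (words 1) {..<N}"
  proof (rule bij_betw_byWitness[where f' = "\<lambda>j. [j]"])
    show "(\<lambda>j. [j]) ` {..<N} \<subseteq> words 1" by (auto simp: words_def)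
  qed (auto dest!: words_1 simp del: One_nat_def)
  then have "flat_system R U (words 1) (\<lambda>w. DX (hd w)) (\<lambda>d x w. coefX d x (hd w)) (\<lambda>w. genX (hd w))"
    by (rule U.reindex)
  moreover have "\<exists>d. \<exists>y\<in>carrier (cpart U 0 d). \<forall>\<^sub>F m in sequentially. coefX d y (hd w) m = wprod w m"
    if w: "w \<in> words 1" for w
  proof -
    obtain j where j: "j < N" "w = [j]" using words_1[OF w] by blast
    then show ?thesis using coefX_gen[OF j(1)] by (simp add: transition_carrier)
  qed
  moreover have "distinct w" if "w \<in> words 1" for w using words_1[OF that] by auto
  moreover have "\<forall>\<^sub>F m in sequentially. a j m \<otimes> coefX d y (hd w) (Suc m) = \<zero>"
    if "w \<in> words 1" "j \<in> set w" "y \<in> carrier (cpart U 0 d)" for w j d y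
    using words_1[OF that(1)] that(2) a_coefX_Suc[OF that(3)] by auto
  ultimately show ?thesis unfolding word_system_def by blast
qed

text \<open>
  The isomorphism with \<open>T\<close> only serves to return to the type at hand. A word of length \<open>r + 1\<close> is split
  into its head, which belongs to \<open>U\<close>, and its tail, which belongs to \<open>Y\<close>, and its
  coordinate is a sum of products of coordinates.
\<close>
lemma word_system_Suc:
  fixes T :: "('l, 't) cochain_complex" and Y :: "('l, 'y) cochain_complex"
  assumes Y: "word_system r Y D coef gen"
    and T: "is_complex R T" and f: "is_chain_map R T (tensor_complex R U Y) f"
    and iso: "\<And>p d. f p d \<in> iso (cpart T p d) (cpart (tensor_complex R U Y) p d)"
  obtains D' coef' gen' where "word_system (Suc r) T D' coef' gen'"
proof -
  have Yf: "flat_system R Y (words r) D coef gen"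
    and Y1: "\<And>w j d y. w \<in> words r \<Longrightarrow> j \<in> set w \<Longrightarrow> y \<in> carrier (cpart Y 0 d) \<Longrightarrow> \<forall>\<^sub>F m in sequentially. a j m \<otimes> coef d y w (Suc m) = \<zero>"
    and Y2: "\<And>w d y. w \<in> words r \<Longrightarrow> \<not> distinct w \<Longrightarrow> y \<in> carrier (cpart Y 0 d) \<Longrightarrow> \<forall>\<^sub>F m in sequentially. coef d y w m = \<zero>"
    and Y3: "\<And>w. w \<in> words r \<Longrightarrow> \<exists>d. \<exists>y\<in>carrier (cpart Y 0 d). \<forall>\<^sub>F m in sequentially. coef d y w m = wprod w m"
    using Y by (auto simp: word_system_def)
  interpret Yf: flat_system R Y "words r" D coef gen by (rule Yf)
  interpret two_flat_systems R U "{..<N}" DX coefX genX Y "words r" D coef gen ..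
  obtain g where g: "is_chain_map R TC T g"
    and fg: "\<And>p d x. x \<in> carrier (cpart TC p d) \<Longrightarrow> f p d (g p d x) = x"
    and gf: "\<And>p d x. x \<in> carrier (cpart T p d) \<Longrightarrow> g p d (f p d x) = x"
    using inverse_chain_map[OF T is_complex_tensor f iso] by blast
  interpret F: flat_system R TC "{..<N} \<times> words r" "\<lambda>ij m. DX (fst ij) m + D (snd ij) m" pcoef_class pgen
    by (rule tensor_flat_system)
  have bij: "bij_betw (\<lambda>w. (hd w, tl w)) (words (Suc r)) ({..<N} \<times> words r)"
    by (rule bij_betw_byWitness[where f' = "\<lambda>(j, w). j # w"]) (auto simp: words_def length_Suc_conv)
  interpret W: flat_system R TC "words (Suc r)" "\<lambda>w m. DX (hd w) m + D (tl w) m" "\<lambda>d K w. pcoef_class d K (hd w, tl w)" "\<lambda>w. pgen (hd w, tl w)"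
    using F.reindex[OF bij] by simp
  let ?coef = "\<lambda>d x w. pcoef_class d (f 0 d x) (hd w, tl w)"
  have flat: "flat_system R T (words (Suc r)) (\<lambda>w m. DX (hd w) m + D (tl w) m) ?coef
      (\<lambda>w m. g 0 (- (DX (hd w) m + D (tl w) m)) (pgen (hd w, tl w) m))"
    by (rule W.transport[OF T f g fg gf])
  have hd_tl: "hd w < N" "tl w \<in> words r" "w = hd w # tl w" if "w \<in> words (Suc r)" for w
    using that by (cases w; auto simp: words_def)+
  have rep: "\<exists>c\<in>tch 0 d. \<forall>w m. ?coef d x w m = pcoef d (hd w) (tl w) m c" if x: "x \<in> carrier (cpart T 0 d)" for d x
  proof -
    from chain_map_closed[OF f x] show ?thesis
      by (rule pcoef_class_rep) auto
  qed
  have kX: "coefX b x j m \<in> carrier R" if "x \<in> carrier (cpart U 0 b)" "j < N" for b x j m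
    using U.coef_homog[OF that(1), of j m] that(2) by (intro homog_carrier) auto
  have kY: "coef b y w m \<in> carrier R" if "y \<in> carrier (cpart Y 0 b)" "w \<in> words r" for b y w m
    using Yf.coef_homog[OF that, of m] by (rule homog_carrier)
  have 1: "\<forall>\<^sub>F m in sequentially. a i m \<otimes> pcoef d j w (Suc m) c = \<zero>"
    if c: "c \<in> tch 0 d" and j: "j < N" and w: "w \<in> words r" and i: "i = j \<or> i \<in> set w" for d c i j w
    using c
  proof (induction rule: tchains_induct)
    case zero
    show ?case using pcoef_zero[of j w] j w by (simp add: a_carrier)
  next
    case (diff c c')
    have jj: "j \<in> {..<N}" using j by simp
    from diff.IH show ?case
    proof eventually_elim
      case (elim m)
      have "pcoef d j w (Suc m) c \<in> carrier R" "pcoef d j w (Suc m) c' \<in> carrier R" "a i m \<in> carrier R"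
        using pcoef_carrier[OF jj w] diff.hyps a_carrier by auto
      then show ?case
        unfolding pcoef_diff[OF jj w diff.hyps] using elim by (simp add: a_minus_def r_distr r_minus)
    qed
  next
    case (gen p b x y)
    have jj: "j \<in> {..<N}" using j by simp
    show ?case
    proof (cases "p = 0")
      case False
      then show ?thesis unfolding pcoef_frag_of[OF jj w gen] by (simp add: a_carrier)
    next
      case True
      have x: "x \<in> carrier (cpart U 0 b)" and y: "y \<in> carrier (cpart Y 0 (d - b))" using gen True by simp_all
      show ?thesis
        using i
      proof
        assume "i = j"
        from a_coefX_Suc[OF x j] show ?thesis
        proof eventually_elim
          case (elim m)
          then show ?case
            unfolding pcoef_frag_of[OF jj w gen] \<open>i = j\<close>
            using True m_assoc[OF a_carrier kX[OF x j] kY[OF y w], of j m "Suc m" "Suc m"] kY[OF y w] by simp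
        qed
      next
        assume "i \<in> set w"
        from Y1[OF w this y] show ?thesis
        proof eventually_elim
          case (elim m)
          then show ?case
            unfolding pcoef_frag_of[OF jj w gen]
            using True m_lcomm[OF a_carrier kX[OF x j] kY[OF y w], of i m "Suc m" "Suc m"] kX[OF x j] by simp
        qed
      qed
    qed
  qed
  have 2: "\<forall>\<^sub>F m in sequentially. pcoef d j w m c = \<zero>"
    if c: "c \<in> tch 0 d" and j: "j < N" and w: "w \<in> words r" and nd: "\<not> distinct (j # w)" for d c j w
    using c
  proof (induction rule: tchains_induct)
    case zero
    show ?case using pcoef_zero[of j w] j w by simp
  next
    case (diff c c')
    have jj: "j \<in> {..<N}" using j by simp
    from diff.IH show ?case
      by eventually_elim (simp add: pcoef_diff[OF jj w diff.hyps] a_minus_def)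
  next
    case (gen p b x y)
    have jj: "j \<in> {..<N}" using j by simp
    show ?case
    proof (cases "p = 0")
      case False
      then show ?thesis unfolding pcoef_frag_of[OF jj w gen] by simp
    next
      case True
      have x: "x \<in> carrier (cpart U 0 b)" and y: "y \<in> carrier (cpart Y 0 (d - b))" using gen True by simp_all
      show ?thesis
      proof (cases "distinct w")
        case False
        from Y2[OF w this y] show ?thesis
          by eventually_elim (simp add: pcoef_frag_of[OF jj w gen] kX[OF x j])
      next
        case d: True
        then have jw: "j \<in> set w" using nd by simp
        \<comment> \<open>At stage \<open>m + 1\<close> the coordinate of \<open>x\<close> has a factor \<open>a j m\<close>, which kills the coordinate of \<open>y\<close>
          because the letter \<open>j\<close> occurs in \<open>w\<close>.\<close>
        have "\<forall>\<^sub>F m in sequentially. pcoef d j w (Suc m) (frag_of (p, b, x, y)) = \<zero>"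
          using coefX_Suc[OF x, of j] Y1[OF w jw y]
        proof eventually_elim
          case (elim m)
          have "(a j m \<otimes> coefX b x j m) \<otimes> coef (d - b) y w (Suc m) = coefX b x j m \<otimes> (a j m \<otimes> coef (d - b) y w (Suc m))"
            using a_carrier kX[OF x j] kY[OF y w] by (simp add: m_ac)
          then show ?case
            unfolding pcoef_frag_of[OF jj w gen] using True elim kX[OF x j] by simp
        qed
        then show ?thesis by (rule eventually_sequentially_Suc[THEN iffD1])
      qed
    qed
  qed
  have 3: "\<exists>d. \<exists>x\<in>carrier (cpart T 0 d). \<forall>\<^sub>F m in sequentially. ?coef d x (j # w) m = wprod (j # w) m"
    if j: "j < N" and w: "w \<in> words r" for j w
  proof -
    have jj: "j \<in> {..<N}" using j by simp
    obtain b x where x: "x \<in> carrier (cpart U 0 b)" and ex: "\<forall>\<^sub>F m in sequentially. coefX b x j m = transition j 0 m"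
      using coefX_gen[OF j] by blast
    obtain e y where y: "y \<in> carrier (cpart Y 0 e)" and ey: "\<forall>\<^sub>F m in sequentially. coef e y w m = wprod w m"
      using Y3[OF w] by blast
    define d where "d = b + e"
    let ?c = "frag_of (0, b, x, y)"
    have y': "y \<in> carrier (cpart Y (0 - 0) (d - b))" using y by (simp add: d_def)
    have c: "?c \<in> tch 0 d" using x y' by (simp add: tchains_frag_of)
    note t = tclass_closed[OF c]
    have "g 0 d (tclass 0 d ?c) \<in> carrier (cpart T 0 d)" by (rule chain_map_closed[OF g t])
    moreover have "\<forall>\<^sub>F m in sequentially. ?coef d (g 0 d (tclass 0 d ?c)) (j # w) m = wprod (j # w) m"
      using pcoef_class_tclass[OF jj w c] ex ey
    proof eventually_elim
      case (elim m)
      then show ?case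
        unfolding fg[OF t] using pcoef_frag_of[OF jj w x y', of m] by (simp add: d_def)
    qed
    ultimately show ?thesis by blast
  qed
  have "word_system (Suc r) T (\<lambda>w m. DX (hd w) m + D (tl w) m) ?coef
      (\<lambda>w m. g 0 (- (DX (hd w) m + D (tl w) m)) (pgen (hd w, tl w) m))"
    unfolding word_system_def
  proof (intro conjI ballI allI impI flat)
    fix w assume w: "w \<in> words (Suc r)"
    note h = hd_tl[OF w]
    show "\<forall>\<^sub>F m in sequentially. a i m \<otimes> ?coef d x w (Suc m) = \<zero>"
      if i: "i \<in> set w" and x: "x \<in> carrier (cpart T 0 d)" for i d x
    proof -
      obtain c where c: "c \<in> tch 0 d" "\<And>w m. ?coef d x w m = pcoef d (hd w) (tl w) m c" using rep[OF x] by blast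
      have "i = hd w \<or> i \<in> set (tl w)" using i h(3) by (metis set_ConsD)
      then show ?thesis unfolding c(2) by (rule 1[OF c(1) h(1,2)])
    qed
    show "\<forall>\<^sub>F m in sequentially. ?coef d x w m = \<zero>"
      if nd: "\<not> distinct w" and x: "x \<in> carrier (cpart T 0 d)" for d x
    proof -
      obtain c where c: "c \<in> tch 0 d" "\<And>w m. ?coef d x w m = pcoef d (hd w) (tl w) m c" using rep[OF x] by blast
      have "\<not> distinct (hd w # tl w)" using nd h(3) by simp
      then show ?thesis unfolding c(2) by (rule 2[OF c(1) h(1,2)])
    qed
    show "\<exists>d. \<exists>x\<in>carrier (cpart T 0 d). \<forall>\<^sub>F m in sequentially. ?coef d x w m = wprod w m"
      using 3[OF h(1,2)] h(3) by simp
  qed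
  then show thesis by (rule that)
qed

lemma K_flat_U: "K_flat R U"
  by (rule U.K_flat)

text \<open>
  In the induction step, the power formed so far is \<open>T\<close>, and \<open>T'\<close> is the derived tensor product of \<open>U\<close>
  with it. It is a copy of \<open>P \<otimes> T\<close> for some K-flat \<open>P\<close> that is quasi-isomorphic to \<open>U\<close>. The
  quasi-isomorphisms \<open>P \<otimes> T \<rightarrow> P \<otimes> Y\<close> (K-flatness of \<open>P\<close>) and \<open>P \<otimes> Y \<rightarrow> U \<otimes> Y\<close> (flatness of \<open>Y\<close>) lead to
  an ordinary tensor product, which is a word system again. All maps point in the same
  direction, so they can be composed.
\<close>
lemma derived_power_word_system:
  assumes inf: "infinite (UNIV :: 'u set)"
  shows "is_complex R ((derived_tensor R U ^^ k) U) \<and>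
    (\<exists>(Y :: ('l, 'u) cochain_complex) D coef gen g. word_system (Suc k) Y D coef gen \<and> qiso R ((derived_tensor R U ^^ k) U) Y g)"
proof (induction k)
  case 0
  show ?case using U.Y word_system_1 qiso_id[OF U.Y] by auto
next
  case (Suc k)
  define T where "T = (derived_tensor R U ^^ k) U"
  define T' where "T' = derived_tensor R U T"
  have TT: "(derived_tensor R U ^^ Suc k) U = T'" by (simp add: T'_def T_def)
  obtain Y :: "('l, 'u) cochain_complex" and D coef gen g
    where Tc: "is_complex R T" and Y: "word_system (Suc k) Y D coef gen" and g: "qiso R T Y g"
    using Suc.IH unfolding T_def by blast
  interpret Yf: flat_system R Y "words (Suc k)" D coef gen using Y by (simp add: word_system_def)
  have "is_derived_tensor R U T T'"
    unfolding T'_def by (rule is_derived_tensor_derived_tensor[OF inf K_flat_U Tc])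
  then obtain P :: "('l, 'u) cochain_complex" and f h where T'c: "is_complex R T'" and P: "K_flat R P"
    and f: "is_quasi_iso R P U f" and h: "is_chain_map R T' (tensor_complex R P T) h"
    and hi: "\<And>p d. h p d \<in> iso (cpart T' p d) (cpart (tensor_complex R P T) p d)"
    unfolding is_derived_tensor_def complexes_isomorphic_def by blast
  have Pc: "is_complex R P" using P by (simp add: K_flat_def)
  interpret PT: complex_pair R P T by unfold_locales (rule Pc Tc)+
  interpret PY: complex_pair R P Y by unfold_locales (rule Pc Yf.Y)+
  interpret UY: complex_pair R U Y by unfold_locales (rule U.Y Yf.Y)+
  have q1: "qiso R T' PT.TC h" by (rule iso_imp_qiso[OF T'c PT.is_complex_tensor h hi])
  obtain g' where q2: "qiso R PT.TC PY.TC g'" using K_flat_tensor_qiso[OF inf P Tc Yf.Y g] .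
  have "qiso R P U f" using f by (simp add: quasi_iso_iff[OF Pc U.Y])
  from Yf.tensor_flat_qiso[OF Pc U.Y this] obtain f' where q3: "qiso R PY.TC UY.TC f'" .
  obtain Z :: "('l, 'u) cochain_complex" and z where Z: "is_complex R Z" and z: "is_chain_map R Z UY.TC z"
    and zi: "\<And>p d. z p d \<in> iso (cpart Z p d) (cpart UY.TC p d)"
    using tensor_copy[OF inf U.Y Yf.Y] by metis
  obtain z' where z': "is_chain_map R UY.TC Z z'"
    and zz': "\<And>p d x. x \<in> carrier (cpart UY.TC p d) \<Longrightarrow> z p d (z' p d x) = x"
    and z'z: "\<And>p d x. x \<in> carrier (cpart Z p d) \<Longrightarrow> z' p d (z p d x) = x"
    using inverse_chain_map[OF Z UY.is_complex_tensor z zi] by blast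
  have "z' p d \<in> iso (cpart UY.TC p d) (cpart Z p d)" for p d
  proof -
    have "bij_betw (z' p d) (carrier (cpart UY.TC p d)) (carrier (cpart Z p d))"
      by (rule bij_betw_byWitness[where f' = "z p d"])
         (auto simp: zz' z'z chain_map_closed[OF z] chain_map_closed[OF z'])
    then show ?thesis using chain_map_hom[OF z'] by (simp add: iso_def)
  qed
  then have q4: "qiso R UY.TC Z z'" by (rule iso_imp_qiso[OF UY.is_complex_tensor Z z'])
  have "qiso R T' Z (\<lambda>p d x. z' p d (f' p d (g' p d (h p d x))))"
    by (rule qiso_comp[OF T'c UY.is_complex_tensor Z qiso_comp[OF T'c PY.is_complex_tensor UY.is_complex_tensor
          qiso_comp[OF T'c PT.is_complex_tensor PY.is_complex_tensor q1 q2] q3] q4])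
  moreover obtain D' coef' gen' where "word_system (Suc (Suc k)) Z D' coef' gen'"
    using word_system_Suc[OF Y Z z zi] .
  ultimately show ?case unfolding TT using T'c by blast
qed

text \<open>
  A complex concentrated in degree 0 is acyclic only if it is trivial, but the image of \<open>1\<close> in the
  summand \<open>w\<close> has nonvanishing coordinates.
\<close>
lemma word_system_not_acyclic:
  fixes Y :: "('l, 'y) cochain_complex"
  assumes Y: "word_system r Y D coef gen" and w: "w \<in> words r" and nz: "\<And>m. wprod w m \<noteq> \<zero>"
  shows "\<not> acyclic_complex Y"
proof
  interpret Yf: flat_system R Y "words r" D coef gen using Y by (simp add: word_system_def)
  assume ac: "acyclic_complex Y"
  obtain d y where y: "y \<in> carrier (cpart Y 0 d)" and ev: "\<forall>\<^sub>F m in sequentially. coef d y w m = wprod w m"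
    using Y w by (auto simp: word_system_def)
  interpret Yg: comm_group "cpart Y 0 d" by (rule complex_group[OF Yf.Y])
  have "diff Y 0 d y = \<one>\<^bsub>cpart Y (0 + 1) d\<^esub>"
    using diff_closed[OF Yf.Y y] Yf.concentrated[of "0 + 1" d] by simp
  then have "y \<in> cocycles Y 0 d" using y unfolding mem_cocycles_iff by blast
  then have "y \<in> coboundaries Y 0 d" using ac unfolding acyclic_complex_iff[OF Yf.Y] by blast
  then obtain b where b: "b \<in> carrier (cpart Y (0 - 1) d)" "y = diff Y (0 - 1) d b" by (auto simp: coboundaries_def)
  then have "b = \<one>\<^bsub>cpart Y (0 - 1) d\<^esub>" using Yf.concentrated[of "0 - 1" d] by simp
  then have y1: "y = \<one>\<^bsub>cpart Y 0 d\<^esub>" using b(2) diff_unit[OF Yf.Y, of "0 - 1" d] by simp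
  \<comment> \<open>If \<open>y\<close> is the neutral element, eventual additivity makes its coordinates eventually vanish.\<close>
  from Yf.coef_mult[OF y y w] ev have "\<forall>\<^sub>F m in sequentially. wprod w m = \<zero>"
  proof eventually_elim
    case (elim m)
    have "wprod w m \<oplus> wprod w m = wprod w m" using elim unfolding y1 by simp
    then show ?case using wprod_carrier[of w m] by (metis add.l_cancel_one)
  qed
  then show False using nz by simp
qed

lemma word_system_acyclic:
  fixes Y :: "('l, 'y) cochain_complex"
  assumes Y: "word_system r Y D coef gen" and nd: "\<And>w. w \<in> words r \<Longrightarrow> \<not> distinct w"
  shows "acyclic_complex Y"
proof -
  interpret Yf: flat_system R Y "words r" D coef gen using Y by (simp add: word_system_def)
  have "carrier (cpart Y p d) \<subseteq> {\<one>\<^bsub>cpart Y p d\<^esub>}" for p d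
  proof (cases "p = 0")
    case False
    then show ?thesis using Yf.concentrated by simp
  next
    case True
    interpret Yg: comm_group "cpart Y 0 d" by (rule complex_group[OF Yf.Y])
    have "y = \<one>\<^bsub>cpart Y 0 d\<^esub>" if y: "y \<in> carrier (cpart Y 0 d)" for y
    proof -
      have "\<forall>\<^sub>F m in sequentially. \<forall>w\<in>words r. coef d y w m = \<zero>"
      proof -
        have "\<forall>\<^sub>F m in sequentially. coef d y w m = \<zero>" if "w \<in> words r" for w
          using Y that nd[OF that] y unfolding word_system_def by blast
        then show ?thesis using Yf.finite_I by (simp add: eventually_ball_finite_distrib)
      qed
      with Yf.expansion[OF y] have "\<forall>\<^sub>F m in sequentially. y = \<one>\<^bsub>cpart Y 0 d\<^esub>"
      proof eventually_elim
        case (elim m)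
        have "cact Y 0 (d + D w m) (- D w m) (coef d y w m) (gen w m) = \<one>\<^bsub>cpart Y 0 d\<^esub>" if "w \<in> words r" for w
          using act_zero_scalar[OF complex_module[OF Yf.Y] Yf.gen_closed[OF that, of m], of "d + D w m"] elim(2) that by simp
        from elim(1) Yg.finprod_one_eqI[OF this] show ?case by (rule trans)
      qed
      then show ?thesis by simp
    qed
    then show ?thesis using True by blast
  qed
  then have "x = \<one>\<^bsub>cpart Y p d\<^esub>" if "x \<in> cocycles Y p d" for x p d
    using that unfolding mem_cocycles_iff by blast
  then show ?thesis
    unfolding acyclic_complex_iff[OF Yf.Y] using subgroup.one_closed[OF subgroup_coboundaries[OF Yf.Y]] by blast
qed

text \<open>
  A word of length \<open>N + 1\<close> in \<open>N\<close> letters repeats one of them, and \<open>[0..<N]\<close> uses each letter once.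
\<close>
lemma derived_power_nonzero_then_zero:
  assumes inf: "infinite (UNIV :: 'u set)" and N: "N \<ge> 1" and nz: "\<And>m. wprod [0..<N] m \<noteq> \<zero>"
  shows "\<not> derived_zero R (derived_power R U N)" "derived_zero R (derived_power R U (N + 1))"
proof -
  obtain Y :: "('l, 'u) cochain_complex" and D coef gen g where Y: "is_complex R (derived_power R U N)"
    "word_system N Y D coef gen" "qiso R (derived_power R U N) Y g"
    using derived_power_word_system[OF inf, of "N - 1"] N by (auto simp: derived_power_def)
  have Yc: "is_complex R Y" using Y(2) by (auto simp: word_system_def flat_system_def flat_system_axioms_def)
  have "[0..<N] \<in> words N" by (auto simp: words_def)
  then have "\<not> acyclic_complex Y" using word_system_not_acyclic[OF Y(2)] nz by blast
  then show "\<not> derived_zero R (derived_power R U N)"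
    using derived_zero_iff[OF Y(1)] qiso_acyclic_iff[OF Y(1) Yc Y(3)] by simp
  obtain Y :: "('l, 'u) cochain_complex" and D coef gen g where Y: "is_complex R (derived_power R U (N + 1))"
    "word_system (Suc N) Y D coef gen" "qiso R (derived_power R U (N + 1)) Y g"
    using derived_power_word_system[OF inf, of N] by (auto simp: derived_power_def)
  have Yc: "is_complex R Y" using Y(2) by (auto simp: word_system_def flat_system_def flat_system_axioms_def)
  have "\<not> distinct w" if "w \<in> words (Suc N)" for w
  proof
    assume "distinct w"
    then have "card (set w) = Suc N" using that by (simp add: words_def distinct_card)
    moreover have "card (set w) \<le> card {..<N}" by (rule card_mono) (use that in \<open>auto simp: words_def\<close>)
    ultimately show False by simp
  qed
  then have "acyclic_complex Y" using word_system_acyclic[OF Y(2)] by blast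
  then show "derived_zero R (derived_power R U (N + 1))"
    using derived_zero_iff[OF Y(1)] qiso_acyclic_iff[OF Y(1) Yc Y(3)] by simp
qed

end

text \<open>
  For a countable ring the telescopes are countable, so they have a copy on any infinite type.
\<close>
theorem (in nilpotent_telescopes) nilpotent_object:
  assumes inf: "infinite (UNIV :: 'u set)" and R: "countable (carrier R)" and N: "N \<ge> 1"
    and nz: "\<And>m. wprod [0..<N] m \<noteq> \<zero>"
  shows "\<exists>U :: ('l, 'u) cochain_complex. is_complex R U \<and>
    \<not> derived_zero R (derived_power R U N) \<and> derived_zero R (derived_power R U (N + 1))"
proof -
  interpret X: flat_system R tel "{..<N}" \<Delta> tel_coef tel_gen by (rule tel_flat_system)
  let ?S = "\<Union>p d. carrier (cpart tel p d)"
  obtain z :: "nat \<Rightarrow> 'u" where z: "inj z" using inf infinite_countable_subset by blast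
  define h where "h K = z (to_nat_on ?S K)" for K
  have h: "inj_on h (carrier (cpart tel p d))" for p d
  proof -
    have "inj_on (to_nat_on ?S) ?S" by (rule inj_on_to_nat_on[OF countable_tel[OF R]])
    then have "inj_on h ?S" by (simp only: h_def inj_on_def inj_eq[OF z])
    then show ?thesis by (rule inj_on_subset) blast
  qed
  obtain U :: "('l, 'u) cochain_complex" and f where U: "is_complex R U" and f: "is_chain_map R U tel f"
    and fi: "\<And>p d. f p d \<in> iso (cpart U p d) (cpart tel p d)"
    using complex_copy[OF X.Y h] by metis
  obtain g where g: "is_chain_map R tel U g"
    and fg: "\<And>p d x. x \<in> carrier (cpart tel p d) \<Longrightarrow> f p d (g p d x) = x"
    and gf: "\<And>p d x. x \<in> carrier (cpart U p d) \<Longrightarrow> g p d (f p d x) = x"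
    using inverse_chain_map[OF U X.Y f fi] by blast
  interpret F: flat_system R U "{..<N}" \<Delta> "\<lambda>d x. tel_coef d (f 0 d x)" "\<lambda>i m. g 0 (- \<Delta> i m) (tel_gen i m)"
    by (rule X.transport[OF U f g fg gf])
  interpret T: telescope_copy R N a \<delta> U \<Delta> "\<lambda>d x. tel_coef d (f 0 d x)" "\<lambda>i m. g 0 (- \<Delta> i m) (tel_gen i m)"
  proof unfold_locales
    show "\<forall>\<^sub>F m in sequentially. tel_coef d (f 0 d x) j (Suc m) = a j m \<otimes> tel_coef d (f 0 d x) j m"
      if "x \<in> carrier (cpart U 0 d)" for x d j
      by (rule tel_coef_Suc[OF chain_map_closed[OF f that]])
    show "\<exists>d. \<exists>x\<in>carrier (cpart U 0 d). \<forall>\<^sub>F m in sequentially. tel_coef d (f 0 d x) j m = transition j 0 m" if j: "j < N" for j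
    proof -
      have t: "tel_gen j 0 \<in> carrier (cpart tel 0 0)" using X.gen_closed[of j 0] j by (simp add: \<Delta>_def)
      show ?thesis
        using tel_coef_gen[OF j] chain_map_closed[OF g t] fg[OF t] by (intro exI[of _ 0] bexI[of _ "g 0 0 (tel_gen j 0)"]) simp_all
    qed
  qed
  show ?thesis using U T.derived_power_nonzero_then_zero[OF inf N nz] by blast
qed


section \<open>The truncated polynomial ring\<close>

text \<open>
  \<open>trunc_poly e\<close> extends the record of the quotient ring by the grading, so it is not literally that
  ring, although all operations coincide.
\<close>
lemma cring_congruent:
  assumes Q: "cring Q" and eq: "carrier L = carrier Q" "monoid.mult L = monoid.mult Q" "\<one>\<^bsub>L\<^esub> = \<one>\<^bsub>Q\<^esub>"
    "add L = add Q" "\<zero>\<^bsub>L\<^esub> = \<zero>\<^bsub>Q\<^esub>"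
  shows "cring L"
proof -
  interpret Q: cring Q by fact
  show ?thesis
  proof (rule cringI)
    show "abelian_group L"
    proof (rule abelian_groupI; unfold eq)
      show "\<exists>y\<in>carrier Q. y \<oplus>\<^bsub>Q\<^esub> x = \<zero>\<^bsub>Q\<^esub>" if "x \<in> carrier Q" for x
        using that Q.l_neg by (intro bexI[of _ "\<ominus>\<^bsub>Q\<^esub> x"]) auto
    qed (auto simp: Q.a_ac)
    show "comm_monoid L"
      by (rule comm_monoidI; unfold eq) (auto simp: Q.m_ac)
  qed (unfold eq, rule Q.l_distr)
qed

lemma monom_deg_superset:
  assumes "finite S" "Poly_Mapping.keys m \<subseteq> S"
  shows "monom_deg m = (\<Sum>j\<in>S. Poly_Mapping.lookup m j * 2 ^ (j + 1))"
  unfolding monom_deg_def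
  by (rule sum.mono_neutral_left) (use assms in \<open>auto simp: in_keys_iff\<close>)

lemma monom_deg_add: "monom_deg (m + m') = monom_deg m + monom_deg m'"
proof -
  let ?S = "Poly_Mapping.keys m \<union> Poly_Mapping.keys m'"
  have f: "finite ?S" by simp
  have "Poly_Mapping.keys (m + m') \<subseteq> ?S" by (rule keys_add)
  then show ?thesis
    using monom_deg_superset[OF f, of "m + m'"] monom_deg_superset[OF f, of m] monom_deg_superset[OF f, of m']
    by (simp add: lookup_add distrib_right sum.distrib)
qed

lemma monom_deg_zero: "monom_deg 0 = 0"
  by (simp add: monom_deg_def)

lemma monom_deg_single: "monom_deg (Poly_Mapping.single j n) = n * 2 ^ (j + 1)"
  by (cases "n = 0") (simp_all add: monom_deg_def)

lemma indet_power: "(indet i :: 'k::field mpoly) ^ n = Poly_Mapping.single (Poly_Mapping.single (i - 1) n) 1"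
proof (induction n)
  case 0
  show ?case by simp
next
  case (Suc n)
  then show ?case by (simp add: indet_def mult_single single_add[symmetric] del: power_Suc add: power_Suc)
qed

lemma countable_poly_mapping:
  assumes "countable (UNIV :: 'a set)" "countable (UNIV :: 'b::comm_monoid_add set)"
  shows "countable (UNIV :: ('a \<Rightarrow>\<^sub>0 'b) set)"
proof -
  let ?f = "\<lambda>xs :: ('a \<times> 'b) list. \<Sum>(m, c)\<leftarrow>xs. Poly_Mapping.single m c"
  have "countable ((UNIV :: 'a set) \<times> (UNIV :: 'b set))"
    using assms by (intro countable_SIGMA)
  then have "countable (lists (UNIV :: ('a \<times> 'b) set))" unfolding UNIV_Times_UNIV by (rule countable_lists)
  then have cf: "countable (?f ` lists UNIV)" by (rule countable_image)
  have "p \<in> ?f ` lists UNIV" for p :: "'a \<Rightarrow>\<^sub>0 'b"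
  proof -
    obtain ys where ys: "set ys = Poly_Mapping.keys p" "distinct ys"
      using finite_distinct_list[of "Poly_Mapping.keys p"] by auto
    have "p = (\<Sum>m\<in>Poly_Mapping.keys p. Poly_Mapping.single m (Poly_Mapping.lookup p m))"
    proof (rule poly_mapping_eqI)
      fix m
      show "Poly_Mapping.lookup p m
          = Poly_Mapping.lookup (\<Sum>m\<in>Poly_Mapping.keys p. Poly_Mapping.single m (Poly_Mapping.lookup p m)) m"
        by (simp add: lookup_sum lookup_single when_def in_keys_iff)
    qed
    also have "\<dots> = (\<Sum>m\<leftarrow>ys. Poly_Mapping.single m (Poly_Mapping.lookup p m))"
      unfolding ys(1)[symmetric] by (rule sum.distinct_set_conv_list[OF ys(2)])
    also have "\<dots> = ?f (map (\<lambda>m. (m, Poly_Mapping.lookup p m)) ys)"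
      unfolding map_map comp_def prod.case ..
    finally show ?thesis by (rule image_eqI) simp
  qed
  then have "UNIV \<subseteq> ?f ` lists UNIV" by blast
  then show ?thesis using cf countable_subset by blast
qed

locale truncated_polynomials =
  fixes e :: "nat \<Rightarrow> nat" and k :: "'k::field itself"
  assumes e: "\<And>i. i \<ge> 1 \<Longrightarrow> e i \<ge> 2"
begin

abbreviation A :: "'k mpoly ring" where "A \<equiv> ring_of_type_algebra"
abbreviation J :: "'k mpoly set" where "J \<equiv> trunc_ideal e"
abbreviation L :: "'k mpoly set graded_ring" where "L \<equiv> trunc_poly e"

lemma A_simps: "carrier A = UNIV" "x \<otimes>\<^bsub>A\<^esub> y = x * y" "x \<oplus>\<^bsub>A\<^esub> y = x + y" "\<zero>\<^bsub>A\<^esub> = 0" "\<one>\<^bsub>A\<^esub> = 1"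
  by (simp_all add: ring_of_type_algebra_def)

sublocale A: cring A by (rule cring_from_type_algebra)

lemma A_inv: "\<ominus>\<^bsub>A\<^esub> x = - x"
  by (rule A.minus_equality) (simp_all add: A_simps)

sublocale J: ideal J A
  unfolding trunc_ideal_def by (rule A.genideal_ideal) (simp add: A_simps)

definition res :: "'k mpoly \<Rightarrow> 'k mpoly set" where "res p = J +>\<^bsub>A\<^esub> p"

interpretation q: ring_hom_ring A "A Quot J" "(+>\<^bsub>A\<^esub>) J"
  by (rule J.rcos_ring_hom_ring)

lemma L_simps: "carrier L = carrier (A Quot J)" "monoid.mult L = monoid.mult (A Quot J)" "\<one>\<^bsub>L\<^esub> = \<one>\<^bsub>A Quot J\<^esub>"
    "add L = add (A Quot J)" "\<zero>\<^bsub>L\<^esub> = \<zero>\<^bsub>A Quot J\<^esub>" "homog L d = res ` homog_poly d"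
  by (simp_all add: trunc_poly_def ring.extend_def ring.defs graded_ring.defs res_def[abs_def])

lemma L_cring: "cring L"
  by (rule cring_congruent[OF J.quotient_is_cring L_simps(1-5)]) (rule A.is_cring)

lemma carrier_L: "carrier L = range res"
  by (auto simp: L_simps(1) FactRing_def A_RCOSETS_def' A_simps res_def)

lemma res_mult: "res p \<otimes>\<^bsub>L\<^esub> res p' = res (p * p')"
  using q.hom_mult[of p p'] by (simp add: L_simps(2) res_def A_simps)

lemma res_add: "res p \<oplus>\<^bsub>L\<^esub> res p' = res (p + p')"
  using q.hom_add[of p p'] by (simp add: L_simps(4) res_def A_simps)

lemma res_one: "\<one>\<^bsub>L\<^esub> = res 1"
  using q.hom_one by (simp add: L_simps(3) res_def A_simps)

lemma res_zero: "\<zero>\<^bsub>L\<^esub> = res 0"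
  using q.hom_zero by (simp add: L_simps(5) res_def A_simps)

lemma res_eq_zero_iff: "res p = \<zero>\<^bsub>L\<^esub> \<longleftrightarrow> p \<in> J"
proof -
  have z: "\<zero>\<^bsub>L\<^esub> = J" unfolding L_simps(5) FactRing_def by simp
  show ?thesis
  proof
    show "p \<in> J" if "res p = \<zero>\<^bsub>L\<^esub>"
      using that J.a_rcos_self[of p] unfolding z res_def by (simp add: A_simps)
    show "res p = \<zero>\<^bsub>L\<^esub>" if "p \<in> J"
      unfolding z res_def using that by (rule J.a_rcos_const)
  qed
qed

lemma homog_poly_zero: "0 \<in> homog_poly d"
  by (simp add: homog_poly_def)

lemma homog_poly_add: "p \<in> homog_poly d \<Longrightarrow> p' \<in> homog_poly d \<Longrightarrow> p + p' \<in> homog_poly d"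
  using keys_add[of p p'] unfolding homog_poly_def by blast

lemma homog_poly_uminus: "p \<in> homog_poly d \<Longrightarrow> - p \<in> homog_poly d"
  by (simp add: homog_poly_def)

lemma homog_poly_mult: "p \<in> homog_poly a \<Longrightarrow> p' \<in> homog_poly b \<Longrightarrow> p * p' \<in> homog_poly (a + b)"
  using keys_mult[of p p'] by (fastforce simp: homog_poly_def monom_deg_add)

lemma homog_poly_one: "1 \<in> homog_poly 0"
  by (simp add: homog_poly_def monom_deg_zero)

lemma L_graded_cring: "graded_cring L"
proof -
  interpret L: cring L by (rule L_cring)
  have neg: "inv\<^bsub>add_monoid L\<^esub> res p = res (- p)" for p
  proof -
    have "\<ominus>\<^bsub>L\<^esub> res p = res (- p)"
      by (rule L.minus_equality) (simp_all add: res_add res_zero carrier_L)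
    then show ?thesis by (simp add: a_inv_def)
  qed
  have "subgroup (homog L d) (add_monoid L)" for d
  proof (rule group.subgroupI[OF L.a_group])
    show "homog L d \<subseteq> carrier (add_monoid L)" by (auto simp: L_simps(6) carrier_L)
    show "homog L d \<noteq> {}" using homog_poly_zero by (auto simp: L_simps(6))
    show "inv\<^bsub>add_monoid L\<^esub> x \<in> homog L d" if "x \<in> homog L d" for x
      using that by (auto simp: L_simps(6) neg homog_poly_uminus)
    show "x \<otimes>\<^bsub>add_monoid L\<^esub> y \<in> homog L d" if "x \<in> homog L d" "y \<in> homog L d" for x y
      using that by (auto simp: L_simps(6) res_add homog_poly_add)
  qed
  moreover have "\<one>\<^bsub>L\<^esub> \<in> homog L 0"
    unfolding L_simps(6) res_one by (intro imageI homog_poly_one)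
  moreover have "r \<otimes>\<^bsub>L\<^esub> s \<in> homog L (a + b)" if "r \<in> homog L a" "s \<in> homog L b" for r s a b
    using that by (auto simp: L_simps(6) res_mult homog_poly_mult)
  ultimately show ?thesis
    by (intro graded_cring.intro graded_cring_axioms.intro L_cring)
qed

text \<open>
  The polynomials all of whose monomials are divisible by some \<open>x\<^bsub>j+1\<^esub> ^ e (j + 1)\<close> form an ideal that
  contains the generators of \<open>J\<close>. The shift comes from the numbering of the indeterminates, which starts
  at 0 in monomials.
\<close>
lemma truncated_monomials:
  assumes "p \<in> J" "m \<in> Poly_Mapping.keys p"
  shows "\<exists>j. Poly_Mapping.lookup m j \<ge> e (j + 1)"
proof -
  define K :: "'k mpoly set" where "K = {p. \<forall>m\<in>Poly_Mapping.keys p. \<exists>j. Poly_Mapping.lookup m j \<ge> e (j + 1)}"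
  have mult: "r * p \<in> K" if "p \<in> K" for r p
  proof -
    have "\<exists>j. Poly_Mapping.lookup m j \<ge> e (j + 1)" if m: "m \<in> Poly_Mapping.keys (r * p)" for m
    proof -
      obtain a b where "m = a + b" "b \<in> Poly_Mapping.keys p" using keys_mult[of r p] m by blast
      then show ?thesis using \<open>p \<in> K\<close> unfolding K_def by (fastforce simp: lookup_add intro: trans_le_add2)
    qed
    then show ?thesis by (simp add: K_def)
  qed
  have "ideal K A"
  proof (rule idealI)
    show "ring A" by (rule A.ring_axioms)
    show "subgroup K (add_monoid A)"
    proof (rule group.subgroupI[OF A.a_group])
      have "0 \<in> K" by (simp add: K_def)
      then show "K \<noteq> {}" by blast
      show "inv\<^bsub>add_monoid A\<^esub> x \<in> K" if "x \<in> K" for x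
        using that A_inv[of x] by (simp add: a_inv_def K_def)
      show "x \<otimes>\<^bsub>add_monoid A\<^esub> y \<in> K" if "x \<in> K" "y \<in> K" for x y
        using that keys_add[of x y] by (auto simp: K_def A_simps)
    qed (simp add: A_simps)
    show "r \<otimes>\<^bsub>A\<^esub> p \<in> K" "p \<otimes>\<^bsub>A\<^esub> r \<in> K" if "p \<in> K" for p r
      using mult[OF that, of r] by (simp_all add: A_simps mult.commute)
  qed
  moreover have "{indet i ^ e i | i. i \<ge> 1} \<subseteq> K"
  proof clarify
    fix i :: nat assume "i \<ge> 1"
    then have "Poly_Mapping.lookup (Poly_Mapping.single (i - 1) (e i)) (i - 1) \<ge> e (Suc (i - 1))" by simp
    then show "indet i ^ e i \<in> K"
      unfolding K_def indet_power by (simp del: lookup_single_eq) blast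
  qed
  ultimately have "J \<subseteq> K" unfolding trunc_ideal_def by (rule A.genideal_minimal)
  then show ?thesis using assms by (auto simp: K_def)
qed

lemma indet_power_in_J: "i \<ge> 1 \<Longrightarrow> n \<ge> e i \<Longrightarrow> indet i ^ n \<in> J"
proof -
  assume i: "i \<ge> 1" and n: "n \<ge> e i"
  have "indet i ^ e i \<in> J"
    using A.genideal_self[of "{indet i ^ e i | i. i \<ge> 1}"] i unfolding trunc_ideal_def by (auto simp: A_simps)
  then have "indet i ^ (n - e i) * indet i ^ e i \<in> J"
    using J.I_l_closed[of "indet i ^ e i" "indet i ^ (n - e i)"] by (simp add: A_simps)
  then show ?thesis using n by (simp add: power_add[symmetric])
qed

text \<open>
  The highest nonvanishing power of \<open>x\<^sub>i\<close> in the truncated ring.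
\<close>
definition socle :: "nat \<Rightarrow> 'k mpoly set" where
  "socle i = res (indet i ^ (e i - 1))"

lemma socle_homog: "i \<ge> 1 \<Longrightarrow> socle i \<in> homog L (int ((e i - 1) * 2 ^ i))"
  unfolding socle_def L_simps(6)
  by (intro imageI) (simp add: homog_poly_def indet_power monom_deg_single)

lemma socle_square: "i \<ge> 1 \<Longrightarrow> socle i \<otimes>\<^bsub>L\<^esub> socle i = \<zero>\<^bsub>L\<^esub>"
proof -
  assume i: "i \<ge> 1"
  have "e i \<le> (e i - 1) + (e i - 1)" using e[OF i] by simp
  then have "indet i ^ ((e i - 1) + (e i - 1)) \<in> J" by (rule indet_power_in_J[OF i])
  then show ?thesis by (simp add: socle_def res_mult res_eq_zero_iff power_add)
qed

lemma countable_carrier: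
  assumes k: "countable (UNIV :: 'k set)" shows "countable (carrier L)"
proof -
  have "countable (UNIV :: 'k mpoly set)"
    using k by (intro countable_poly_mapping countableI_type)
  then show ?thesis unfolding carrier_L by (rule countable_image)
qed

text \<open>
  The product is the class of a monomial with exponents \<open>e i - 1\<close>, which is not in \<open>J\<close> by
  \<open>truncated_monomials\<close>.
\<close>
lemma socle_prod_nonzero:
  assumes F: "finite F" "\<And>i. i \<in> F \<Longrightarrow> i \<ge> 1"
  shows "res (\<Prod>i\<in>F. indet i ^ (e i - 1)) \<noteq> \<zero>\<^bsub>L\<^esub>"
proof
  assume "res (\<Prod>i\<in>F. indet i ^ (e i - 1)) = \<zero>\<^bsub>L\<^esub>"
  then have J: "(\<Prod>i\<in>F. indet i ^ (e i - 1)) \<in> J" unfolding res_eq_zero_iff .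
  let ?m = "\<Sum>i\<in>F. Poly_Mapping.single (i - 1) (e i - 1)"
  have "(\<Prod>i\<in>F. indet i ^ (e i - 1) :: 'k mpoly) = Poly_Mapping.single ?m 1"
    using F(1) by (induction F rule: finite_induct) (simp_all add: indet_power mult_single)
  then obtain j where j: "Poly_Mapping.lookup ?m j \<ge> e (j + 1)"
    using truncated_monomials[OF J] by auto
  have "Poly_Mapping.lookup ?m j = (\<Sum>i\<in>F. if i = j + 1 then e i - 1 else 0)"
    unfolding lookup_sum
  proof (intro sum.cong refl)
    fix i assume "i \<in> F"
    then have "i - 1 = j \<longleftrightarrow> i = j + 1" using F(2)[of i] by auto
    then show "Poly_Mapping.lookup (Poly_Mapping.single (i - 1) (e i - 1)) j = (if i = j + 1 then e i - 1 else 0)"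
      by (simp add: lookup_single when_def)
  qed
  also have "\<dots> \<le> e (j + 1) - 1" using F(1) by (simp add: sum.delta)
  finally show False using j e[of "j + 1"] by simp
qed

lemma nilpotent_object_trunc_poly:
  assumes inf: "infinite (UNIV :: 'u set)" and k: "countable (UNIV :: 'k set)" and N: "N \<ge> 1"
  shows "\<exists>U :: ('k mpoly set, 'u) cochain_complex. is_complex L U \<and>
    \<not> derived_zero L (derived_power L U N) \<and> derived_zero L (derived_power L U (N + 1))"
proof -
  \<comment> \<open>Residues modulo \<open>N\<close> distribute the indeterminates over \<open>N\<close> infinite sequences, so that all the \<open>a j m\<close>
    involve different indeterminates.\<close>
  define ix where "ix j m = m * N + j + 1" for j m
  define s where "s j m = socle (ix j m)" for j m
  interpret T: nilpotent_telescopes L N s "\<lambda>j m. int ((e (ix j m) - 1) * 2 ^ ix j m)"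
  proof (rule nilpotent_telescopes.intro[OF L_graded_cring], unfold_locales)
    show "s j m \<in> homog L (int ((e (ix j m) - 1) * 2 ^ ix j m))" for j m
      unfolding s_def by (rule socle_homog) (simp add: ix_def)
    show "s j m \<otimes>\<^bsub>L\<^esub> s j m = \<zero>\<^bsub>L\<^esub>" for j m
      unfolding s_def by (rule socle_square) (simp add: ix_def)
  qed
  let ?x = "\<lambda>i. indet i ^ (e i - 1) :: 'k mpoly"
  have transition: "T.transition j 0 m = res (\<Prod>t<m. ?x (ix j t))" for j m
  proof (induction m)
    case (Suc m)
    have "s j m \<otimes>\<^bsub>L\<^esub> res (\<Prod>t<m. ?x (ix j t)) = res (\<Prod>t<Suc m. ?x (ix j t))"
      by (simp add: s_def socle_def res_mult mult.commute)
    then show ?case by (simp add: Suc.IH)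
  qed (simp add: res_one)
  have wprod: "T.wprod w m = res (\<Prod>j\<leftarrow>w. \<Prod>t<m. ?x (ix j t))" for w m
    by (induction w) (simp_all add: res_one res_mult transition)
  have "T.wprod [0..<N] m \<noteq> \<zero>\<^bsub>L\<^esub>" for m
  proof -
    have inj: "inj_on (\<lambda>(j, t). ix j t) ({..<N} \<times> {..<m})"
    proof (rule inj_onI, clarsimp simp: ix_def)
      fix j t j' t' assume j: "j < N" "j' < N" and eq: "t * N + j = t' * N + j'"
      from j have "(t * N + j) div N = t" "(t' * N + j') div N = t'" by simp_all
      then have "t = t'" using eq by metis
      then show "j = j' \<and> t = t'" using eq by simp
    qed
    have "(\<Prod>j\<leftarrow>[0..<N]. \<Prod>t<m. ?x (ix j t)) = (\<Prod>j<N. \<Prod>t<m. ?x (ix j t))"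
      by (simp add: prod.distinct_set_conv_list[symmetric] atLeast0LessThan)
    also have "\<dots> = (\<Prod>i\<in>(\<lambda>(j, t). ix j t) ` ({..<N} \<times> {..<m}). ?x i)"
      unfolding prod.cartesian_product prod.reindex[OF inj] by (simp add: case_prod_unfold)
    finally show ?thesis
      unfolding wprod by (simp only:) (rule socle_prod_nonzero, auto simp: ix_def)
  qed
  then show ?thesis using T.nilpotent_object[OF inf countable_carrier[OF k] N] by blast
qed

end

theorem theorem2:
  fixes e :: "nat \<Rightarrow> nat" and n :: nat
  assumes "countable (UNIV :: 'k::field set)"
    and "infinite (UNIV :: 'u set)"
    and "\<And>i. i \<ge> 1 \<Longrightarrow> e i \<ge> 2"
    and "n \<ge> 1"
  shows "\<exists>Xn :: ('k mpoly set, 'u) cochain_complex.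
           is_complex (trunc_poly e) Xn \<and>
           \<not> derived_zero (trunc_poly e) (derived_power (trunc_poly e) Xn n) \<and>
           derived_zero (trunc_poly e) (derived_power (trunc_poly e) Xn (n + 1))"
proof -
  interpret truncated_polynomials e "TYPE('k)" by unfold_locales (rule assms(3))
  show ?thesis by (rule nilpotent_object_trunc_poly[OF assms(2,1,4)])
qed

end
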